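(* Let $F_2=\langle a,b\rangle$ and $c=aba^{-2}b^{-2}a^2b^2a^{-1}b^{-1}\in F_2$. For integers $o_1,o_2\ge2$ let $c_{\boldsymbol{o}}$ be the image of $c$ under the natural homomorphism $F_2\to(\mathbb{Z}/o_1\mathbb{Z})*(\mathbb{Z}/o_2\mathbb{Z})$ (with $a$ mapping to a generator of the first factor and $b$ to a generator of the second). There exist constants $r,s\ge1$ such that whenever $o_1=6K+3$ and $o_2=6L+3$ with integers $K,L$ satisfying $L\ge rK$ and $K\ge s$, we have $$\mathrm{scl}(c_{\boldsymbol{o}})=1-\frac{3(o_1-1)}{o_1(o_1+1)}.$$
   Context: For a group $G$ and $g\in[G,G]$, the commutator length $\mathrm{cl}(g)$ is the minimal $n$ such that $g$ is a product of $n$ commutators in $G$, and the stable commutator length is $\mathrm{scl}_G(g)=\lim_{n\to\infty}\mathrm{cl}(g^n)/n$. Here scl is taken in $(\mathbb{Z}/o_1\mathbb{Z})*(\mathbb{Z}/o_2\mathbb{Z})$. *)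

theory Defs
  imports Complex_Main "HOL-Algebra.Elementary_Groups" "HOL-Algebra.Generated_Groups"
begin

section \<open>Monoids presented by generators and relations\<close>

inductive word_cong :: "'a set \<Rightarrow> ('a list \<times> 'a list) set \<Rightarrow> 'a list \<Rightarrow> 'a list \<Rightarrow> bool"
  for A R where
  cong_rel: "(u, v) \<in> R \<Longrightarrow> p \<in> lists A \<Longrightarrow> q \<in> lists A \<Longrightarrow> u \<in> lists A \<Longrightarrow> v \<in> lists A \<Longrightarrow>
    word_cong A R (p @ u @ q) (p @ v @ q)"
| cong_refl: "u \<in> lists A \<Longrightarrow> word_cong A R u u"
| cong_sym: "word_cong A R u v \<Longrightarrow> word_cong A R v u"
| cong_trans: "word_cong A R u v \<Longrightarrow> word_cong A R v w \<Longrightarrow> word_cong A R u w"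

definition word_class :: "'a set \<Rightarrow> ('a list \<times> 'a list) set \<Rightarrow> 'a list \<Rightarrow> 'a list set" where
  "word_class A R u = {v. word_cong A R u v}"

definition word_monoid :: "'a set \<Rightarrow> ('a list \<times> 'a list) set \<Rightarrow> 'a list set monoid" where
  "word_monoid A R =
    \<lparr>carrier = word_class A R ` lists A,
     monoid.mult = (\<lambda>U V. {w. \<exists>u\<in>U. \<exists>v\<in>V. word_cong A R (u @ v) w}),
     one = word_class A R []\<rparr>"

lemma word_cong_lists: "word_cong A R u v \<Longrightarrow> u \<in> lists A \<and> v \<in> lists A"
  by (induction rule: word_cong.induct) auto

lemma word_cong_context:
  assumes "word_cong A R u v" "p \<in> lists A" "q \<in> lists A"
  shows "word_cong A R (p @ u @ q) (p @ v @ q)"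
  using assms
proof (induction rule: word_cong.induct)
  case (cong_rel u v p' q')
  then have "word_cong A R ((p @ p') @ u @ (q' @ q)) ((p @ p') @ v @ (q' @ q))"
    by (intro word_cong.cong_rel) auto
  then show ?case by simp
next
  case (cong_refl u)
  then show ?case by (intro word_cong.cong_refl) auto
next
  case (cong_sym u v)
  then show ?case by (simp add: word_cong.cong_sym)
next
  case (cong_trans u v w)
  then show ?case using word_cong.cong_trans[of A R "p @ u @ q" "p @ v @ q"] by simp
qed

lemma word_cong_append:
  assumes "word_cong A R u u'" "word_cong A R v v'"
  shows "word_cong A R (u @ v) (u' @ v')"
proof -
  have "word_cong A R (u @ v) (u' @ v)"
    using word_cong_context[of A R u u' "[]" v] assms word_cong_lists[OF assms(2)] by simp
  moreover have "word_cong A R (u' @ v) (u' @ v')"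
    using word_cong_context[of A R v v' u' "[]"] assms word_cong_lists[OF assms(1)] by simp
  ultimately show ?thesis by (rule word_cong.cong_trans)
qed

lemma word_class_eq_iff:
  assumes "u \<in> lists A" "v \<in> lists A"
  shows "word_class A R u = word_class A R v \<longleftrightarrow> word_cong A R u v"
proof
  assume "word_class A R u = word_class A R v"
  moreover have "v \<in> word_class A R v" using assms by (simp add: word_class_def word_cong.cong_refl)
  ultimately have "v \<in> word_class A R u" by simp
  then show "word_cong A R u v" by (simp add: word_class_def)
next
  assume uv: "word_cong A R u v"
  show "word_class A R u = word_class A R v"
    unfolding word_class_def
    by (rule Collect_cong)
      (rule iffI, rule word_cong.cong_trans[OF word_cong.cong_sym[OF uv]], assumption,
        rule word_cong.cong_trans[OF uv], assumption)
qed

lemma word_class_mult: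
  assumes "u \<in> lists A" "v \<in> lists A"
  shows "word_class A R u \<otimes>\<^bsub>word_monoid A R\<^esub> word_class A R v = word_class A R (u @ v)"
proof -
  have 1: "word_cong A R (u @ v) w"
    if "word_cong A R u u'" "word_cong A R v v'" "word_cong A R (u' @ v') w" for u' v' w
    by (rule word_cong.cong_trans[OF word_cong_append[OF that(1,2)] that(3)])
  have 2: "word_cong A R u u" "word_cong A R v v"
    using assms by (simp_all add: word_cong.cong_refl)
  have "{w. \<exists>u'\<in>{u'. word_cong A R u u'}. \<exists>v'\<in>{v'. word_cong A R v v'}. word_cong A R (u' @ v') w} =
      {w. word_cong A R (u @ v) w}"
  proof (rule Collect_cong, rule iffI)
    fix w
    assume "\<exists>u'\<in>{u'. word_cong A R u u'}. \<exists>v'\<in>{v'. word_cong A R v v'}. word_cong A R (u' @ v') w"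
    then obtain u' v' where "word_cong A R u u'" "word_cong A R v v'" "word_cong A R (u' @ v') w"
      by (elim bexE CollectE)
    then show "word_cong A R (u @ v) w" by (rule 1)
  next
    fix w assume "word_cong A R (u @ v) w"
    then show "\<exists>u'\<in>{u'. word_cong A R u u'}. \<exists>v'\<in>{v'. word_cong A R v v'}. word_cong A R (u' @ v') w"
      by (intro bexI[of _ u] bexI[of _ v] CollectI 2)
  qed
  then show ?thesis by (simp add: word_monoid_def word_class_def)
qed

lemma word_monoid_monoid: "monoid (word_monoid A R)"
proof (rule monoidI)
  show "\<one>\<^bsub>word_monoid A R\<^esub> \<in> carrier (word_monoid A R)"
    by (auto simp: word_monoid_def)
next
  fix U V assume "U \<in> carrier (word_monoid A R)" "V \<in> carrier (word_monoid A R)"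
  then obtain u v where "u \<in> lists A" "v \<in> lists A" "U = word_class A R u" "V = word_class A R v"
    by (auto simp: word_monoid_def)
  then show "U \<otimes>\<^bsub>word_monoid A R\<^esub> V \<in> carrier (word_monoid A R)"
    using word_class_mult[of u A v R] by (auto simp: word_monoid_def)
next
  fix U V W assume "U \<in> carrier (word_monoid A R)" "V \<in> carrier (word_monoid A R)"
    "W \<in> carrier (word_monoid A R)"
  then obtain u v w where "u \<in> lists A" "v \<in> lists A" "w \<in> lists A"
    "U = word_class A R u" "V = word_class A R v" "W = word_class A R w"
    by (auto simp: word_monoid_def)
  then show "U \<otimes>\<^bsub>word_monoid A R\<^esub> V \<otimes>\<^bsub>word_monoid A R\<^esub> W =
      U \<otimes>\<^bsub>word_monoid A R\<^esub> (V \<otimes>\<^bsub>word_monoid A R\<^esub> W)"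
    by (simp add: word_class_mult)
next
  fix U assume "U \<in> carrier (word_monoid A R)"
  then obtain u where u: "u \<in> lists A" "U = word_class A R u"
    by (auto simp: word_monoid_def)
  have one: "\<one>\<^bsub>word_monoid A R\<^esub> = word_class A R []" by (simp add: word_monoid_def)
  show "\<one>\<^bsub>word_monoid A R\<^esub> \<otimes>\<^bsub>word_monoid A R\<^esub> U = U"
    "U \<otimes>\<^bsub>word_monoid A R\<^esub> \<one>\<^bsub>word_monoid A R\<^esub> = U"
    using u by (simp_all add: one word_class_mult)
qed

lemma word_monoid_group:
  assumes "\<And>x. x \<in> A \<Longrightarrow> \<exists>y\<in>A. word_cong A R [y, x] []"
  shows "group (word_monoid A R)"
proof -
  have inv: "\<exists>v\<in>lists A. word_cong A R (v @ u) []" if "u \<in> lists A" for u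
    using that
  proof (induction u)
    case Nil
    show ?case by (auto intro!: word_cong.cong_refl)
  next
    case (Cons x u)
    then obtain v y where v: "v \<in> lists A" "word_cong A R (v @ u) []"
      and y: "y \<in> A" "word_cong A R [y, x] []"
      using assms by blast
    have "word_cong A R (v @ [y, x] @ u) (v @ [] @ u)"
      using v y Cons by (intro word_cong_context) auto
    then have "word_cong A R ((v @ [y]) @ x # u) []"
      using word_cong.cong_trans[OF _ v(2)] by simp
    then show ?case using v y by (intro bexI[of _ "v @ [y]"]) auto
  qed
  interpret monoid "word_monoid A R" by (rule word_monoid_monoid)
  show ?thesis
  proof (rule groupI)
    fix U assume "U \<in> carrier (word_monoid A R)"
    then obtain u where u: "u \<in> lists A" "U = word_class A R u"
      by (auto simp: word_monoid_def)
    obtain v where v: "v \<in> lists A" "word_cong A R (v @ u) []" using inv u by blast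
    have "word_class A R v \<otimes>\<^bsub>word_monoid A R\<^esub> U = \<one>\<^bsub>word_monoid A R\<^esub>"
      using u v word_class_eq_iff[of "v @ u" A "[]" R]
      by (simp add: word_class_mult) (simp add: word_monoid_def)
    moreover have "word_class A R v \<in> carrier (word_monoid A R)"
      using v by (simp add: word_monoid_def)
    ultimately show "\<exists>V\<in>carrier (word_monoid A R).
        V \<otimes>\<^bsub>word_monoid A R\<^esub> U = \<one>\<^bsub>word_monoid A R\<^esub>"
      by blast
  qed (simp_all add: m_assoc)
qed

lemma word_monoid_lift:
  fixes G (structure)
  assumes "monoid G" and f: "\<And>x. x \<in> A \<Longrightarrow> f x \<in> carrier G"
    and R: "\<And>u v. (u, v) \<in> R \<Longrightarrow> foldr (\<otimes>) (map f u) \<one> = foldr (\<otimes>) (map f v) \<one>"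
  shows "\<exists>h\<in>hom (word_monoid A R) G. \<forall>x\<in>A. h (word_class A R [x]) = f x"
proof -
  interpret monoid G by fact
  define e where "e u = foldr (\<otimes>) (map f u) \<one>" for u
  have e_closed: "e u \<in> carrier G" if "u \<in> lists A" for u
    using that by (induction u) (auto simp: e_def f)
  have e_append: "e (u @ v) = e u \<otimes> e v" if "u \<in> lists A" "v \<in> lists A" for u v
    using that
  proof (induction u)
    case Nil then show ?case using e_closed[of v] by (simp add: e_def)
  next
    case (Cons x u)
    then show ?case using e_closed[of u] e_closed[of v] f by (simp add: e_def m_assoc)
  qed
  have e_cong: "e u = e v" if "word_cong A R u v" for u v
    using that
  proof (induction rule: word_cong.induct)
    case (cong_rel u v p q)
    have "e u = e v" using R[OF cong_rel(1)] by (simp add: e_def)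
    then show ?case using cong_rel by (simp add: e_append)
  qed auto
  define h where "h U = e (SOME u. u \<in> U)" for U
  have h: "h (word_class A R u) = e u" if "u \<in> lists A" for u
  proof -
    have "u \<in> word_class A R u" using that by (simp add: word_class_def word_cong.cong_refl)
    then have "(SOME v. v \<in> word_class A R u) \<in> word_class A R u" by (rule someI)
    then show ?thesis using e_cong by (simp add: h_def word_class_def)
  qed
  have "h \<in> hom (word_monoid A R) G"
  proof (rule homI)
    fix U assume "U \<in> carrier (word_monoid A R)"
    then obtain u where "u \<in> lists A" "U = word_class A R u" by (auto simp: word_monoid_def)
    then show "h U \<in> carrier G" using h e_closed by metis
  next
    fix U V assume "U \<in> carrier (word_monoid A R)" "V \<in> carrier (word_monoid A R)"
    then obtain u v where "u \<in> lists A" "v \<in> lists A" "U = word_class A R u" "V = word_class A R v"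
      by (auto simp: word_monoid_def)
    then show "h (U \<otimes>\<^bsub>word_monoid A R\<^esub> V) = h U \<otimes> h V"
      by (simp add: word_class_mult h e_append)
  qed
  moreover have "h (word_class A R [x]) = f x" if "x \<in> A" for x
    using that h[of "[x]"] f by (simp add: e_def)
  ultimately show ?thesis by blast
qed

section \<open>Free groups\<close>

text \<open>The letter \<open>(s, True)\<close> stands for the generator \<open>s\<close>, and \<open>(s, False)\<close> for its formal inverse.\<close>

definition free_rels :: "'s set \<Rightarrow> (('s \<times> bool) list \<times> ('s \<times> bool) list) set" where
  "free_rels S = {([(s, e), (s, \<not> e)], []) |s e. s \<in> S}"

definition free_group :: "'s set \<Rightarrow> ('s \<times> bool) list set monoid" where
  "free_group S = word_monoid (S \<times> UNIV) (free_rels S)"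

definition free_gen :: "'s set \<Rightarrow> 's \<Rightarrow> ('s \<times> bool) list set" where
  "free_gen S s = word_class (S \<times> UNIV) (free_rels S) [(s, True)]"

lemma free_rels_cong:
  "s \<in> S \<Longrightarrow> word_cong (S \<times> UNIV) (free_rels S) [(s, e), (s, \<not> e)] []"
  using word_cong.cong_rel[of "[(s, e), (s, \<not> e)]" "[]" "free_rels S" "[]" "S \<times> UNIV" "[]"]
  by (auto simp: free_rels_def)

lemma group_free_group: "group (free_group S)"
  unfolding free_group_def
proof (rule word_monoid_group)
  fix x :: "'a \<times> bool" assume "x \<in> S \<times> UNIV"
  then show "\<exists>y\<in>S \<times> UNIV. word_cong (S \<times> UNIV) (free_rels S) [y, x] []"
    using free_rels_cong[of "fst x" S "\<not> snd x"] by (intro bexI[of _ "(fst x, \<not> snd x)"]) auto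
qed

lemma free_gen_carrier: "s \<in> S \<Longrightarrow> free_gen S s \<in> carrier (free_group S)"
  by (auto simp: free_gen_def free_group_def word_monoid_def)

lemma free_group_lift:
  assumes "group G" "\<And>s. s \<in> S \<Longrightarrow> f s \<in> carrier G"
  shows "\<exists>h\<in>hom (free_group S) G. \<forall>s\<in>S. h (free_gen S s) = f s"
proof -
  interpret group G by fact
  let ?f = "\<lambda>(s, e). if e then f s else inv\<^bsub>G\<^esub> f s"
  have "\<exists>h\<in>hom (free_group S) G. \<forall>x\<in>S \<times> UNIV.
      h (word_class (S \<times> UNIV) (free_rels S) [x]) = ?f x"
    unfolding free_group_def
    by (rule word_monoid_lift) (use assms in \<open>auto simp: free_rels_def split: if_splits\<close>)
  then obtain h where "h \<in> hom (free_group S) G"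
    and h: "\<And>x. x \<in> S \<times> UNIV \<Longrightarrow> h (word_class (S \<times> UNIV) (free_rels S) [x]) = ?f x"
    by blast
  moreover have "h (free_gen S s) = f s" if "s \<in> S" for s
    using h[of "(s, True)"] that by (simp add: free_gen_def)
  ultimately show ?thesis by blast
qed

section \<open>Free products of two groups\<close>

definition free_prod_rels :: "('a, 'm) monoid_scheme \<Rightarrow> ('b, 'n) monoid_scheme
    \<Rightarrow> (('a + 'b) list \<times> ('a + 'b) list) set" where
  "free_prod_rels G H =
    {([Inl x, Inl y], [Inl (x \<otimes>\<^bsub>G\<^esub> y)]) |x y. x \<in> carrier G \<and> y \<in> carrier G} \<union>
    {([Inr x, Inr y], [Inr (x \<otimes>\<^bsub>H\<^esub> y)]) |x y. x \<in> carrier H \<and> y \<in> carrier H} \<union>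
    {([Inl \<one>\<^bsub>G\<^esub>], []), ([Inr \<one>\<^bsub>H\<^esub>], [])}"

definition free_prod :: "('a, 'm) monoid_scheme \<Rightarrow> ('b, 'n) monoid_scheme
    \<Rightarrow> ('a + 'b) list set monoid" where
  "free_prod G H = word_monoid (carrier G <+> carrier H) (free_prod_rels G H)"

definition free_prod_inl :: "('a, 'm) monoid_scheme \<Rightarrow> ('b, 'n) monoid_scheme
    \<Rightarrow> 'a \<Rightarrow> ('a + 'b) list set" where
  "free_prod_inl G H x = word_class (carrier G <+> carrier H) (free_prod_rels G H) [Inl x]"

definition free_prod_inr :: "('a, 'm) monoid_scheme \<Rightarrow> ('b, 'n) monoid_scheme
    \<Rightarrow> 'b \<Rightarrow> ('a + 'b) list set" where
  "free_prod_inr G H y = word_class (carrier G <+> carrier H) (free_prod_rels G H) [Inr y]"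

lemma free_prod_rels_cong:
  assumes "(u, v) \<in> free_prod_rels G H" "u \<in> lists (carrier G <+> carrier H)"
    "v \<in> lists (carrier G <+> carrier H)"
  shows "word_cong (carrier G <+> carrier H) (free_prod_rels G H) u v"
  using word_cong.cong_rel[of u v "free_prod_rels G H" "[]" "carrier G <+> carrier H" "[]"] assms
  by simp

lemma group_free_prod:
  assumes "group G" "group H"
  shows "group (free_prod G H)"
  unfolding free_prod_def
proof (rule word_monoid_group)
  interpret G: group G by fact
  interpret H: group H by fact
  let ?C = "word_cong (carrier G <+> carrier H) (free_prod_rels G H)"
  fix x assume "x \<in> carrier G <+> carrier H"
  then show "\<exists>y\<in>carrier G <+> carrier H. ?C [y, x] []"
  proof
    fix g assume g: "g \<in> carrier G" "x = Inl g"
    have "?C [Inl (inv\<^bsub>G\<^esub> g), Inl g] [Inl (inv\<^bsub>G\<^esub> g \<otimes>\<^bsub>G\<^esub> g)]"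
      using g by (intro free_prod_rels_cong) (auto simp: free_prod_rels_def)
    moreover have "?C [Inl \<one>\<^bsub>G\<^esub>] []"
      by (intro free_prod_rels_cong) (auto simp: free_prod_rels_def)
    ultimately have "?C [Inl (inv\<^bsub>G\<^esub> g), x] []"
      using g word_cong.cong_trans[of _ _ "[Inl (inv\<^bsub>G\<^esub> g), Inl g]" "[Inl \<one>\<^bsub>G\<^esub>]" "[]"] by simp
    then show ?thesis using g by blast
  next
    fix g assume g: "g \<in> carrier H" "x = Inr g"
    have "?C [Inr (inv\<^bsub>H\<^esub> g), Inr g] [Inr (inv\<^bsub>H\<^esub> g \<otimes>\<^bsub>H\<^esub> g)]"
      using g by (intro free_prod_rels_cong) (auto simp: free_prod_rels_def)
    moreover have "?C [Inr \<one>\<^bsub>H\<^esub>] []"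
      by (intro free_prod_rels_cong) (auto simp: free_prod_rels_def)
    ultimately have "?C [Inr (inv\<^bsub>H\<^esub> g), x] []"
      using g word_cong.cong_trans[of _ _ "[Inr (inv\<^bsub>H\<^esub> g), Inr g]" "[Inr \<one>\<^bsub>H\<^esub>]" "[]"] by simp
    then show ?thesis using g by blast
  qed
qed

lemma free_prod_inl_hom:
  assumes "group G"
  shows "free_prod_inl G H \<in> hom G (free_prod G H)"
proof (rule homI)
  interpret group G by fact
  fix x assume x: "x \<in> carrier G"
  then show "free_prod_inl G H x \<in> carrier (free_prod G H)"
    by (auto simp: free_prod_inl_def free_prod_def word_monoid_def)
  fix y assume y: "y \<in> carrier G"
  have "word_cong (carrier G <+> carrier H) (free_prod_rels G H) [Inl x, Inl y] [Inl (x \<otimes>\<^bsub>G\<^esub> y)]"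
    using x y by (intro free_prod_rels_cong) (auto simp: free_prod_rels_def)
  then show "free_prod_inl G H (x \<otimes>\<^bsub>G\<^esub> y) =
      free_prod_inl G H x \<otimes>\<^bsub>free_prod G H\<^esub> free_prod_inl G H y"
    using x y word_class_eq_iff[of "[Inl x, Inl y]" "carrier G <+> carrier H" "[Inl (x \<otimes>\<^bsub>G\<^esub> y)]" "free_prod_rels G H"]
      word_class_mult[of "[Inl x]" "carrier G <+> carrier H" "[Inl y]" "free_prod_rels G H"]
    by (simp add: free_prod_inl_def free_prod_def InlI InrI)
qed

lemma free_prod_inr_hom:
  assumes "group H"
  shows "free_prod_inr G H \<in> hom H (free_prod G H)"
proof (rule homI)
  interpret group H by fact
  fix x assume x: "x \<in> carrier H"
  then show "free_prod_inr G H x \<in> carrier (free_prod G H)"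
    by (auto simp: free_prod_inr_def free_prod_def word_monoid_def)
  fix y assume y: "y \<in> carrier H"
  have "word_cong (carrier G <+> carrier H) (free_prod_rels G H) [Inr x, Inr y] [Inr (x \<otimes>\<^bsub>H\<^esub> y)]"
    using x y by (intro free_prod_rels_cong) (auto simp: free_prod_rels_def)
  then show "free_prod_inr G H (x \<otimes>\<^bsub>H\<^esub> y) =
      free_prod_inr G H x \<otimes>\<^bsub>free_prod G H\<^esub> free_prod_inr G H y"
    using x y word_class_eq_iff[of "[Inr x, Inr y]" "carrier G <+> carrier H" "[Inr (x \<otimes>\<^bsub>H\<^esub> y)]" "free_prod_rels G H"]
      word_class_mult[of "[Inr x]" "carrier G <+> carrier H" "[Inr y]" "free_prod_rels G H"]
    by (simp add: free_prod_inr_def free_prod_def InlI InrI)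
qed

lemma free_prod_lift:
  assumes "group G" "group H" "group M" and f: "f \<in> hom G M" and g: "g \<in> hom H M"
  shows "\<exists>h\<in>hom (free_prod G H) M.
    (\<forall>x\<in>carrier G. h (free_prod_inl G H x) = f x) \<and>
    (\<forall>y\<in>carrier H. h (free_prod_inr G H y) = g y)"
proof -
  interpret M: group M by fact
  interpret F: group_hom G M f using assms by (simp add: group_hom_def group_hom_axioms_def)
  interpret K: group_hom H M g using assms by (simp add: group_hom_def group_hom_axioms_def)
  have "\<exists>h\<in>hom (free_prod G H) M. \<forall>x\<in>carrier G <+> carrier H.
      h (word_class (carrier G <+> carrier H) (free_prod_rels G H) [x]) = case_sum f g x"
    unfolding free_prod_def
    by (rule word_monoid_lift)
      (auto simp: free_prod_rels_def M.m_assoc M.is_monoid)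
  then obtain h where "h \<in> hom (free_prod G H) M"
    and h: "\<And>x. x \<in> carrier G <+> carrier H \<Longrightarrow>
      h (word_class (carrier G <+> carrier H) (free_prod_rels G H) [x]) = case_sum f g x"
    by blast
  moreover have "h (free_prod_inl G H x) = f x" if "x \<in> carrier G" for x
    using h[of "Inl x"] that by (simp add: free_prod_inl_def InlI)
  moreover have "h (free_prod_inr G H y) = g y" if "y \<in> carrier H" for y
    using h[of "Inr y"] that by (simp add: free_prod_inr_def InrI)
  ultimately show ?thesis by blast
qed

section \<open>Stable commutator length\<close>

definition comm_length :: "('a, 'm) monoid_scheme \<Rightarrow> 'a \<Rightarrow> nat" where
  "comm_length G g = (LEAST n. \<exists>xs. length xs = n \<and> set xs \<subseteq> derived_set G (carrier G) \<and>
    foldr (\<otimes>\<^bsub>G\<^esub>) xs \<one>\<^bsub>G\<^esub> = g)"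

text \<open>In a group, both notions are meaningful only for \<open>g \<in> derived G (carrier G)\<close>: otherwise the set of
  admissible \<open>n\<close> may be empty. For such \<open>g\<close> the sequence \<open>n \<mapsto> comm_length G (g [^] n)\<close> is subadditive,
  so the limit exists.\<close>

definition scl :: "('a, 'm) monoid_scheme \<Rightarrow> 'a \<Rightarrow> real" where
  "scl G g = lim (\<lambda>n. real (comm_length G (g [^]\<^bsub>G\<^esub> n)) / real n)"

section \<open>The word and its image\<close>

datatype two_gens = GenA | GenB

abbreviation F2 :: "(two_gens \<times> bool) list set monoid" where
  "F2 \<equiv> free_group UNIV"

abbreviation gen_a :: "(two_gens \<times> bool) list set" where
  "gen_a \<equiv> free_gen UNIV GenA"

abbreviation gen_b :: "(two_gens \<times> bool) list set" where
  "gen_b \<equiv> free_gen UNIV GenB"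

definition word_c :: "(two_gens \<times> bool) list set" where
  "word_c = gen_a \<otimes>\<^bsub>F2\<^esub> gen_b \<otimes>\<^bsub>F2\<^esub> gen_a [^]\<^bsub>F2\<^esub> (-2::int) \<otimes>\<^bsub>F2\<^esub> gen_b [^]\<^bsub>F2\<^esub> (-2::int)
    \<otimes>\<^bsub>F2\<^esub> gen_a [^]\<^bsub>F2\<^esub> (2::int) \<otimes>\<^bsub>F2\<^esub> gen_b [^]\<^bsub>F2\<^esub> (2::int)
    \<otimes>\<^bsub>F2\<^esub> gen_a [^]\<^bsub>F2\<^esub> (-1::int) \<otimes>\<^bsub>F2\<^esub> gen_b [^]\<^bsub>F2\<^esub> (-1::int)"

abbreviation cyclic_prod :: "nat \<Rightarrow> nat \<Rightarrow> (int + int) list set monoid" where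
  "cyclic_prod m n \<equiv> free_prod (integer_mod_group m) (integer_mod_group n)"

definition natural_hom :: "nat \<Rightarrow> nat
    \<Rightarrow> ((two_gens \<times> bool) list set \<Rightarrow> (int + int) list set) \<Rightarrow> bool" where
  "natural_hom m n \<phi> \<longleftrightarrow> \<phi> \<in> hom F2 (cyclic_prod m n) \<and>
    (\<exists>x\<in>carrier (integer_mod_group m). \<exists>y\<in>carrier (integer_mod_group n).
      generate (integer_mod_group m) {x} = carrier (integer_mod_group m) \<and>
      generate (integer_mod_group n) {y} = carrier (integer_mod_group n) \<and>
      \<phi> gen_a = free_prod_inl (integer_mod_group m) (integer_mod_group n) x \<and>
      \<phi> gen_b = free_prod_inr (integer_mod_group m) (integer_mod_group n) y)"

lemma generate_integer_mod_group:
  assumes "n \<ge> 2"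
  shows "generate (integer_mod_group n) {1} = carrier (integer_mod_group n)"
proof -
  interpret group "integer_mod_group n" by simp
  have 1: "1 \<in> carrier (integer_mod_group n)" using assms by (simp add: carrier_integer_mod_group)
  have "k \<in> generate (integer_mod_group n) {1}" if "k \<in> carrier (integer_mod_group n)" for k
  proof -
    have "k = 1 [^]\<^bsub>integer_mod_group n\<^esub> k"
      using that assms by (simp add: int_pow_integer_mod_group carrier_integer_mod_group)
    then show ?thesis using generate_pow[OF 1] by blast
  qed
  moreover have "generate (integer_mod_group n) {1} \<subseteq> carrier (integer_mod_group n)"
    using 1 by (intro generate_incl) auto
  ultimately show ?thesis by blast
qed

lemma natural_hom_exists:
  assumes "m \<ge> 2" "n \<ge> 2"
  shows "\<exists>\<phi>. natural_hom m n \<phi>"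
proof -
  let ?G = "integer_mod_group m" and ?H = "integer_mod_group n"
  have 1: "1 \<in> carrier ?G" "1 \<in> carrier ?H" using assms by (auto simp: carrier_integer_mod_group)
  let ?f = "case_two_gens (free_prod_inl ?G ?H 1) (free_prod_inr ?G ?H 1)"
  have grp: "group (cyclic_prod m n)" by (intro group_free_prod group_integer_mod_group)
  have f: "?f s \<in> carrier (cyclic_prod m n)" for s
    using hom_in_carrier[OF free_prod_inl_hom[OF group_integer_mod_group] 1(1), of ?H]
      hom_in_carrier[OF free_prod_inr_hom[OF group_integer_mod_group] 1(2), of ?G]
    by (cases s) (simp_all only: two_gens.case)
  obtain \<phi> where \<phi>: "\<phi> \<in> hom F2 (cyclic_prod m n)"
    and gens: "\<forall>s\<in>UNIV. \<phi> (free_gen UNIV s) = ?f s"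
    using free_group_lift[where f = ?f and S = UNIV, OF grp f] by (elim bexE)
  have "\<phi> gen_a = free_prod_inl ?G ?H 1" "\<phi> gen_b = free_prod_inr ?G ?H 1"
    using gens by simp_all
  then have "natural_hom m n \<phi>"
    unfolding natural_hom_def
    using 1 \<phi> generate_integer_mod_group[OF assms(1)] generate_integer_mod_group[OF assms(2)]
    by blast
  then show ?thesis by (rule exI[of _ \<phi>])
qed

lemma (in group) word_c_derived:
  assumes a: "a \<in> carrier G" and b: "b \<in> carrier G"
  shows "a \<otimes> b \<otimes> a [^] (-2::int) \<otimes> b [^] (-2::int) \<otimes> a [^] (2::int) \<otimes> b [^] (2::int)
    \<otimes> a [^] (-1::int) \<otimes> b [^] (-1::int) \<in> derived G (carrier G)" (is "?c \<in> _")
proof -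
  define x y p where "x = a [^] (2::int)" and "y = b [^] (2::int)" and "p = a \<otimes> b"
  have cl: "x \<in> carrier G" "y \<in> carrier G" "p \<in> carrier G" using a b by (auto simp: x_def y_def p_def)
  define U V where "U = p \<otimes> inv x \<otimes> inv p" and "V = p \<otimes> inv y \<otimes> inv p"
  have UV: "U \<in> carrier G" "V \<in> carrier G" using cl by (auto simp: U_def V_def)
  have cancel: "inv u \<otimes> (u \<otimes> v) = v" if "u \<in> carrier G" "v \<in> carrier G" for u v
    using that by (simp add: m_assoc[symmetric])
  have c1: "U \<otimes> V \<otimes> inv U \<otimes> inv V = p \<otimes> inv x \<otimes> inv y \<otimes> x \<otimes> y \<otimes> inv p"
    using cl by (simp add: U_def V_def m_assoc inv_mult_group cancel)
  have pab: "inv p \<otimes> (a \<otimes> (b \<otimes> (inv a \<otimes> inv b))) = inv a \<otimes> inv b"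
    using a b by (simp add: p_def m_assoc inv_mult_group cancel)
  have "?c = p \<otimes> inv x \<otimes> inv y \<otimes> x \<otimes> y \<otimes> inv a \<otimes> inv b"
    unfolding int_pow_neg[OF a, of 2] int_pow_neg[OF b, of 2] int_pow_neg[OF a, of 1]
      int_pow_neg[OF b, of 1] int_pow_1[OF a] int_pow_1[OF b] x_def y_def p_def by (rule refl)
  also have "\<dots> = (U \<otimes> V \<otimes> inv U \<otimes> inv V) \<otimes> (a \<otimes> b \<otimes> inv a \<otimes> inv b)"
    unfolding c1 using cl a b by (simp add: m_assoc pab)
  finally have c2: "?c = (U \<otimes> V \<otimes> inv U \<otimes> inv V) \<otimes> (a \<otimes> b \<otimes> inv a \<otimes> inv b)" .
  have "u \<otimes> v \<otimes> inv u \<otimes> inv v \<in> derived_set G (carrier G)"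
    if "u \<in> carrier G" "v \<in> carrier G" for u v
    by (rule UN_I, rule that(1), rule UN_I, rule that(2), rule singletonI)
  from this[OF UV, THEN generate.incl] this[OF a b, THEN generate.incl]
  show ?thesis unfolding c2 derived_def by (rule generate.eng)
qed

lemma natural_hom_word_c_derived:
  assumes "natural_hom m n \<phi>"
  shows "\<phi> word_c \<in> derived (cyclic_prod m n) (carrier (cyclic_prod m n))"
proof -
  interpret F: group F2 by (rule group_free_group)
  interpret P: group "cyclic_prod m n" by (simp add: group_free_prod)
  interpret group_hom F2 "cyclic_prod m n" \<phi>
    using assms by unfold_locales (simp add: natural_hom_def)
  have c: "gen_a \<in> carrier F2" "gen_b \<in> carrier F2" by (simp_all add: free_gen_carrier)
  from P.word_c_derived[OF c[THEN hom_closed]] show ?thesis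
    unfolding word_c_def
    by (simp only: hom_mult hom_int_pow c F.m_closed F.int_pow_closed)
qed

end

theory Submission
  imports Defs "HOL-Combinatorics.Orbits" "HOL-Combinatorics.Cycles"
begin

text \<open>
  Lower bound. A product of \<open>k\<close> commutators in the free product bounds a surface, encoded by a
  type-preserving permutation \<open>\<tau>\<close> of the letters of a cyclic word with successor \<open>\<sigma>\<close>: the cycles of \<open>\<tau>\<close>
  with trivial product are discs mapped to one of the factors, and the cycles of \<open>\<tau>\<^sup>-\<^sup>1 \<sigma>\<close> are discs
  mapped to the base point. The number of these discs minus the length of the word can be kept at
  least \<open>1 - 2 k\<close> under the defining relations of the free product, so it is attained on the \<open>n\<close>-th power
  of the reduced word. There all cycles of \<open>\<tau>\<^sup>-\<^sup>1 \<sigma>\<close> may be taken of length two, and the number of discs is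
  bounded by weights on pairs of consecutive letters that add up to at least one around every disc.

  Upper bound. Let \<open>o\<^sub>1 = 2 N + 3\<close>. Two copies of \<open>c\<close> differ from a commutator by the elements \<open>a\<^sup>3\<close>,
  \<open>a\<^sup>-\<^sup>2\<close>, \<open>a\<^sup>-\<^sup>1\<close>, and one copy splits into \<open>a\<^sup>2\<close>, \<open>a\<^sup>-\<^sup>3\<close>, \<open>a\<close>, up to conjugation. The relations
  \<open>a\<^sup>3 (a\<^sup>2)\<^sup>N = 1\<close> and \<open>(a\<^sup>-\<^sup>2)\<^sup>N a\<^sup>-\<^sup>3 = 1\<close> let these factors cancel in groups, and a leftover factor of order
  \<open>p\<close> costs only \<open>1 - 1/p\<close>.
\<close>

section \<open>Orbits of permutations composed with a transposition\<close>

text \<open>Pieces that are not discs have Euler characteristic at most zero, so counting discs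
  suffices, and maximising their number is a linear programme. Write \<open>d\<close> for the order
  of the first factor. The extremal disc has one letter \<open>a\<close> and (d - 1)/2 letters
  \<open>a^2\<close>; tightness of the dual weights on it forces \<eta> = 12/(d + 1), the source of
  the factor o1 + 1 in the value. The obstacle in checking the weights is the infinity of closed
  walks. A sign change of the exponent costs d/2, so walks with more than two changes are settled by
  the size of \<open>d\<close>; walks with two changes and exponent sum zero reduce to a finite
  table, since the weight of a run is bounded in terms of its end letters and a truncated sum. Discs
  of one sign in the second factor are harmless once its order is at least 5 d; this is the role of
  L \<ge> r K. The upper bound needs a recursion: a remainder R with c2^m = R a^2 is replaced by one
  for m + N (N + 2). With V the claimed value, each round takes N (N + 2) copies of the word at the
  rate of V commutators per copy. The excess of the initial copy is bounded and disappears only in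
  the limit of many rounds.\<close>

abbreviation finv :: "('a \<Rightarrow> 'b) \<Rightarrow> 'b \<Rightarrow> 'a" where
  "finv f \<equiv> inv_into UNIV f"

definition orbits_on :: "('a \<Rightarrow> 'a) \<Rightarrow> 'a set \<Rightarrow> 'a set set" where
  "orbits_on f X = orbit f ` X"

definition num_orbits :: "('a \<Rightarrow> 'a) \<Rightarrow> 'a set \<Rightarrow> nat" where
  "num_orbits f X = card (orbits_on f X)"

definition num_good_orbits :: "('a set \<Rightarrow> bool) \<Rightarrow> ('a \<Rightarrow> 'a) \<Rightarrow> 'a set \<Rightarrow> nat" where
  "num_good_orbits P f X = card {A \<in> orbits_on f X. P A}"

lemma permutes_self_in_orbit:
  assumes "f permutes X" "finite X"
  shows "x \<in> orbit f x"
  using assms by (intro permutation_self_in_orbit) (auto simp: permutation_permutes)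

lemma permutes_orbit_eq:
  assumes "f permutes X" "finite X" "y \<in> orbit f x"
  shows "orbit f y = orbit f x"
  using orbit_cyclic_eq3[OF cyclic_on_orbit[OF assms(1,2)] assms(3)] .

lemma orbits_on_disjoint:
  assumes "f permutes X" "finite X" "A \<in> orbits_on f X" "B \<in> orbits_on f X" "A \<noteq> B"
  shows "A \<inter> B = {}"
proof (rule ccontr)
  assume "A \<inter> B \<noteq> {}"
  then obtain z where "z \<in> A" "z \<in> B" by blast
  moreover obtain x y where "A = orbit f x" "B = orbit f y"
    using assms(3,4) by (auto simp: orbits_on_def)
  ultimately show False using permutes_orbit_eq[OF assms(1,2)] assms(5) by metis
qed

lemma Union_orbits_on:
  assumes "f permutes X" "finite X"
  shows "\<Union>(orbits_on f X) = X"
proof (intro equalityI subsetI)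
  fix x assume "x \<in> X"
  then show "x \<in> \<Union>(orbits_on f X)"
    unfolding orbits_on_def using permutes_self_in_orbit[OF assms, of x] by auto
qed (use permutes_orbit_subset[OF assms(1)] in \<open>auto simp: orbits_on_def\<close>)

lemma orbits_on_sum:
  fixes w :: "'a \<Rightarrow> 'b::comm_monoid_add"
  assumes "f permutes X" "finite X"
  shows "(\<Sum>x\<in>X. w x) = (\<Sum>A\<in>orbits_on f X. \<Sum>x\<in>A. w x)"
proof -
  have "sum w (\<Union>(orbits_on f X)) = (sum \<circ> sum) w (orbits_on f X)"
  proof (intro sum.Union_disjoint ballI impI)
    fix A assume "A \<in> orbits_on f X"
    then show "finite A"
      using permutes_orbit_subset[OF assms(1)] assms(2)
      by (auto simp: orbits_on_def intro: finite_subset)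
  qed (rule orbits_on_disjoint[OF assms])
  then show ?thesis by (simp add: Union_orbits_on[OF assms])
qed

lemma permutes_comp_transpose:
  assumes "f permutes X" "x \<in> X" "y \<in> X"
  shows "f \<circ> transpose x y permutes X"
  using assms by (intro permutes_compose permutes_swap_id)

text \<open>Composition with a transposition changes only the orbits through its two points. All
  counts below are therefore compared on at most two orbits before and at most two after.\<close>

definition orbits_avoiding :: "('a \<Rightarrow> 'a) \<Rightarrow> 'a set \<Rightarrow> 'a \<Rightarrow> 'a \<Rightarrow> 'a set set" where
  "orbits_avoiding f X x y = {A \<in> orbits_on f X. x \<notin> A \<and> y \<notin> A}"

lemma orbit_comp_transpose_avoiding:
  assumes "f permutes X" "finite X" "x \<notin> orbit f z" "y \<notin> orbit f z"
  shows "orbit (f \<circ> transpose x y) z = orbit f z"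
proof (rule orbit_cong)
  show "z \<in> orbit f z" by (rule permutes_self_in_orbit[OF assms(1,2)])
  fix s assume "s \<in> orbit f z"
  then have "s \<noteq> x" "s \<noteq> y" using assms by auto
  then show "(f \<circ> transpose x y) s = f s" by simp
qed

lemma orbits_avoiding_subset:
  assumes "f permutes X" "finite X"
  shows "orbits_avoiding f X x y \<subseteq> orbits_avoiding (f \<circ> transpose x y) X x y"
proof
  fix A assume "A \<in> orbits_avoiding f X x y"
  then obtain z where z: "z \<in> X" "A = orbit f z" "x \<notin> A" "y \<notin> A"
    by (auto simp: orbits_avoiding_def orbits_on_def)
  then have "orbit (f \<circ> transpose x y) z = A"
    using orbit_comp_transpose_avoiding[OF assms] by simp
  with z show "A \<in> orbits_avoiding (f \<circ> transpose x y) X x y"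
    by (auto simp: orbits_avoiding_def orbits_on_def)
qed

lemma orbits_avoiding_comp_transpose:
  assumes "f permutes X" "finite X" "x \<in> X" "y \<in> X"
  shows "orbits_avoiding (f \<circ> transpose x y) X x y = orbits_avoiding f X x y"
proof
  have "f \<circ> transpose x y \<circ> transpose x y = f" by (simp add: comp_assoc)
  then show "orbits_avoiding (f \<circ> transpose x y) X x y \<subseteq> orbits_avoiding f X x y"
    using orbits_avoiding_subset[OF permutes_comp_transpose[OF assms(1,3,4)] assms(2), of x y]
    by simp
qed (rule orbits_avoiding_subset[OF assms(1,2)])

lemma orbits_on_split:
  assumes "f permutes X" "finite X" "x \<in> X" "y \<in> X"
  shows "orbits_on f X = orbits_avoiding f X x y \<union> {orbit f x, orbit f y}"
    and "orbits_avoiding f X x y \<inter> {orbit f x, orbit f y} = {}"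
    and "finite (orbits_avoiding f X x y)"
proof -
  show "orbits_on f X = orbits_avoiding f X x y \<union> {orbit f x, orbit f y}"
  proof (intro equalityI subsetI)
    fix A assume A: "A \<in> orbits_on f X"
    then obtain z where "A = orbit f z" by (auto simp: orbits_on_def)
    then have "A = orbit f x" if "x \<in> A" for x
      using that permutes_orbit_eq[OF assms(1,2), of x z] by simp
    then show "A \<in> orbits_avoiding f X x y \<union> {orbit f x, orbit f y}"
      using A by (auto simp: orbits_avoiding_def)
  qed (use assms(3,4) in \<open>auto simp: orbits_avoiding_def orbits_on_def\<close>)
  show "orbits_avoiding f X x y \<inter> {orbit f x, orbit f y} = {}"
    using permutes_self_in_orbit[OF assms(1,2)] by (auto simp: orbits_avoiding_def)
  show "finite (orbits_avoiding f X x y)"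
    using assms(2) by (simp add: orbits_avoiding_def orbits_on_def)
qed

lemma num_orbits_split:
  assumes "f permutes X" "finite X" "x \<in> X" "y \<in> X"
  shows "num_orbits f X = card (orbits_avoiding f X x y) + card {orbit f x, orbit f y}"
  unfolding num_orbits_def orbits_on_split(1)[OF assms]
  by (rule card_Un_disjoint[OF orbits_on_split(3)[OF assms] _ orbits_on_split(2)[OF assms]]) simp

lemma Collect_disj_Un: "{A \<in> S \<union> T. P A} = {A \<in> S. P A} \<union> {A \<in> T. P A}"
  by blast

lemma num_good_orbits_split:
  assumes "f permutes X" "finite X" "x \<in> X" "y \<in> X"
  shows "num_good_orbits P f X =
    card {A \<in> orbits_avoiding f X x y. P A} + card {A \<in> {orbit f x, orbit f y}. P A}"
proof -
  have "{A \<in> orbits_on f X. P A} =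
      {A \<in> orbits_avoiding f X x y. P A} \<union> {A \<in> {orbit f x, orbit f y}. P A}"
    unfolding orbits_on_split(1)[OF assms] by (rule Collect_disj_Un)
  moreover have "card ({A \<in> orbits_avoiding f X x y. P A} \<union> {A \<in> {orbit f x, orbit f y}. P A}) =
      card {A \<in> orbits_avoiding f X x y. P A} + card {A \<in> {orbit f x, orbit f y}. P A}"
  proof (rule card_Un_disjoint)
    show "{A \<in> orbits_avoiding f X x y. P A} \<inter> {A \<in> {orbit f x, orbit f y}. P A} = {}"
      using orbits_on_split(2)[OF assms] by blast
  qed (use orbits_on_split(3)[OF assms] in simp_all)
  ultimately show ?thesis unfolding num_good_orbits_def by simp
qed

lemma num_orbits_comp_transpose_ge:
  assumes "f permutes X" "finite X" "x \<in> X" "y \<in> X"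
  shows "num_orbits f X \<le> num_orbits (f \<circ> transpose x y) X + 1"
proof -
  have "card {a, b} \<ge> 1 \<and> card {a, b} \<le> 2" for a b :: "'a set"
    by (simp add: card_insert_if)
  from this[of "orbit f x" "orbit f y"] this[of "orbit (f \<circ> transpose x y) x" "orbit (f \<circ> transpose x y) y"]
  show ?thesis
    unfolding num_orbits_split[OF assms]
      num_orbits_split[OF permutes_comp_transpose[OF assms(1,3,4)] assms(2,3,4)]
      orbits_avoiding_comp_transpose[OF assms]
    by linarith
qed

lemma orbit_union_comp_transpose:
  assumes "f permutes X" "finite X" "x \<in> X" "y \<in> X"
  shows "orbit (f \<circ> transpose x y) x \<union> orbit (f \<circ> transpose x y) y = orbit f x \<union> orbit f y"
proof -
  have *: "orbit g x \<union> orbit g y = X - \<Union>(orbits_avoiding g X x y)" if g: "g permutes X" for g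
  proof -
    have "X = \<Union>(orbits_avoiding g X x y) \<union> (orbit g x \<union> orbit g y)"
      using Union_orbits_on[OF g assms(2)] unfolding orbits_on_split(1)[OF g assms(2-4)] by auto
    moreover have "A \<inter> orbit g z = {}" if "A \<in> orbits_avoiding g X x y" "z \<in> {x, y}" for A z
    proof (rule orbits_on_disjoint[OF g assms(2)])
      show "A \<in> orbits_on g X" using that by (simp add: orbits_avoiding_def)
      show "orbit g z \<in> orbits_on g X" using that assms by (auto simp: orbits_on_def)
      show "A \<noteq> orbit g z"
        using that permutes_self_in_orbit[OF g assms(2), of z] by (auto simp: orbits_avoiding_def)
    qed
    ultimately show ?thesis by blast
  qed
  show ?thesis
    unfolding *[OF assms(1)] *[OF permutes_comp_transpose[OF assms(1,3,4)]]
      orbits_avoiding_comp_transpose[OF assms] ..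
qed

text \<open>The new map sends \<open>x\<close> to \<open>f y\<close>, follows \<open>f\<close>
  through the orbit of \<open>y\<close> as far as \<open>y\<close>, and only then continues with
  \<open>f x\<close>.\<close>

lemma orbit_comp_transpose_merge:
  assumes "f permutes X" "finite X" "x \<in> X" "y \<in> X" and ne: "orbit f x \<noteq> orbit f y"
  shows "orbit (f \<circ> transpose x y) x = orbit f x \<union> orbit f y"
    and "orbit (f \<circ> transpose x y) y = orbit f x \<union> orbit f y"
proof -
  let ?g = "f \<circ> transpose x y"
  have g: "?g permutes X" by (rule permutes_comp_transpose[OF assms(1,3,4)])
  have x: "x \<notin> orbit f y" using permutes_orbit_eq[OF assms(1,2)] ne by metis
  have "?g x = f y" by simp
  then have gx: "f y \<in> orbit ?g x" by (metis orbit.base)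
  have "z \<in> orbit ?g x" if "z \<in> orbit f y" for z
    using that
  proof induction
    case (step z)
    show ?case
    proof (cases "z = y")
      case False
      moreover have "z \<noteq> x" using step x by blast
      ultimately have "?g z = f z" by simp
      then show ?thesis using orbit.step[OF step(2)] by (simp del: comp_apply)
    qed (use gx in \<open>simp del: comp_apply\<close>)
  qed (rule gx)
  then have "y \<in> orbit ?g x" using permutes_self_in_orbit[OF assms(1,2)] by blast
  then have "orbit ?g y = orbit ?g x" by (rule permutes_orbit_eq[OF g assms(2)])
  then show "orbit ?g x = orbit f x \<union> orbit f y" "orbit ?g y = orbit f x \<union> orbit f y"
    using orbit_union_comp_transpose[OF assms(1-4)] by auto
qed

text \<open>The two-out-of-three property of a condition "the sum vanishes modulo k". It makes two
  good orbits merge into a good one.\<close>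

definition additive_pred :: "('a set \<Rightarrow> bool) \<Rightarrow> bool" where
  "additive_pred P \<longleftrightarrow> (\<forall>A B. finite A \<longrightarrow> finite B \<longrightarrow> A \<inter> B = {} \<longrightarrow> P A \<longrightarrow> (P B \<longleftrightarrow> P (A \<union> B)))"

text \<open>If the orbits of \<open>x\<close> and \<open>y\<close> are distinct and both good, they
  merge into one orbit that is good by additivity. Otherwise there is at most one good orbit to
  lose.\<close>

lemma num_good_orbits_comp_transpose_ge:
  assumes "f permutes X" "finite X" "x \<in> X" "y \<in> X" and P: "additive_pred P"
  shows "num_good_orbits P f X \<le> num_good_orbits P (f \<circ> transpose x y) X + 1"
proof -
  let ?g = "f \<circ> transpose x y"
  let ?F = "{A \<in> {orbit f x, orbit f y}. P A}"
  let ?G = "{A \<in> {orbit ?g x, orbit ?g y}. P A}"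
  have "card ?F \<le> card ?G + 1"
  proof (cases "orbit f x \<noteq> orbit f y \<and> P (orbit f x) \<and> P (orbit f y)")
    case True
    have fin: "finite (orbit f z)" if "z \<in> X" for z
      using permutes_orbit_subset[OF assms(1) that] assms(2) finite_subset by blast
    have "orbit f x \<inter> orbit f y = {}"
      by (rule orbits_on_disjoint[OF assms(1,2)]) (use True assms in \<open>auto simp: orbits_on_def\<close>)
    then have "P (orbit f x \<union> orbit f y)"
      using P True fin assms unfolding additive_pred_def by blast
    then have "?G = {orbit f x \<union> orbit f y}"
      using orbit_comp_transpose_merge[OF assms(1-4)] True by auto
    moreover have "card ?F \<le> card {orbit f x, orbit f y}" by (rule card_mono) auto
    moreover have "card {orbit f x, orbit f y} \<le> 2" by (simp add: card_insert_if)
    ultimately show ?thesis by simp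
  next
    case False
    then have "?F \<subseteq> {orbit f x} \<or> ?F \<subseteq> {orbit f y}" by auto
    then have "card ?F \<le> 1"
      using card_mono[of "{orbit f x}" ?F] card_mono[of "{orbit f y}" ?F] by auto
    then show ?thesis by simp
  qed
  then show ?thesis
    using num_good_orbits_split[OF assms(1-4), of P]
      num_good_orbits_split[OF permutes_comp_transpose[OF assms(1,3,4)] assms(2,3,4), of P]
    by (simp add: orbits_avoiding_comp_transpose[OF assms(1-4)])
qed

lemma num_orbits_comp_transpose_eq:
  assumes "f permutes X" "finite X" "x \<in> X" "y \<in> X"
    and "orbit (f \<circ> transpose x y) x \<noteq> orbit (f \<circ> transpose x y) y"
  shows "num_orbits (f \<circ> transpose x y) X = num_orbits f X + 1"
proof -
  let ?g = "f \<circ> transpose x y"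
  have g: "?g permutes X" by (rule permutes_comp_transpose[OF assms(1,3,4)])
  have gf: "?g \<circ> transpose x y = f" by (simp add: comp_assoc)
  have "orbit f x = orbit f y"
    using orbit_comp_transpose_merge[OF g assms(2-4) assms(5)] unfolding gf by simp
  then show ?thesis
    using num_orbits_split[OF assms(1-4)] num_orbits_split[OF g assms(2-4)] assms(5)
    by (simp add: orbits_avoiding_comp_transpose[OF assms(1-4)])
qed

lemma num_orbits_comp_transpose_fix:
  assumes "f permutes X" "finite X" "x \<in> X" "x \<noteq> y" "f x = y"
  shows "num_orbits (f \<circ> transpose x y) X = num_orbits f X + 1"
proof -
  have y: "y \<in> X" using assms permutes_in_image[OF assms(1)] by metis
  have "orbit (f \<circ> transpose x y) y = {y}" using assms by (simp add: orbit_eq_singleton_iff)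
  moreover have "x \<in> orbit (f \<circ> transpose x y) x"
    by (rule permutes_self_in_orbit[OF permutes_comp_transpose[OF assms(1,3) y] assms(2)])
  ultimately have "orbit (f \<circ> transpose x y) x \<noteq> orbit (f \<circ> transpose x y) y"
    using assms(4) by auto
  then show ?thesis using num_orbits_comp_transpose_eq[OF assms(1-3) y] by blast
qed

lemma orbits_on_insert_fixed:
  assumes "f permutes X" "p \<notin> X"
  shows "orbits_on f (insert p X) = insert {p} (orbits_on f X)" "{p} \<notin> orbits_on f X"
proof -
  have "f p = p" using assms by (simp add: permutes_def)
  then have "orbit f p = {p}" by (simp add: orbit_eq_singleton_iff)
  then show "orbits_on f (insert p X) = insert {p} (orbits_on f X)" by (simp add: orbits_on_def)
  show "{p} \<notin> orbits_on f X"
    using permutes_orbit_subset[OF assms(1)] assms(2) by (auto simp: orbits_on_def)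
qed

lemma num_orbits_insert_fixed:
  assumes "f permutes X" "finite X" "p \<notin> X"
  shows "num_orbits f (insert p X) = num_orbits f X + 1"
  using orbits_on_insert_fixed[OF assms(1,3)] assms(2)
  by (simp add: num_orbits_def orbits_on_def)

lemma num_good_orbits_insert_fixed:
  assumes "f permutes X" "finite X" "p \<notin> X"
  shows "num_good_orbits P f (insert p X) = num_good_orbits P f X + (if P {p} then 1 else 0)"
proof -
  have "{A \<in> insert {p} (orbits_on f X). P A} =
      (if P {p} then insert {p} {A \<in> orbits_on f X. P A} else {A \<in> orbits_on f X. P A})"
    by auto
  then show ?thesis
    using orbits_on_insert_fixed[OF assms(1,3)] assms(2)
    by (simp add: num_good_orbits_def orbits_on_def)
qed

lemma permutes_insert_mono: "f permutes X \<Longrightarrow> f permutes insert p X"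
  by (rule permutes_subset) auto

lemma num_orbits_insert_transpose:
  assumes "f permutes X" "finite X" "p \<notin> X" "x \<in> X"
  shows "num_orbits (f \<circ> transpose x p) (insert p X) = num_orbits f X"
proof -
  have f: "f permutes insert p X" by (rule permutes_insert_mono[OF assms(1)])
  have fp: "f p = p" using assms by (simp add: permutes_def)
  let ?g = "f \<circ> transpose x p"
  have g: "?g permutes insert p X" using f assms by (intro permutes_comp_transpose) auto
  have "?g x = p" using fp by simp
  then have "num_orbits (?g \<circ> transpose x p) (insert p X) = num_orbits ?g (insert p X) + 1"
    using assms by (intro num_orbits_comp_transpose_fix[OF g]) auto
  moreover have "?g \<circ> transpose x p = f" by (simp add: comp_assoc)
  ultimately show ?thesis using num_orbits_insert_fixed[OF assms(1-3)] by simp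
qed

text \<open>\<open>f \<circ> transpose x p\<close> inserts the new point \<open>p\<close> into the
  cycle of \<open>x\<close>, directly after \<open>x\<close>. Two predicates are needed because the
  letter at \<open>x\<close> may be relabelled at the same time.\<close>

lemma num_good_orbits_insert_transpose:
  assumes "f permutes X" "finite X" "p \<notin> X" "x \<in> X"
    and "\<And>A. A \<subseteq> X \<Longrightarrow> x \<notin> A \<Longrightarrow> P A = Q A"
    and "\<And>A. A \<subseteq> X \<Longrightarrow> x \<in> A \<Longrightarrow> P (insert p A) = Q A"
  shows "num_good_orbits P (f \<circ> transpose x p) (insert p X) = num_good_orbits Q f X"
proof -
  let ?X = "insert p X" and ?g = "f \<circ> transpose x p"
  have f: "f permutes ?X" by (rule permutes_insert_mono[OF assms(1)])
  have in_X: "x \<in> ?X" "p \<in> ?X" "finite ?X" using assms by auto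
  have g: "?g permutes ?X" by (rule permutes_comp_transpose[OF f in_X(1,2)])
  have fp: "orbit f p = {p}" using assms by (simp add: permutes_def orbit_eq_singleton_iff)
  have fx: "x \<in> orbit f x" "orbit f x \<subseteq> X"
    using permutes_self_in_orbit[OF assms(1,2)] permutes_orbit_subset[OF assms(1,4)] by auto
  have ne: "orbit f x \<noteq> orbit f p" using fp fx assms(3) by auto
  have go: "orbit ?g x = insert p (orbit f x)" "orbit ?g p = insert p (orbit f x)"
    using orbit_comp_transpose_merge[OF f in_X(3,1,2) ne] fp by auto
  have av: "orbits_avoiding f ?X x p = orbits_avoiding f X x x"
  proof -
    have "p \<notin> A" if "A \<in> orbits_on f X" for A
      using that permutes_orbit_subset[OF assms(1)] assms(3) by (auto simp: orbits_on_def)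
    then show ?thesis
      unfolding orbits_avoiding_def orbits_on_insert_fixed(1)[OF assms(1,3)] by auto
  qed
  have avP: "{A \<in> orbits_avoiding f X x x. P A} = {A \<in> orbits_avoiding f X x x. Q A}"
    using assms(5) permutes_orbit_subset[OF assms(1)]
    by (auto simp: orbits_avoiding_def orbits_on_def)
  have "{A \<in> {orbit ?g x, orbit ?g p}. P A} = (if Q (orbit f x) then {insert p (orbit f x)} else {})"
    using assms(6)[OF fx(2,1)] go by auto
  moreover have "{A \<in> {orbit f x, orbit f x}. Q A} = (if Q (orbit f x) then {orbit f x} else {})"
    by auto
  ultimately show ?thesis
    unfolding num_good_orbits_split[OF g in_X(3,1,2), of P]
      num_good_orbits_split[OF assms(1,2,4,4), of Q]
    by (simp add: orbits_avoiding_comp_transpose[OF f in_X(3,1,2)] av avP)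
qed

lemma num_orbits_conj:
  assumes "bij t" "t ` X = X"
  shows "num_orbits (t \<circ> f \<circ> finv t) X = num_orbits f X"
proof -
  have pw: "((t \<circ> f \<circ> finv t) ^^ n) (t x) = t ((f ^^ n) x)" for n x
    using assms(1) by (induction n) (auto simp: bij_is_inj)
  have "orbit (t \<circ> f \<circ> finv t) (t x) = t ` orbit f x" for x
    unfolding orbit_altdef pw by auto
  then have "orbits_on (t \<circ> f \<circ> finv t) (t ` X) = (`) t ` orbits_on f X"
    by (auto simp: orbits_on_def)
  moreover have "inj_on ((`) t) (orbits_on f X)"
    using bij_is_inj[OF assms(1)] by (auto intro!: inj_onI simp: inj_image_eq_iff)
  ultimately show ?thesis using assms(2) by (simp add: num_orbits_def card_image)
qed

section \<open>Joining and exchanging segments of a cycle\<close>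

lemma cycle_of_list_last:
  assumes "distinct xs" "xs \<noteq> []"
  shows "cycle_of_list xs (last xs) = hd xs"
  using assms
proof (induction xs rule: cycle_of_list.induct)
  case (1 i j cs)
  then show ?case by auto
qed auto

lemma cycle_of_list_append:
  assumes "distinct (xs @ ys)" "xs \<noteq> []" "ys \<noteq> []"
  shows "cycle_of_list (xs @ ys) =
    cycle_of_list xs \<circ> cycle_of_list ys \<circ> transpose (last xs) (last ys)"
  using assms
proof (induction xs rule: cycle_of_list.induct)
  case (1 i j cs)
  then show ?case by (simp add: comp_assoc)
next
  case ("2_2" x)
  then obtain y ys' where ys: "ys = y # ys'" by (cases ys) auto
  let ?c = "cycle_of_list ys"
  have c: "?c x = x" "?c (last ys) = y"
    using "2_2" id_outside_supp[of x ys] cycle_of_list_last[of ys] ys by auto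
  have "transpose x y \<circ> ?c = ?c \<circ> transpose x (last ys)"
  proof
    fix z
    have "inj ?c" using permutation_bijective[OF permutation_of_cycle] bij_is_inj by blast
    then have "?c z = x \<longleftrightarrow> z = x" "?c z = y \<longleftrightarrow> z = last ys" using c by (metis injD)+
    then show "(transpose x y \<circ> ?c) z = (?c \<circ> transpose x (last ys)) z"
      using c by (auto simp: transpose_def)
  qed
  then show ?case using ys by simp
qed auto

lemma cycle_of_list_rotate_append:
  assumes "distinct (xs @ ys)"
  shows "cycle_of_list (xs @ ys) = cycle_of_list (ys @ xs)"
  using cycle_of_list_rotate_independent[OF assms, of "length xs"] by (simp add: rotate_append)

text \<open>Cutting off \<open>xs\<close> leaves a cycle through \<open>ys\<close> and
  \<open>zs\<close> that does not depend on their order; only the transposition that joins it to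
  \<open>xs\<close> differs. These two transpositions are why a commutator will cost 2.\<close>

lemma cycle_of_list_swap_segments:
  assumes "distinct (xs @ ys @ zs)" "xs \<noteq> []" "ys \<noteq> []" "zs \<noteq> []"
  shows "cycle_of_list (xs @ zs @ ys) =
    cycle_of_list (xs @ ys @ zs) \<circ> transpose (last xs) (last zs) \<circ> transpose (last xs) (last ys)"
proof -
  have d: "distinct (ys @ zs)" "distinct (zs @ ys)" "distinct (xs @ zs @ ys)"
    using assms by auto
  have "cycle_of_list (zs @ ys) = cycle_of_list (ys @ zs)"
    by (rule cycle_of_list_rotate_append[OF d(2)])
  moreover have "transpose (last xs) (last zs) \<circ> transpose (last xs) (last zs) = id" by simp
  ultimately show ?thesis
    using cycle_of_list_append[of xs "ys @ zs"] cycle_of_list_append[of xs "zs @ ys"] assms d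
    by (simp add: comp_assoc)
qed

section \<open>Surfaces spanned by words\<close>

definition lval_A :: "int + int \<Rightarrow> int" where
  "lval_A l = (case l of Inl k \<Rightarrow> k | Inr _ \<Rightarrow> 0)"

definition lval_B :: "int + int \<Rightarrow> int" where
  "lval_B l = (case l of Inl _ \<Rightarrow> 0 | Inr k \<Rightarrow> k)"

text \<open>The factors are abelian, so whether an orbit of letters of one factor bounds a disc
  depends only on its exponent sum. The sum for the other factor is then 0.\<close>

definition null_sum :: "nat \<Rightarrow> nat \<Rightarrow> ('p \<Rightarrow> int + int) \<Rightarrow> 'p set \<Rightarrow> bool" where
  "null_sum m n lab A \<longleftrightarrow> int m dvd (\<Sum>x\<in>A. lval_A (lab x)) \<and> int n dvd (\<Sum>x\<in>A. lval_B (lab x))"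

text \<open>Cut the surface along one arc for each letter \<open>x\<close>, from the end of
  \<open>x\<close> to the start of \<open>\<tau> x\<close>. The pieces in the factors are the cycles
  of \<open>\<tau>\<close>, those at the base point the cycles of
  \<open>finv \<tau> \<circ> cycle_of_list xs\<close>. The value is the number of discs minus the
  number of arcs, that is, the Euler characteristic with every other piece counted as 0.\<close>

definition euler_bound :: "nat \<Rightarrow> nat \<Rightarrow> (nat \<Rightarrow> int + int) \<Rightarrow> (nat \<Rightarrow> nat) \<Rightarrow> nat list \<Rightarrow> int" where
  "euler_bound m n lab \<tau> xs = int (num_good_orbits (null_sum m n lab) \<tau> (set xs)) +
    int (num_orbits (finv \<tau> \<circ> cycle_of_list xs) (set xs)) - int (length xs)"

text \<open>Positions are arbitrary distinct numbers, so that letters can be inserted and deleted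
  without renumbering. The inequality allows surfaces to be wasteful and makes the predicate
  monotone in \<open>e\<close>.\<close>

definition spans_surface :: "nat \<Rightarrow> nat \<Rightarrow> (int + int) list \<Rightarrow> int \<Rightarrow> bool" where
  "spans_surface m n w e \<longleftrightarrow> (\<exists>xs lab \<tau>. distinct xs \<and> map lab xs = w \<and> \<tau> permutes set xs \<and>
    (\<forall>x\<in>set xs. isl (lab (\<tau> x)) = isl (lab x)) \<and> e \<le> euler_bound m n lab \<tau> xs)"

lemma additive_null_sum: "additive_pred (null_sum m n lab)"
  unfolding additive_pred_def null_sum_def
  by (auto simp: sum.union_disjoint dvd_add_right_iff)

lemma null_sum_cong:
  "(\<And>x. x \<in> A \<Longrightarrow> lab x = lab' x) \<Longrightarrow> null_sum m n lab A = null_sum m n lab' A"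
  unfolding null_sum_def by (metis (no_types, lifting) sum.cong)

lemma num_good_orbits_cong:
  assumes "f permutes X" "\<And>A. A \<subseteq> X \<Longrightarrow> P A = Q A"
  shows "num_good_orbits P f X = num_good_orbits Q f X"
proof -
  have "{A \<in> orbits_on f X. P A} = {A \<in> orbits_on f X. Q A}"
    using assms(2) permutes_orbit_subset[OF assms(1)] by (auto simp: orbits_on_def)
  then show ?thesis by (simp add: num_good_orbits_def)
qed

lemma spans_surface_mono: "spans_surface m n w e \<Longrightarrow> e' \<le> e \<Longrightarrow> spans_surface m n w e'"
  unfolding spans_surface_def by (elim exE conjE) (intro exI conjI; assumption?; simp)

lemma spans_surface_rotate:
  assumes "spans_surface m n (u @ v) e"
  shows "spans_surface m n (v @ u) e"
proof -
  obtain xs lab \<tau> where xs: "distinct xs" "map lab xs = u @ v" "\<tau> permutes set xs"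
    "\<forall>x\<in>set xs. isl (lab (\<tau> x)) = isl (lab x)" "e \<le> euler_bound m n lab \<tau> xs"
    using assms by (auto simp: spans_surface_def)
  obtain ys zs where yz: "xs = ys @ zs" "map lab ys = u" "map lab zs = v"
    using xs(2) by (auto simp: map_eq_append_conv)
  have "cycle_of_list (zs @ ys) = cycle_of_list xs"
    using cycle_of_list_rotate_append[of ys zs] xs(1) yz(1) by simp
  then have "euler_bound m n lab \<tau> (zs @ ys) = euler_bound m n lab \<tau> xs"
    by (simp add: euler_bound_def yz(1) Un_commute)
  then show ?thesis
    unfolding spans_surface_def using xs yz by (intro exI[of _ "zs @ ys"] exI[of _ lab] exI[of _ \<tau>]) (auto simp: Un_commute)
qed

lemma inv_comp_transpose:
  assumes "f permutes X"
  shows "finv (f \<circ> transpose x y) = transpose x y \<circ> finv f"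
  using assms by (simp add: o_inv_distrib permutes_bij)

lemma comp_transpose_transpose: "f \<circ> transpose x y \<circ> transpose x y = f"
  by (simp add: comp_assoc)

lemma num_orbits_transpose_comp_ge:
  assumes "f permutes X" "finite X" "x \<in> X" "y \<in> X"
  shows "num_orbits f X \<le> num_orbits (transpose x y \<circ> f) X + 1"
proof -
  let ?t = "transpose x y"
  have "?t ` X = X" using assms by (auto simp: transpose_def)
  then have "num_orbits (?t \<circ> (f \<circ> ?t) \<circ> finv ?t) X = num_orbits (f \<circ> ?t) X"
    by (intro num_orbits_conj) auto
  moreover have "?t \<circ> (f \<circ> ?t) \<circ> finv ?t = ?t \<circ> f" by (simp add: comp_assoc)
  ultimately show ?thesis using num_orbits_comp_transpose_ge[OF assms] by simp
qed

lemma cycle_of_list_snoc: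
  assumes "distinct (xs @ [q])" "xs \<noteq> []"
  shows "cycle_of_list (xs @ [q]) = cycle_of_list xs \<circ> transpose (last xs) q"
  using cycle_of_list_append[of xs "[q]"] assms by simp

lemma inv_cycle_permutes:
  assumes "\<tau> permutes set xs"
  shows "finv \<tau> \<circ> cycle_of_list xs permutes set xs"
  using assms by (intro permutes_compose cycle_permutes permutes_inv)

section \<open>Moves on cyclic words that keep the bound\<close>

definition null_letter :: "nat \<Rightarrow> nat \<Rightarrow> int + int \<Rightarrow> bool" where
  "null_letter m n l \<longleftrightarrow> int m dvd lval_A l \<and> int n dvd lval_B l"

text \<open>The new letter is a fixed point of \<open>\<tau>\<close>, hence a disc of its own, which
  pays for the longer word. At the base point it only lengthens an existing cycle.\<close>

lemma spans_surface_insert_null: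
  assumes "spans_surface m n w e" "w \<noteq> []" "null_letter m n l"
  shows "spans_surface m n (w @ [l]) e"
proof -
  obtain xs lab \<tau> where xs: "distinct xs" "map lab xs = w" "\<tau> permutes set xs"
    "\<forall>x\<in>set xs. isl (lab (\<tau> x)) = isl (lab x)" "e \<le> euler_bound m n lab \<tau> xs"
    using assms(1) by (auto simp: spans_surface_def)
  obtain q where q: "q \<notin> set xs" using ex_new_if_finite[OF infinite_UNIV_nat finite_set] by blast
  have ne: "xs \<noteq> []" using xs(2) assms(2) by auto
  define lab' where "lab' = lab(q := l)"
  have \<tau>q: "\<tau> q = q" using xs(3) q by (simp add: permutes_def)
  have \<tau>in: "\<tau> x \<in> set xs \<longleftrightarrow> x \<in> set xs" for x using permutes_in_image[OF xs(3)] .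
  have "num_good_orbits (null_sum m n lab') \<tau> (insert q (set xs)) =
      num_good_orbits (null_sum m n lab') \<tau> (set xs) + 1"
    using num_good_orbits_insert_fixed[OF xs(3) _ q, of "null_sum m n lab'"] assms(3)
    by (simp add: null_sum_def null_letter_def lab'_def)
  also have "num_good_orbits (null_sum m n lab') \<tau> (set xs) = num_good_orbits (null_sum m n lab) \<tau> (set xs)"
    using q by (intro num_good_orbits_cong[OF xs(3)] null_sum_cong) (auto simp: lab'_def)
  finally have good: "num_good_orbits (null_sum m n lab') \<tau> (insert q (set xs)) =
      num_good_orbits (null_sum m n lab) \<tau> (set xs) + 1" .
  have "finv \<tau> \<circ> cycle_of_list (xs @ [q]) = (finv \<tau> \<circ> cycle_of_list xs) \<circ> transpose (last xs) q"
    using cycle_of_list_snoc[of xs q] xs(1) q ne by (simp add: comp_assoc)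
  then have "num_orbits (finv \<tau> \<circ> cycle_of_list (xs @ [q])) (insert q (set xs)) =
      num_orbits (finv \<tau> \<circ> cycle_of_list xs) (set xs)"
    using num_orbits_insert_transpose[OF inv_cycle_permutes[OF xs(3)] _ q, of "last xs"] ne by simp
  with good have "euler_bound m n lab' \<tau> (xs @ [q]) = euler_bound m n lab \<tau> xs"
    by (simp add: euler_bound_def)
  moreover have "map lab' (xs @ [q]) = w @ [l]" using xs(2) q by (auto simp: lab'_def)
  moreover have "\<tau> permutes set (xs @ [q])" using permutes_insert_mono[OF xs(3)] by simp
  moreover have "\<forall>x\<in>set (xs @ [q]). isl (lab' (\<tau> x)) = isl (lab' x)"
    using xs(4) q \<tau>q \<tau>in by (auto simp: lab'_def)
  ultimately show ?thesis
    unfolding spans_surface_def using xs(1,5) q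
    by (intro exI[of _ "xs @ [q]"] exI[of _ lab'] exI[of _ \<tau>]) auto
qed

text \<open>The letter is first taken out of its cycle of \<open>\<tau>\<close>. If that cycle had
  other letters, it stays good or bad, and at most one base-point disc is lost, which the shorter
  word pays for.\<close>

lemma spans_surface_delete_null:
  assumes "spans_surface m n (w @ [l]) e" "w \<noteq> []" "null_letter m n l"
  shows "spans_surface m n w e"
proof -
  obtain zs lab \<tau> where zs: "distinct zs" "map lab zs = w @ [l]" "\<tau> permutes set zs"
    "\<forall>x\<in>set zs. isl (lab (\<tau> x)) = isl (lab x)" "e \<le> euler_bound m n lab \<tau> zs"
    using assms(1) by (auto simp: spans_surface_def)
  obtain xs q where xq: "zs = xs @ [q]" "map lab xs = w" "lab q = l"
    using zs(2) by (auto simp: map_eq_append_conv)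
  have q: "q \<notin> set xs" and d: "distinct xs" and ne: "xs \<noteq> []" using zs(1) xq assms(2) by auto
  have set_zs: "set zs = insert q (set xs)" using xq by simp
  define r where "r = finv \<tau> q"
  define \<tau>' where "\<tau>' = \<tau> \<circ> transpose r q"
  have r: "r \<in> set zs" "\<tau> r = q"
    using permutes_in_image[OF permutes_inv[OF zs(3)], of q] permutes_inverses(1)[OF zs(3)] xq
    by (auto simp: r_def)
  have \<tau>': "\<tau>' permutes set zs"
    unfolding \<tau>'_def using zs(3) r xq by (intro permutes_comp_transpose) auto
  have \<tau>'q: "\<tau>' q = q" using r by (simp add: \<tau>'_def)
  have \<tau>'X: "\<tau>' permutes set xs"
    using permutes_superset[OF \<tau>', of "set xs"] \<tau>'q set_zs by auto
  have \<tau>_eq: "\<tau> = \<tau>' \<circ> transpose r q" by (simp add: \<tau>'_def comp_transpose_transpose)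
  have null_ins: "null_sum m n lab (insert q A) = null_sum m n lab A" if "A \<subseteq> set xs" for A
  proof -
    have "q \<notin> A" "finite A" using that q finite_subset by auto
    then show ?thesis
      using assms(3) xq(3) by (simp add: null_sum_def null_letter_def dvd_add_right_iff)
  qed
  have inv\<tau>': "finv \<tau>' = transpose r q \<circ> finv \<tau>"
    unfolding \<tau>'_def by (rule inv_comp_transpose[OF zs(3)])
  define F where "F = finv \<tau> \<circ> cycle_of_list zs"
  have F: "F permutes set zs" unfolding F_def by (rule inv_cycle_permutes[OF zs(3)])
  have "finv \<tau>' \<circ> cycle_of_list zs = (finv \<tau>' \<circ> cycle_of_list xs) \<circ> transpose (last xs) q"
    using cycle_of_list_snoc[of xs q] zs(1) xq(1) ne by (simp add: comp_assoc)
  then have orb: "num_orbits (finv \<tau>' \<circ> cycle_of_list zs) (set zs) =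
      num_orbits (finv \<tau>' \<circ> cycle_of_list xs) (set xs)"
    using num_orbits_insert_transpose[OF inv_cycle_permutes[OF \<tau>'X] _ q, of "last xs"] ne set_zs
    by simp
  have "int (num_good_orbits (null_sum m n lab) \<tau> (set zs)) + int (num_orbits F (set zs)) \<le>
    int (num_good_orbits (null_sum m n lab) \<tau>' (set xs)) +
    int (num_orbits (finv \<tau>' \<circ> cycle_of_list xs) (set xs)) + 1"
  proof (cases "r = q")
    case True
    then have "\<tau>' = \<tau>" by (simp add: \<tau>'_def)
    moreover have "null_sum m n lab {q}" using null_ins[of "{}"] by (simp add: null_sum_def)
    ultimately show ?thesis
      using num_good_orbits_insert_fixed[OF \<tau>'X _ q, of "null_sum m n lab"] orb
      by (simp add: F_def set_zs)
  next
    case False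
    then have "r \<in> set xs" using r set_zs by auto
    then have "num_good_orbits (null_sum m n lab) \<tau> (set zs) = num_good_orbits (null_sum m n lab) \<tau>' (set xs)"
      unfolding \<tau>_eq set_zs using null_ins
      by (intro num_good_orbits_insert_transpose[OF \<tau>'X _ q]) auto
    moreover have "num_orbits F (set zs) \<le> num_orbits (transpose r q \<circ> F) (set zs) + 1"
      by (rule num_orbits_transpose_comp_ge[OF F]) (use r set_zs in auto)
    moreover have "transpose r q \<circ> F = finv \<tau>' \<circ> cycle_of_list zs"
      by (simp add: F_def inv\<tau>' comp_assoc)
    ultimately show ?thesis using orb by simp
  qed
  then have "euler_bound m n lab \<tau> zs \<le> euler_bound m n lab \<tau>' xs"
    by (simp add: euler_bound_def F_def xq(1))
  moreover have "isl (lab (\<tau>' x)) = isl (lab x)" if "x \<in> set xs" for x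
  proof (cases "x = r")
    case True
    then have "isl (lab (\<tau>' x)) = isl (lab (\<tau> q))" by (simp add: \<tau>'_def)
    also have "\<dots> = isl (lab (\<tau> r))" using zs(4) r set_zs by auto
    also have "\<dots> = isl (lab r)" using zs(4) r by auto
    finally show ?thesis using True by simp
  next
    case False
    moreover have "x \<noteq> q" using that q by blast
    ultimately have "\<tau>' x = \<tau> x" by (simp add: \<tau>'_def)
    then show ?thesis using zs(4) that set_zs by auto
  qed
  ultimately show ?thesis
    unfolding spans_surface_def using d xq(2) \<tau>'X zs(5)
    by (intro exI[of _ xs] exI[of _ lab] exI[of _ \<tau>']) auto
qed

definition merged_letter :: "nat \<Rightarrow> nat \<Rightarrow> int + int \<Rightarrow> int + int \<Rightarrow> int + int \<Rightarrow> bool" where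
  "merged_letter m n l1 l2 l \<longleftrightarrow> isl l1 = isl l \<and> isl l2 = isl l \<and>
    int m dvd lval_A l1 + lval_A l2 - lval_A l \<and> int n dvd lval_B l1 + lval_B l2 - lval_B l"

lemma null_sum_insert_merged:
  assumes "merged_letter m n (lab' p) (lab' q) (lab p)" "finite A" "p \<in> A" "q \<notin> A"
    and "\<And>x. x \<in> A \<Longrightarrow> x \<noteq> p \<Longrightarrow> lab' x = lab x"
  shows "null_sum m n lab' (insert q A) = null_sum m n lab A"
proof -
  have *: "(\<Sum>x\<in>insert q A. v (lab' x)) - (\<Sum>x\<in>A. v (lab x)) = v (lab' p) + v (lab' q) - v (lab p)"
    for v :: "int + int \<Rightarrow> int"
  proof -
    have "(\<Sum>x\<in>A - {p}. v (lab' x)) = (\<Sum>x\<in>A - {p}. v (lab x))"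
      using assms(5) by (intro sum.cong) auto
    then show ?thesis
      using assms(2-4) sum.remove[of A p "\<lambda>x. v (lab' x)"] sum.remove[of A p "\<lambda>x. v (lab x)"] by simp
  qed
  have dvd: "k dvd a \<longleftrightarrow> k dvd b" if "k dvd a - b" for k a b :: int
    using dvd_add_right_iff[OF that, of b] by simp
  have "int m dvd lval_A (lab' p) + lval_A (lab' q) - lval_A (lab p)"
    "int n dvd lval_B (lab' p) + lval_B (lab' q) - lval_B (lab p)"
    using assms(1) by (simp_all add: merged_letter_def)
  then show ?thesis
    unfolding null_sum_def using * dvd by metis
qed

text \<open>With \<open>q\<close> inserted after \<open>last xs\<close> in both permutations, the
  composite is the old one conjugated by the transposition, and the conjugated fixed point
  \<open>q\<close> is the additional orbit.\<close>

lemma num_orbits_inv_comp_cycle_snoc: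
  assumes "distinct (xs @ [q])" "xs \<noteq> []" "\<tau> permutes set xs"
  shows "num_orbits (finv (\<tau> \<circ> transpose (last xs) q) \<circ> cycle_of_list (xs @ [q])) (insert q (set xs)) =
    num_orbits (finv \<tau> \<circ> cycle_of_list xs) (set xs) + 1"
proof -
  let ?t = "transpose (last xs) q"
  have q: "q \<notin> set xs" using assms(1) by simp
  have "finv (\<tau> \<circ> ?t) \<circ> cycle_of_list (xs @ [q]) = ?t \<circ> (finv \<tau> \<circ> cycle_of_list xs) \<circ> finv ?t"
    by (simp add: inv_comp_transpose[OF assms(3)] cycle_of_list_snoc[OF assms(1,2)] comp_assoc)
  moreover have "?t ` insert q (set xs) = insert q (set xs)"
    using assms(2) by (intro permutes_image permutes_swap_id) auto
  ultimately show ?thesis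
    using num_orbits_conj[of ?t "insert q (set xs)" "finv \<tau> \<circ> cycle_of_list xs"]
      num_orbits_insert_fixed[OF inv_cycle_permutes[OF assms(3)] _ q] by simp
qed

text \<open>The two new letters are made consecutive in the word and in \<open>\<tau>\<close>. This
  creates one small base-point disc, which balances the additional letter.\<close>

lemma spans_surface_split_letter:
  assumes "spans_surface m n (w @ [l]) e" "merged_letter m n l1 l2 l"
  shows "spans_surface m n (w @ [l1, l2]) e"
proof -
  obtain xs lab \<tau> where xs: "distinct xs" "map lab xs = w @ [l]" "\<tau> permutes set xs"
    "\<forall>x\<in>set xs. isl (lab (\<tau> x)) = isl (lab x)" "e \<le> euler_bound m n lab \<tau> xs"
    using assms(1) by (auto simp: spans_surface_def)
  obtain q where q: "q \<notin> set xs" using ex_new_if_finite[OF infinite_UNIV_nat finite_set] by blast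
  obtain ys p where yp: "xs = ys @ [p]" "map lab ys = w" "lab p = l"
    using xs(2) by (auto simp: map_eq_append_conv)
  have p: "p \<notin> set ys" "p \<in> set xs" "last xs = p" "xs \<noteq> []" "p \<noteq> q" using xs(1) yp q by auto
  define lab' where "lab' = lab(p := l1, q := l2)"
  define \<tau>' where "\<tau>' = \<tau> \<circ> transpose p q"
  have l12: "lab' p = l1" "lab' q = l2" using p by (auto simp: lab'_def)
  have isl': "isl (lab' x) = isl (if x = q then lab p else lab x)" for x
    using assms(2) yp(3) by (auto simp: lab'_def merged_letter_def)
  have "num_good_orbits (null_sum m n lab') \<tau>' (insert q (set xs)) =
      num_good_orbits (null_sum m n lab) \<tau> (set xs)"
    unfolding \<tau>'_def
  proof (rule num_good_orbits_insert_transpose[OF xs(3) _ q p(2)])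
    fix A assume A: "A \<subseteq> set xs"
    show "p \<notin> A \<Longrightarrow> null_sum m n lab' A = null_sum m n lab A"
      using A q by (intro null_sum_cong) (auto simp: lab'_def)
    show "p \<in> A \<Longrightarrow> null_sum m n lab' (insert q A) = null_sum m n lab A"
      using A q assms(2) yp(3) l12 by (intro null_sum_insert_merged) (auto simp: lab'_def finite_subset)
  qed simp
  moreover have "num_orbits (finv \<tau>' \<circ> cycle_of_list (xs @ [q])) (insert q (set xs)) =
      num_orbits (finv \<tau> \<circ> cycle_of_list xs) (set xs) + 1"
    unfolding \<tau>'_def using num_orbits_inv_comp_cycle_snoc[of xs q \<tau>] xs q p by simp
  ultimately have "euler_bound m n lab' \<tau>' (xs @ [q]) = euler_bound m n lab \<tau> xs"
    by (simp add: euler_bound_def)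
  moreover have "map lab' (xs @ [q]) = w @ [l1, l2]" using yp q p by (auto simp: lab'_def)
  moreover have "\<tau>' permutes set (xs @ [q])"
    unfolding \<tau>'_def using permutes_insert_mono[OF xs(3)] p by (intro permutes_comp_transpose) auto
  moreover have "\<forall>x\<in>set (xs @ [q]). isl (lab' (\<tau>' x)) = isl (lab' x)"
  proof
    fix x assume x: "x \<in> set (xs @ [q])"
    have \<tau>q: "\<tau> q = q" using xs(3) q by (simp add: permutes_def)
    have \<tau>in: "\<tau> z \<noteq> q" if "z \<in> set xs" for z
      using permutes_in_image[OF xs(3), of z] that q by metis
    consider "x = p" | "x = q" | "x \<noteq> p" "x \<noteq> q" "x \<in> set xs" using x by auto
    then show "isl (lab' (\<tau>' x)) = isl (lab' x)"
      using \<tau>q \<tau>in p xs(4) by cases (auto simp: \<tau>'_def isl')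
  qed
  ultimately show ?thesis
    unfolding spans_surface_def using xs(1,5) q
    by (intro exI[of _ "xs @ [q]"] exI[of _ lab'] exI[of _ \<tau>']) auto
qed

text \<open>Once \<open>\<tau>\<close> sends the first letter to the second, merging reverses the
  splitting.\<close>

lemma spans_surface_merge_letters:
  assumes "spans_surface m n (w @ [l1, l2]) e" "merged_letter m n l1 l2 l"
  shows "spans_surface m n (w @ [l]) e"
proof -
  obtain zs lab \<tau>0 where zs: "distinct zs" "map lab zs = w @ [l1, l2]" "\<tau>0 permutes set zs"
    "\<forall>x\<in>set zs. isl (lab (\<tau>0 x)) = isl (lab x)" "e \<le> euler_bound m n lab \<tau>0 zs"
    using assms(1) by (auto simp: spans_surface_def)
  obtain ys p q where yp: "zs = ys @ [p, q]" "map lab ys = w" "lab p = l1" "lab q = l2"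
    using zs(2) by (auto simp: map_eq_append_conv map_eq_Cons_conv)
  have isl_pq: "isl l1 = isl l2" "isl l = isl l1" using assms(2) by (auto simp: merged_letter_def)
  have pq: "p \<noteq> q" "p \<in> set zs" "q \<in> set zs" using zs(1) yp by auto
  define xs where "xs = ys @ [p]"
  have xs: "zs = xs @ [q]" "distinct xs" "q \<notin> set xs" "last xs = p" "xs \<noteq> []" "p \<in> set xs"
    "set zs = insert q (set xs)"
    using zs(1) yp by (auto simp: xs_def)
  let ?\<sigma> = "cycle_of_list zs"
  have \<sigma>p: "?\<sigma> p = q"
  proof -
    have "?\<sigma> p = cycle_of_list xs q" using cycle_of_list_snoc[of xs q] zs(1) xs by simp
    then show ?thesis using id_outside_supp[of q xs] xs by simp
  qed
  \<comment> \<open>\<open>\<tau>\<close> can be changed by a transposition so that \<open>p\<close>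
    is followed by \<open>q\<close>: at most one good orbit is lost, and one base-point orbit is
    gained because \<open>p\<close> becomes a fixed point there.\<close>
  have "\<exists>\<tau>. \<tau> permutes set zs \<and> (\<forall>x\<in>set zs. isl (lab (\<tau> x)) = isl (lab x)) \<and>
      e \<le> euler_bound m n lab \<tau> zs \<and> \<tau> p = q"
  proof (cases "\<tau>0 p = q")
    case False
    define r where "r = finv \<tau>0 q"
    have r: "r \<in> set zs" "\<tau>0 r = q"
      using permutes_in_image[OF permutes_inv[OF zs(3)], of q] permutes_inverses(1)[OF zs(3)] pq
      by (auto simp: r_def)
    define \<tau> where "\<tau> = \<tau>0 \<circ> transpose p r"
    have \<tau>: "\<tau> permutes set zs"
      unfolding \<tau>_def using zs(3) pq r by (intro permutes_comp_transpose) auto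
    have \<tau>p: "\<tau> p = q" using r by (simp add: \<tau>_def)
    define F where "F = finv \<tau>0 \<circ> ?\<sigma>"
    have F: "F permutes set zs" unfolding F_def by (rule inv_cycle_permutes[OF zs(3)])
    define x where "x = finv ?\<sigma> (\<tau>0 p)"
    have \<sigma>perm: "?\<sigma> permutes set zs" by (rule cycle_permutes)
    have \<sigma>x: "?\<sigma> x = \<tau>0 p" using permutes_inverses(1)[OF \<sigma>perm] by (simp add: x_def)
    have x: "x \<in> set zs"
      using permutes_in_image[OF permutes_inv[OF \<sigma>perm]] permutes_in_image[OF zs(3)] pq
      by (simp add: x_def)
    have Fx: "F x = p" using \<sigma>x permutes_inverses(2)[OF zs(3)] by (simp add: F_def)
    have xp: "x \<noteq> p" using \<sigma>x \<sigma>p False by auto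
    have Fp: "F p = r" using \<sigma>p by (simp add: F_def r_def)
    have "finv \<tau> \<circ> ?\<sigma> = transpose p r \<circ> F"
      unfolding \<tau>_def F_def inv_comp_transpose[OF zs(3)] by (simp add: comp_assoc)
    also have "\<dots> = F \<circ> transpose x p"
    proof
      fix z
      have "F z = p \<longleftrightarrow> z = x" "F z = r \<longleftrightarrow> z = p"
        using Fx Fp permutes_inj[OF F] by (metis injD)+
      then show "(transpose p r \<circ> F) z = (F \<circ> transpose x p) z"
        using Fx Fp by (auto simp: transpose_def)
    qed
    finally have "num_orbits (finv \<tau> \<circ> ?\<sigma>) (set zs) = num_orbits F (set zs) + 1"
      using num_orbits_comp_transpose_fix[OF F _ x xp Fx] by simp
    moreover have "num_good_orbits (null_sum m n lab) \<tau>0 (set zs) \<le>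
        num_good_orbits (null_sum m n lab) \<tau> (set zs) + 1"
      unfolding \<tau>_def using zs(3) pq r
      by (intro num_good_orbits_comp_transpose_ge additive_null_sum) auto
    ultimately have "euler_bound m n lab \<tau>0 zs \<le> euler_bound m n lab \<tau> zs"
      by (simp add: euler_bound_def F_def)
    moreover have "isl (lab (\<tau> z)) = isl (lab z)" if z: "z \<in> set zs" for z
    proof -
      have "isl (lab r) = isl (lab p)" using zs(4) r yp isl_pq by auto
      then show ?thesis
        using zs(4) z r pq by (cases "z = p"; cases "z = r") (auto simp: \<tau>_def)
    qed
    ultimately show ?thesis using \<tau> \<tau>p zs(5) by auto
  qed (use zs in blast)
  then obtain \<tau> where \<tau>: "\<tau> permutes set zs" "\<forall>x\<in>set zs. isl (lab (\<tau> x)) = isl (lab x)"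
    "e \<le> euler_bound m n lab \<tau> zs" "\<tau> p = q" by blast
  define \<tau>' where "\<tau>' = \<tau> \<circ> transpose p q"
  have "\<tau>' permutes set zs"
    unfolding \<tau>'_def using \<tau>(1) pq by (intro permutes_comp_transpose) auto
  moreover have "\<tau>' q = q" using \<tau>(4) by (simp add: \<tau>'_def)
  ultimately have \<tau>'X: "\<tau>' permutes set xs"
    using permutes_superset[of \<tau>' "set zs" "set xs"] xs(7) by auto
  have \<tau>_eq: "\<tau> = \<tau>' \<circ> transpose p q" by (simp add: \<tau>'_def comp_transpose_transpose)
  define lab' where "lab' = lab(p := l)"
  have "num_good_orbits (null_sum m n lab) \<tau> (insert q (set xs)) =
      num_good_orbits (null_sum m n lab') \<tau>' (set xs)"
    unfolding \<tau>_eq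
  proof (rule num_good_orbits_insert_transpose[OF \<tau>'X _ xs(3,6)])
    fix A assume A: "A \<subseteq> set xs"
    show "p \<notin> A \<Longrightarrow> null_sum m n lab A = null_sum m n lab' A"
      using A by (intro null_sum_cong) (auto simp: lab'_def)
    show "p \<in> A \<Longrightarrow> null_sum m n lab (insert q A) = null_sum m n lab' A"
      using A xs(3) assms(2) yp by (intro null_sum_insert_merged) (auto simp: lab'_def finite_subset)
  qed simp
  moreover have "num_orbits (finv \<tau> \<circ> ?\<sigma>) (insert q (set xs)) =
      num_orbits (finv \<tau>' \<circ> cycle_of_list xs) (set xs) + 1"
    using num_orbits_inv_comp_cycle_snoc[of xs q \<tau>'] zs(1) xs \<tau>'X \<tau>_eq by simp
  ultimately have "euler_bound m n lab \<tau> zs = euler_bound m n lab' \<tau>' xs"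
    using xs(1) by (simp add: euler_bound_def)
  moreover have "map lab' xs = w @ [l]" using yp xs(2) by (auto simp: lab'_def xs_def)
  moreover have "\<forall>x\<in>set xs. isl (lab' (\<tau>' x)) = isl (lab' x)"
  proof
    fix x assume x: "x \<in> set xs"
    have isl': "isl (lab' z) = isl (lab z)" for z using isl_pq yp by (simp add: lab'_def)
    have "isl (lab (\<tau>' x)) = isl (lab x)"
    proof (cases "x = p")
      case True
      then have "isl (lab (\<tau>' x)) = isl (lab (\<tau> q))" by (simp add: \<tau>'_def)
      also have "\<dots> = isl (lab q)" using \<tau>(2) pq by auto
      finally show ?thesis using True yp isl_pq by simp
    next
      case False
      moreover have "x \<noteq> q" using x xs by blast
      ultimately have "\<tau>' x = \<tau> x" by (simp add: \<tau>'_def)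
      then show ?thesis using \<tau>(2) x xs by auto
    qed
    then show "isl (lab' (\<tau>' x)) = isl (lab' x)" by (simp add: isl')
  qed
  ultimately show ?thesis
    unfolding spans_surface_def using xs(2) \<tau>(3) \<tau>'X
    by (intro exI[of _ xs] exI[of _ lab'] exI[of _ \<tau>']) auto
qed

text \<open>\<open>\<tau>\<close> and its discs are kept. Only the cyclic successor changes, by two
  transpositions, each of which loses at most one base-point disc.\<close>

lemma spans_surface_swap_segments:
  assumes "spans_surface m n (u @ v @ w) e" "u \<noteq> []"
  shows "spans_surface m n (u @ w @ v) (e - 2)"
proof (cases "v = [] \<or> w = []")
  case True
  then show ?thesis using assms(1) by (auto intro: spans_surface_mono)
next
  case False
  obtain xs lab \<tau> where xs: "distinct xs" "map lab xs = u @ v @ w" "\<tau> permutes set xs"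
    "\<forall>x\<in>set xs. isl (lab (\<tau> x)) = isl (lab x)" "e \<le> euler_bound m n lab \<tau> xs"
    using assms(1) by (auto simp: spans_surface_def)
  obtain us vws where us: "xs = us @ vws" "u = map lab us" "v @ w = map lab vws"
    using xs(2) unfolding map_eq_append_conv by blast
  obtain vs ws where "vws = vs @ ws" "v = map lab vs" "w = map lab ws"
    using us(3)[symmetric] unfolding map_eq_append_conv by blast
  with us have s: "xs = us @ vs @ ws" "map lab us = u" "map lab vs = v" "map lab ws = w"
    by simp_all
  have ne: "us \<noteq> []" "vs \<noteq> []" "ws \<noteq> []" using s assms(2) False by auto
  let ?ys = "us @ ws @ vs"
  let ?F = "finv \<tau> \<circ> cycle_of_list xs"
  have set_ys: "set ?ys = set xs" using s by auto
  have F: "?F permutes set xs" by (rule inv_cycle_permutes[OF xs(3)])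
  have l: "last us \<in> set xs" "last vs \<in> set xs" "last ws \<in> set xs" using s ne by auto
  have F': "?F \<circ> transpose (last us) (last ws) permutes set xs"
    by (rule permutes_comp_transpose[OF F l(1,3)])
  have "finv \<tau> \<circ> cycle_of_list ?ys =
      ?F \<circ> transpose (last us) (last ws) \<circ> transpose (last us) (last vs)"
    using cycle_of_list_swap_segments[of us vs ws] xs(1) s(1) ne by (simp add: comp_assoc)
  then have "num_orbits ?F (set xs) \<le> num_orbits (finv \<tau> \<circ> cycle_of_list ?ys) (set xs) + 2"
    using num_orbits_comp_transpose_ge[OF F _ l(1,3)] num_orbits_comp_transpose_ge[OF F' _ l(1,2)]
    by simp
  then have "euler_bound m n lab \<tau> xs \<le> euler_bound m n lab \<tau> ?ys + 2"
    unfolding euler_bound_def set_ys by (simp add: s(1))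
  then show ?thesis
    unfolding spans_surface_def using xs s set_ys
    by (intro exI[of _ ?ys] exI[of _ lab] exI[of _ \<tau>]) auto
qed

section \<open>Invariance under equality in the free product\<close>

lemma spans_surface_congruence:
  assumes "\<And>w e. w \<noteq> [] \<Longrightarrow> spans_surface m n (w @ u) e \<longleftrightarrow> spans_surface m n (w @ v) e" "p \<noteq> []"
  shows "spans_surface m n (p @ u @ q) e \<longleftrightarrow> spans_surface m n (p @ v @ q) e"
proof -
  have *: "spans_surface m n (p @ z @ q) e \<longleftrightarrow> spans_surface m n ((q @ p) @ z) e" for z
    using spans_surface_rotate[of m n "p @ z" q e] spans_surface_rotate[of m n q "p @ z" e] by auto
  show ?thesis unfolding * using assms(1)[of "q @ p" e] assms(2) by simp
qed

lemma spans_surface_free_prod_rels: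
  assumes "(u, v) \<in> free_prod_rels (integer_mod_group m) (integer_mod_group n)"
    "m > 0" "n > 0" "w \<noteq> []"
  shows "spans_surface m n (w @ u) e \<longleftrightarrow> spans_surface m n (w @ v) e"
proof -
  have merge: "spans_surface m n (w @ [l1, l2]) e \<longleftrightarrow> spans_surface m n (w @ [l]) e"
    if "merged_letter m n l1 l2 l" for l1 l2 l
    using that spans_surface_merge_letters spans_surface_split_letter by blast
  have null: "spans_surface m n (w @ [l]) e \<longleftrightarrow> spans_surface m n (w @ []) e"
    if "null_letter m n l" for l
    using that spans_surface_insert_null spans_surface_delete_null assms(4) by auto
  have mod: "int k dvd x + y - (x + y) mod int k" for x y k by (simp add: dvd_minus_mod)
  from assms(1) consider
      x y where "u = [Inl x, Inl y]" "v = [Inl (x \<otimes>\<^bsub>integer_mod_group m\<^esub> y)]"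
    | x y where "u = [Inr x, Inr y]" "v = [Inr (x \<otimes>\<^bsub>integer_mod_group n\<^esub> y)]"
    | "u = [Inl \<one>\<^bsub>integer_mod_group m\<^esub>]" "v = []" | "u = [Inr \<one>\<^bsub>integer_mod_group n\<^esub>]" "v = []"
    unfolding free_prod_rels_def by blast
  then show ?thesis
  proof cases
    case (1 x y)
    show ?thesis unfolding 1
      by (rule merge) (use mod assms in \<open>simp add: merged_letter_def lval_A_def lval_B_def mult_integer_mod_group\<close>)
  next
    case (2 x y)
    show ?thesis unfolding 2
      by (rule merge) (use mod assms in \<open>simp add: merged_letter_def lval_A_def lval_B_def mult_integer_mod_group\<close>)
  next
    case 3
    show ?thesis unfolding 3 by (rule null) (simp add: null_letter_def lval_A_def lval_B_def)
  next
    case 4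
    show ?thesis unfolding 4 by (rule null) (simp add: null_letter_def lval_A_def lval_B_def)
  qed
qed

abbreviation prod_letters :: "nat \<Rightarrow> nat \<Rightarrow> (int + int) set" where
  "prod_letters m n \<equiv> carrier (integer_mod_group m) <+> carrier (integer_mod_group n)"

abbreviation prod_rels :: "nat \<Rightarrow> nat \<Rightarrow> ((int + int) list \<times> (int + int) list) set" where
  "prod_rels m n \<equiv> free_prod_rels (integer_mod_group m) (integer_mod_group n)"

abbreviation prod_class :: "nat \<Rightarrow> nat \<Rightarrow> (int + int) list \<Rightarrow> (int + int) list set" where
  "prod_class m n \<equiv> word_class (prod_letters m n) (prod_rels m n)"

text \<open>The letter \<open>l\<close> in front keeps the word nonempty throughout a chain of
  relations, as inserting and deleting null letters requires.\<close>

lemma spans_surface_word_cong: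
  assumes "word_cong (prod_letters m n) (prod_rels m n) u v" "m > 0" "n > 0"
  shows "spans_surface m n (l # u) e \<longleftrightarrow> spans_surface m n (l # v) e"
  using assms(1)
proof (induction rule: word_cong.induct)
  case (cong_rel u v p q)
  show ?case
    using spans_surface_congruence[of m n u v "l # p" q e]
      spans_surface_free_prod_rels[OF cong_rel(1) assms(2,3)] by simp
qed simp_all

lemma cyclic_prod_carrierE:
  assumes "g \<in> carrier (cyclic_prod m n)"
  obtains u where "u \<in> lists (prod_letters m n)" "g = prod_class m n u"
  using assms by (auto simp: free_prod_def word_monoid_def)

lemma prod_class_carrier:
  "u \<in> lists (prod_letters m n) \<Longrightarrow> prod_class m n u \<in> carrier (cyclic_prod m n)"
  by (auto simp: free_prod_def word_monoid_def)

lemma prod_class_append: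
  assumes "u \<in> lists (prod_letters m n)" "v \<in> lists (prod_letters m n)"
  shows "prod_class m n (u @ v) = prod_class m n u \<otimes>\<^bsub>cyclic_prod m n\<^esub> prod_class m n v"
  using word_class_mult[OF assms] by (simp add: free_prod_def)

lemma prod_class_Nil: "prod_class m n [] = \<one>\<^bsub>cyclic_prod m n\<^esub>"
  by (simp add: free_prod_def word_monoid_def)

lemma spans_surface_prod_class:
  assumes "prod_class m n u = prod_class m n v" "u \<in> lists (prod_letters m n)"
    "v \<in> lists (prod_letters m n)" "m > 0" "n > 0" "spans_surface m n (l # u) e"
  shows "spans_surface m n (l # v) e"
  using assms spans_surface_word_cong[of m n u v] word_class_eq_iff[of u "prod_letters m n" v] by blast

lemma euler_bound_singleton:
  assumes "null_letter m n l"
  shows "spans_surface m n [l] 1"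
proof -
  have o: "orbits_on id {0::nat} = {{0}}" by (simp add: orbits_on_def orbit_eq_singleton_iff)
  have "id \<circ> id = (id :: nat \<Rightarrow> nat)" by simp
  then have "euler_bound m n (\<lambda>_. l) id [0] = 1"
    using assms o
    by (simp add: euler_bound_def num_orbits_def num_good_orbits_def null_sum_def null_letter_def inv_id
        del: id_apply comp_id id_comp)
  then show ?thesis
    unfolding spans_surface_def
    by (intro exI[of _ "[0]"] exI[of _ "\<lambda>_. l"] exI[of _ id]) (auto simp: permutes_id)
qed

text \<open>A commutator is created from the trivial word \<open>a a' b b'\<close>, where
  \<open>a'\<close> and \<open>b'\<close> represent the inverses, by exchanging \<open>a'\<close>
  and \<open>b\<close>; this costs 2. The null letter \<open>Inl 0\<close> stands in front, so that
  the empty product is the one-letter word with bound 1.\<close>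

lemma spans_surface_of_commutators:
  assumes "m > 0" "n > 0"
    "set gs \<subseteq> derived_set (cyclic_prod m n) (carrier (cyclic_prod m n))"
  shows "\<exists>w\<in>lists (prod_letters m n).
    prod_class m n w = foldr (\<otimes>\<^bsub>cyclic_prod m n\<^esub>) gs \<one>\<^bsub>cyclic_prod m n\<^esub> \<and>
    spans_surface m n (Inl 0 # w) (1 - 2 * int (length gs))"
  using assms(3)
proof (induction gs)
  case Nil
  show ?case
    using euler_bound_singleton[of m n "Inl 0"]
    by (intro bexI[of _ "[]"]) (auto simp: prod_class_Nil null_letter_def lval_A_def lval_B_def)
next
  case (Cons g gs)
  let ?P = "cyclic_prod m n"
  interpret P: group ?P by (simp add: group_free_prod)
  obtain w where w: "w \<in> lists (prod_letters m n)"
    "prod_class m n w = foldr (\<otimes>\<^bsub>?P\<^esub>) gs \<one>\<^bsub>?P\<^esub>"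
    "spans_surface m n (Inl 0 # w) (1 - 2 * int (length gs))"
    using Cons by auto
  obtain h k where hk: "h \<in> carrier ?P" "k \<in> carrier ?P"
    "g = h \<otimes>\<^bsub>?P\<^esub> k \<otimes>\<^bsub>?P\<^esub> inv\<^bsub>?P\<^esub> h \<otimes>\<^bsub>?P\<^esub> inv\<^bsub>?P\<^esub> k"
    using Cons.prems by auto
  obtain a where a: "a \<in> lists (prod_letters m n)" "h = prod_class m n a"
    using cyclic_prod_carrierE[OF hk(1)] .
  obtain b where b: "b \<in> lists (prod_letters m n)" "k = prod_class m n b"
    using cyclic_prod_carrierE[OF hk(2)] .
  obtain a' where a': "a' \<in> lists (prod_letters m n)" "inv\<^bsub>?P\<^esub> h = prod_class m n a'"
    using cyclic_prod_carrierE[OF P.inv_closed[OF hk(1)]] .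
  obtain b' where b': "b' \<in> lists (prod_letters m n)" "inv\<^bsub>?P\<^esub> k = prod_class m n b'"
    using cyclic_prod_carrierE[OF P.inv_closed[OF hk(2)]] .
  note mem = a(1) b(1) a'(1) b'(1) w(1)
  note cl = mem[THEN prod_class_carrier]
  have "prod_class m n (a @ a' @ b @ b' @ w) =
      (h \<otimes>\<^bsub>?P\<^esub> inv\<^bsub>?P\<^esub> h) \<otimes>\<^bsub>?P\<^esub> (k \<otimes>\<^bsub>?P\<^esub> inv\<^bsub>?P\<^esub> k) \<otimes>\<^bsub>?P\<^esub> prod_class m n w"
    unfolding a'(2) b'(2) unfolding a(2) b(2)
    by (simp add: prod_class_append mem cl P.m_assoc)
  then have "prod_class m n (a @ a' @ b @ b' @ w) = prod_class m n w"
    using hk cl by simp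
  then have "spans_surface m n (Inl 0 # a @ a' @ b @ b' @ w) (1 - 2 * int (length gs))"
    using spans_surface_prod_class[OF _ w(1) _ assms(1,2) w(3), of "a @ a' @ b @ b' @ w"] mem by simp
  then have "spans_surface m n ((b' @ w @ Inl 0 # a) @ a' @ b) (1 - 2 * int (length gs))"
    using spans_surface_rotate[of m n "Inl 0 # a @ a' @ b" "b' @ w"] by simp
  then have "spans_surface m n ((b' @ w @ Inl 0 # a) @ b @ a') (1 - 2 * int (length gs) - 2)"
    by (rule spans_surface_swap_segments) simp
  then have "spans_surface m n (Inl 0 # a @ b @ a' @ b' @ w) (1 - 2 * int (length gs) - 2)"
    using spans_surface_rotate[of m n "b' @ w" "Inl 0 # a @ b @ a'"] by simp
  moreover have "prod_class m n (a @ b @ a' @ b' @ w) = g \<otimes>\<^bsub>?P\<^esub> prod_class m n w"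
    unfolding hk(3) a'(2) b'(2) unfolding a(2) b(2)
    by (simp add: prod_class_append mem cl P.m_assoc)
  ultimately show ?case
    using w mem by (intro bexI[of _ "a @ b @ a' @ b' @ w"]) auto
qed

section \<open>Counting discs with weights on turns\<close>

fun path_weight :: "('i \<Rightarrow> 'i \<Rightarrow> real) \<Rightarrow> 'i \<Rightarrow> 'i list \<Rightarrow> real" where
  "path_weight w x [] = 0"
| "path_weight w x (y # ys) = w x y + path_weight w y ys"

text \<open>A nonempty list stands for the closed walk that starts at its last element.\<close>

definition walk_weight :: "('i \<Rightarrow> 'i \<Rightarrow> real) \<Rightarrow> 'i list \<Rightarrow> real" where
  "walk_weight w ys = path_weight w (last ys) ys"

lemma path_weight_append:
  "path_weight w x (ys @ zs) = path_weight w x ys + path_weight w (last (x # ys)) zs"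
  by (induction ys arbitrary: x) auto

lemma walk_weight_rotate: "walk_weight w (us @ vs) = walk_weight w (vs @ us)"
  by (cases "us = []"; cases "vs = []") (auto simp: walk_weight_def path_weight_append)

lemma walk_weight_replicate:
  assumes "ys \<noteq> []"
  shows "walk_weight w (concat (replicate (Suc k) ys)) = real (Suc k) * walk_weight w ys"
proof -
  have last: "last (concat (replicate (Suc k) ys)) = last ys" for k
    using assms by (induction k) auto
  have "path_weight w (last ys) (concat (replicate k ys)) = real k * walk_weight w ys" for k
    using assms by (induction k) (auto simp: walk_weight_def path_weight_append algebra_simps)
  then show ?thesis using last unfolding walk_weight_def by metis
qed

section \<open>Orbits as closed walks\<close>

lemma orbit_enumeration:
  assumes "f permutes X" "finite X"
  obtains k where "k > 0" "(f ^^ k) x = x" "bij_betw (\<lambda>i. (f ^^ i) x) {..<k} (orbit f x)"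
proof -
  have self: "x \<in> orbit f x" by (rule permutes_self_in_orbit[OF assms])
  define k where "k = (LEAST k. k > 0 \<and> (f ^^ k) x = x)"
  have "\<exists>k>0. (f ^^ k) x = x" using self by (force simp: orbit_altdef)
  then have k: "k > 0" "(f ^^ k) x = x"
    unfolding k_def by (metis (mono_tags, lifting) LeastI_ex)+
  have min: "k \<le> j" if "j > 0" "(f ^^ j) x = x" for j
    unfolding k_def using that by (intro Least_le) auto
  have inj: "inj (f ^^ i)" for i by (rule inj_fn[OF permutes_inj[OF assms(1)]])
  have ne: "(f ^^ i) x \<noteq> (f ^^ j) x" if "i < j" "j < k" for i j
  proof
    assume "(f ^^ i) x = (f ^^ j) x"
    also have "(f ^^ j) x = (f ^^ i) ((f ^^ (j - i)) x)"
      using that by (simp flip: comp_apply[of "f ^^ i"] funpow_add)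
    finally have "(f ^^ (j - i)) x = x" using inj[of i] by (metis injD)
    then show False using min[of "j - i"] that by simp
  qed
  then have "inj_on (\<lambda>i. (f ^^ i) x) {..<k}"
    by (intro linorder_inj_onI) auto
  moreover have "orbit f x = (\<lambda>i. (f ^^ i) x) ` {..<k}"
    using orbit_altdef_bounded[OF k(2,1)] by auto
  ultimately show ?thesis using k that by (simp add: bij_betw_def)
qed

lemma path_weight_iterates:
  "path_weight w (h x) (map (\<lambda>i. h ((f ^^ Suc i) x)) [0..<k]) =
    (\<Sum>i<k. w (h ((f ^^ i) x)) (h (f ((f ^^ i) x))))"
proof (induction k)
  case (Suc k)
  have "last (h x # map (\<lambda>i. h ((f ^^ Suc i) x)) [0..<k]) = h ((f ^^ k) x)"
    by (cases k) auto
  then show ?case using Suc by (simp add: path_weight_append del: funpow.simps last.simps) (simp)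
qed simp

lemma orbit_walk:
  fixes v :: "'i \<Rightarrow> int"
  assumes "f permutes X" "finite X"
  obtains ys where "ys \<noteq> []"
    "walk_weight w ys = (\<Sum>y\<in>orbit f x. w (h y) (h (f y)))"
    "(\<Sum>y\<leftarrow>ys. v y) = (\<Sum>y\<in>orbit f x. v (h y))"
proof -
  obtain k where k: "k > 0" "(f ^^ k) x = x" "bij_betw (\<lambda>i. (f ^^ i) x) {..<k} (orbit f x)"
    using orbit_enumeration[OF assms] .
  \<comment> \<open>The enumeration is shifted by one, so that the last entry belongs to
    \<open>x\<close> itself, where the closed walk starts.\<close>
  define ys where "ys = map (\<lambda>i. h ((f ^^ Suc i) x)) [0..<k]"
  have ne: "ys \<noteq> []" using k by (simp add: ys_def)
  have "last ys = h x" using k by (cases k) (auto simp: ys_def)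
  then have "walk_weight w ys = (\<Sum>i<k. w (h ((f ^^ i) x)) (h (f ((f ^^ i) x))))"
    unfolding walk_weight_def using path_weight_iterates[of w h x f k] by (simp add: ys_def)
  also have "\<dots> = (\<Sum>y\<in>orbit f x. w (h y) (h (f y)))"
    by (rule sum.reindex_bij_betw[OF k(3), of "\<lambda>y. w (h y) (h (f y))"])
  finally have ww: "walk_weight w ys = (\<Sum>y\<in>orbit f x. w (h y) (h (f y)))" .
  have "(\<Sum>y\<leftarrow>ys. v y) = (\<Sum>i<k. v (h ((f ^^ Suc i) x)))"
    by (simp add: ys_def interv_sum_list_conv_sum_set_nat comp_def atLeast0LessThan)
  also have "\<dots> = (\<Sum>i<k. v (h ((f ^^ i) x)))"
  proof -
    have "(\<Sum>i<Suc k. v (h ((f ^^ i) x))) = v (h ((f ^^ 0) x)) + (\<Sum>i<k. v (h ((f ^^ Suc i) x)))"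
      by (rule sum.lessThan_Suc_shift)
    then show ?thesis using k(2) by simp
  qed
  also have "\<dots> = (\<Sum>y\<in>orbit f x. v (h y))"
    by (rule sum.reindex_bij_betw[OF k(3), of "\<lambda>y. v (h y)"])
  finally have vs: "(\<Sum>y\<leftarrow>ys. v y) = (\<Sum>y\<in>orbit f x. v (h y))" .
  with ne ww show ?thesis using that by blast
qed

text \<open>The word \<open>c\<close> is the product of \<open>a\<^sup>e b\<^sup>e\<close> over \<open>e = 1, -2, 2, -1\<close>; \<open>I\<^sub>j\<close> is the index of the letters
  \<open>a\<^sup>e\<close> and \<open>b\<^sup>e\<close> of its \<open>j\<close>-th factor.\<close>

datatype letter_index = I0 | I1 | I2 | I3

fun expo :: "letter_index \<Rightarrow> int" where
  "expo I0 = 1" | "expo I1 = -2" | "expo I2 = 2" | "expo I3 = -1"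

fun next_index :: "letter_index \<Rightarrow> letter_index" where
  "next_index I0 = I1" | "next_index I1 = I2" | "next_index I2 = I3" | "next_index I3 = I0"

definition total_expo :: "letter_index list \<Rightarrow> int" where
  "total_expo ys = (\<Sum>y\<leftarrow>ys. expo y)"

text \<open>These are the constraints of the dual programme: one for each closed walk that can bound
  a disc.\<close>

definition disc_weight :: "nat \<Rightarrow> (letter_index \<Rightarrow> letter_index \<Rightarrow> real) \<Rightarrow> bool" where
  "disc_weight m w \<longleftrightarrow> (\<forall>ys. ys \<noteq> [] \<longrightarrow> int m dvd total_expo ys \<longrightarrow> walk_weight w ys \<ge> 1)"

text \<open>Going round any closed walk \<open>m\<close> times makes its exponent sum divisible by
  \<open>m\<close>, so \<open>m\<close> times its weight is at least 1.\<close>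

lemma disc_weight_nonneg:
  assumes "disc_weight m w" "m > 0" "ys \<noteq> []"
  shows "walk_weight w ys \<ge> 0"
proof -
  obtain k where k: "m = Suc k" using assms(2) by (cases m) auto
  let ?zs = "concat (replicate (Suc k) ys)"
  have "total_expo (concat (replicate j ys)) = int j * total_expo ys" for j
    by (induction j) (auto simp: total_expo_def algebra_simps)
  then have "int m dvd total_expo ?zs" unfolding k by (metis dvd_triv_left)
  then have "walk_weight w ?zs \<ge> 1" using assms unfolding disc_weight_def by auto
  then have "real (Suc k) * walk_weight w ys \<ge> 1"
    unfolding walk_weight_replicate[OF assms(3)] .
  then show ?thesis using mult_nonneg_nonpos[of "real (Suc k)" "walk_weight w ys"] by linarith
qed

text \<open>The units \<open>g\<close> and \<open>h\<close> account for the free choice of the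
  generators of the two factors. Coprimality lets the disc condition be read off the exponents
  alone.\<close>

locale alternating_word =
  fixes X :: "'p set" and \<sigma> :: "'p \<Rightarrow> 'p" and lab :: "'p \<Rightarrow> int + int" and ix :: "'p \<Rightarrow> letter_index"
    and m n :: nat and g h :: int
  assumes finite_X: "finite X" and \<sigma>: "\<sigma> permutes X" and mn: "m > 0" "n > 0"
    and coprime: "coprime g (int m)" "coprime h (int n)"
    and alternate: "\<And>x. x \<in> X \<Longrightarrow> isl (lab (\<sigma> x)) \<longleftrightarrow> \<not> isl (lab x)"
    and ix_\<sigma>: "\<And>x. x \<in> X \<Longrightarrow> ix (\<sigma> x) = (if isl (lab x) then ix x else next_index (ix x))"
    and lab_A: "\<And>x. x \<in> X \<Longrightarrow> isl (lab x) \<Longrightarrow> int m dvd lval_A (lab x) - g * expo (ix x)"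
    and lab_B: "\<And>x. x \<in> X \<Longrightarrow> \<not> isl (lab x) \<Longrightarrow> int n dvd lval_B (lab x) - h * expo (ix x)"
begin

definition type_preserving :: "('p \<Rightarrow> 'p) \<Rightarrow> bool" where
  "type_preserving \<tau> \<longleftrightarrow> \<tau> permutes X \<and> (\<forall>x\<in>X. isl (lab (\<tau> x)) = isl (lab x))"

abbreviation corners :: "('p \<Rightarrow> 'p) \<Rightarrow> 'p \<Rightarrow> 'p" where
  "corners \<tau> \<equiv> finv \<tau> \<circ> \<sigma>"

lemma corners_permutes: "type_preserving \<tau> \<Longrightarrow> corners \<tau> permutes X"
  unfolding type_preserving_def by (intro permutes_compose \<sigma> permutes_inv) auto

lemma corners_in: "type_preserving \<tau> \<Longrightarrow> x \<in> X \<Longrightarrow> corners \<tau> x \<in> X"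
  using permutes_in_image[OF corners_permutes] by blast

lemma \<tau>_corners: "type_preserving \<tau> \<Longrightarrow> \<tau> (corners \<tau> x) = \<sigma> x"
  using permutes_inverses(1) by (auto simp: type_preserving_def)

lemma corners_type:
  assumes "type_preserving \<tau>" "x \<in> X"
  shows "isl (lab (corners \<tau> x)) \<longleftrightarrow> \<not> isl (lab x)"
proof -
  have "isl (lab (\<tau> (corners \<tau> x))) = isl (lab (corners \<tau> x))"
    using assms corners_in[OF assms] unfolding type_preserving_def by blast
  then show ?thesis using \<tau>_corners[OF assms(1)] alternate[OF assms(2)] by simp
qed

text \<open>Types alternate along \<open>corners \<tau>\<close>, so no cycle has length one. From a
  longer cycle the pair of \<open>x\<close> and its image is cut off by a transposition of two
  letters of equal type: one base-point orbit is gained and at most one good orbit is lost. The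
  number of points outside two-cycles decreases.\<close>

lemma exists_involutive:
  assumes "type_preserving \<tau>"
  shows "\<exists>\<tau>'. type_preserving \<tau>' \<and> (\<forall>x\<in>X. corners \<tau>' (corners \<tau>' x) = x) \<and>
    num_good_orbits (null_sum m n lab) \<tau> X + num_orbits (corners \<tau>) X \<le>
    num_good_orbits (null_sum m n lab) \<tau>' X + num_orbits (corners \<tau>') X"
  using assms
proof (induction "card {x \<in> X. corners \<tau> (corners \<tau> x) \<noteq> x}" arbitrary: \<tau> rule: less_induct)
  case less
  note \<tau> = less(2)
  show ?case
  proof (cases "\<forall>x\<in>X. corners \<tau> (corners \<tau> x) = x")
    case False
    define F where "F = corners \<tau>"
    have F: "F permutes X" unfolding F_def by (rule corners_permutes[OF \<tau>])
    have Fin: "F x \<in> X \<longleftrightarrow> x \<in> X" for x by (rule permutes_in_image[OF F])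
    have Fty: "isl (lab (F x)) \<longleftrightarrow> \<not> isl (lab x)" if "x \<in> X" for x
      unfolding F_def by (rule corners_type[OF \<tau> that])
    obtain x where x: "x \<in> X" "F (F x) \<noteq> x" using False unfolding F_def by blast
    define z where "z = finv F x"
    have Fz: "F z = x" unfolding z_def by (rule permutes_inverses(1)[OF F])
    have zX: "z \<in> X" using Fin[of z] Fz x by simp
    have zFx: "z \<noteq> F x" using Fz x by auto
    have xFx: "x \<noteq> F x" using Fty[OF x(1)] by auto
    have xz: "x \<noteq> z" using Fty[OF zX] Fz by auto
    let ?t = "transpose (F (F x)) x"
    define \<tau>' where "\<tau>' = \<tau> \<circ> ?t"
    have \<tau>perm: "\<tau> permutes X" using \<tau> by (simp add: type_preserving_def)
    have ffx: "F (F x) \<in> X" using Fin x by simp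
    have "type_preserving \<tau>'"
      unfolding type_preserving_def
    proof (intro conjI ballI)
      show "\<tau>' permutes X"
        unfolding \<tau>'_def by (rule permutes_comp_transpose[OF \<tau>perm ffx x(1)])
      fix u assume u: "u \<in> X"
      have "isl (lab (F (F x))) = isl (lab x)" using Fty x Fin by simp
      moreover have "isl (lab (\<tau>' u)) = isl (lab (?t u))"
      proof -
        have "?t u \<in> X" using u ffx x by (simp add: transpose_def)
        then show ?thesis using \<tau> by (simp add: \<tau>'_def type_preserving_def)
      qed
      ultimately show "isl (lab (\<tau>' u)) = isl (lab u)" by (simp add: transpose_def)
    qed
    moreover define G where "G = corners \<tau>'"
    have G_eq: "G = F \<circ> transpose (F x) z"
    proof -
      have "G = ?t \<circ> F" unfolding G_def F_def \<tau>'_def inv_comp_transpose[OF \<tau>perm] by (simp add: comp_assoc)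
      moreover have "?t \<circ> F = F \<circ> transpose (F x) z"
      proof
        fix u
        have "F u = F (F x) \<longleftrightarrow> u = F x" "F u = x \<longleftrightarrow> u = z"
          using permutes_inj[OF F] Fz by (metis injD)+
        then show "(?t \<circ> F) u = (F \<circ> transpose (F x) z) u"
          using Fz by (auto simp: transpose_def)
      qed
      ultimately show ?thesis by simp
    qed
    have G: "G permutes X" unfolding G_eq by (rule permutes_comp_transpose[OF F]) (use Fin x zX in auto)
    have Gx: "G x = F x" "G (F x) = x" "G z = F (F x)"
      using xFx xz zFx Fz by (auto simp: G_eq)
    have "z \<notin> orbit G (F x)"
    proof -
      have "u \<in> {x, F x}" if "u \<in> orbit G (F x)" for u
        using that by induction (use Gx in auto)
      then show ?thesis using xz zFx by auto
    qed
    then have "orbit G (F x) \<noteq> orbit G z"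
      using permutes_self_in_orbit[OF G finite_X, of z] by auto
    then have orb: "num_orbits G X = num_orbits F X + 1"
      unfolding G_eq by (intro num_orbits_comp_transpose_eq[OF F finite_X]) (use Fin x zX in auto)
    have good: "num_good_orbits (null_sum m n lab) \<tau> X \<le> num_good_orbits (null_sum m n lab) \<tau>' X + 1"
      unfolding \<tau>'_def
      by (rule num_good_orbits_comp_transpose_ge[OF \<tau>perm finite_X ffx x(1) additive_null_sum])
    have "{u \<in> X. G (G u) \<noteq> u} \<subset> {u \<in> X. F (F u) \<noteq> u}"
    proof (rule psubsetI)
      show "{u \<in> X. G (G u) \<noteq> u} \<subseteq> {u \<in> X. F (F u) \<noteq> u}"
      proof (clarify)
        fix u assume u: "u \<in> X" "G (G u) \<noteq> u" "F (F u) = u"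
        have "u \<noteq> F x" "u \<noteq> x" using Gx u(2) by auto
        moreover have "u \<noteq> z" using u(3) Fz zFx by auto
        ultimately have "G u = F u" by (simp add: G_eq)
        moreover have "F u \<noteq> F x" using permutes_inj[OF F] \<open>u \<noteq> x\<close> by (metis injD)
        moreover have "F u \<noteq> z" using u(3) Fz \<open>u \<noteq> x\<close> by auto
        ultimately have "G (G u) = F (F u)" by (simp add: G_eq)
        then show False using u by simp
      qed
      have "x \<in> {u \<in> X. F (F u) \<noteq> u}" "x \<notin> {u \<in> X. G (G u) \<noteq> u}" using x Gx by simp_all
      then show "{u \<in> X. G (G u) \<noteq> u} \<noteq> {u \<in> X. F (F u) \<noteq> u}" by metis
    qed
    then have "card {u \<in> X. G (G u) \<noteq> u} < card {u \<in> X. F (F u) \<noteq> u}"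
      using finite_X by (intro psubset_card_mono) auto
    ultimately obtain \<tau>'' where "type_preserving \<tau>''" "\<forall>x\<in>X. corners \<tau>'' (corners \<tau>'' x) = x"
      "num_good_orbits (null_sum m n lab) \<tau>' X + num_orbits G X \<le>
       num_good_orbits (null_sum m n lab) \<tau>'' X + num_orbits (corners \<tau>'') X"
      using less(1)[of \<tau>'] unfolding F_def G_def by blast
    then show ?thesis
      using orb good unfolding F_def by (intro exI[of _ \<tau>'']) auto
  qed (use \<tau> in blast)
qed

definition turn_weight :: "(letter_index \<Rightarrow> letter_index \<Rightarrow> real) \<Rightarrow> (letter_index \<Rightarrow> letter_index \<Rightarrow> real)
    \<Rightarrow> 'p \<Rightarrow> 'p \<Rightarrow> real" where
  "turn_weight wA wB x y = (if isl (lab x) then wA (ix x) (ix y) else wB (ix x) (ix y))"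

text \<open>Such an orbit stays in one factor and is a closed walk of indices. If it bounds a disc,
  its exponent sum is divisible by the order; otherwise nonnegativity is enough.\<close>

lemma orbit_turn_weight:
  assumes "type_preserving \<tau>" "x \<in> X" "disc_weight m wA" "disc_weight n wB"
  shows "(\<Sum>y\<in>orbit \<tau> x. turn_weight wA wB y (\<tau> y)) \<ge> (if null_sum m n lab (orbit \<tau> x) then 1 else 0)"
proof -
  have \<tau>: "\<tau> permutes X" using assms(1) by (simp add: type_preserving_def)
  have sub: "orbit \<tau> x \<subseteq> X" by (rule permutes_orbit_subset[OF \<tau> assms(2)])
  have ty: "isl (lab y) = isl (lab x)" if "y \<in> orbit \<tau> x" for y
    using that
  proof induction
    case base
    then show ?case using assms(1,2) by (simp add: type_preserving_def)
  next
    case (step y)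
    then show ?case using assms(1) sub by (auto simp: type_preserving_def)
  qed
  have key: "(\<Sum>y\<in>orbit \<tau> x. w (ix y) (ix (\<tau> y))) \<ge> (if null_sum m n lab (orbit \<tau> x) then 1 else 0)"
    if w: "disc_weight k w" "k > 0" and c: "coprime c (int k)"
      and d: "\<And>y. y \<in> orbit \<tau> x \<Longrightarrow> int k dvd lv (lab y) - c * expo (ix y)"
      and nl: "null_sum m n lab (orbit \<tau> x) \<Longrightarrow> int k dvd (\<Sum>y\<in>orbit \<tau> x. lv (lab y))"
    for w k c and lv :: "int + int \<Rightarrow> int"
  proof -
    obtain ys where ys: "ys \<noteq> []"
      "walk_weight w ys = (\<Sum>y\<in>orbit \<tau> x. w (ix y) (ix (\<tau> y)))"
      "(\<Sum>y\<leftarrow>ys. expo y) = (\<Sum>y\<in>orbit \<tau> x. expo (ix y))"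
      using orbit_walk[OF \<tau> finite_X, where h = ix and w = w and v = expo and x = x] by metis
    show ?thesis
    proof (cases "null_sum m n lab (orbit \<tau> x)")
      case True
      have "int k dvd (\<Sum>y\<in>orbit \<tau> x. lv (lab y) - c * expo (ix y))"
        using d by (rule dvd_sum)
      then have "int k dvd (\<Sum>y\<in>orbit \<tau> x. lv (lab y)) - c * (\<Sum>y\<in>orbit \<tau> x. expo (ix y))"
        by (simp add: sum_subtractf sum_distrib_left)
      then have "int k dvd c * total_expo ys"
        using dvd_diff[OF nl[OF True]] ys(3) unfolding total_expo_def by fastforce
      then have "int k dvd total_expo ys"
        using c by (simp add: coprime_commute coprime_dvd_mult_right_iff)
      then show ?thesis using w ys unfolding disc_weight_def by auto
    next
      case False
      then show ?thesis using disc_weight_nonneg[OF w ys(1)] ys(2) by simp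
    qed
  qed
  show ?thesis
  proof (cases "isl (lab x)")
    case True
    have "(\<Sum>y\<in>orbit \<tau> x. turn_weight wA wB y (\<tau> y)) = (\<Sum>y\<in>orbit \<tau> x. wA (ix y) (ix (\<tau> y)))"
      using ty True by (intro sum.cong) (auto simp: turn_weight_def)
    also have "\<dots> \<ge> (if null_sum m n lab (orbit \<tau> x) then 1 else 0)"
    proof (rule key[OF assms(3) mn(1) coprime(1)])
      show "int m dvd lval_A (lab y) - g * expo (ix y)" if "y \<in> orbit \<tau> x" for y
        using that sub ty True lab_A by blast
    qed (simp add: null_sum_def)
    finally show ?thesis .
  next
    case False
    have "(\<Sum>y\<in>orbit \<tau> x. turn_weight wA wB y (\<tau> y)) = (\<Sum>y\<in>orbit \<tau> x. wB (ix y) (ix (\<tau> y)))"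
      using ty False by (intro sum.cong) (auto simp: turn_weight_def)
    also have "\<dots> \<ge> (if null_sum m n lab (orbit \<tau> x) then 1 else 0)"
    proof (rule key[OF assms(4) mn(2) coprime(2)])
      show "int n dvd lval_B (lab y) - h * expo (ix y)" if "y \<in> orbit \<tau> x" for y
        using that sub ty False lab_B by blast
    qed (simp add: null_sum_def)
    finally show ?thesis .
  qed
qed

lemma num_good_orbits_le_weight:
  assumes "type_preserving \<tau>" "disc_weight m wA" "disc_weight n wB"
  shows "real (num_good_orbits (null_sum m n lab) \<tau> X) \<le> (\<Sum>x\<in>X. turn_weight wA wB x (\<tau> x))"
proof -
  have \<tau>: "\<tau> permutes X" using assms(1) by (simp add: type_preserving_def)
  have fin: "finite (orbits_on \<tau> X)" using finite_X by (simp add: orbits_on_def)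
  have "real (num_good_orbits (null_sum m n lab) \<tau> X) =
      (\<Sum>A\<in>orbits_on \<tau> X. if null_sum m n lab A then 1 else 0)"
    using fin by (simp add: num_good_orbits_def sum.If_cases Int_def)
  also have "\<dots> \<le> (\<Sum>A\<in>orbits_on \<tau> X. \<Sum>y\<in>A. turn_weight wA wB y (\<tau> y))"
  proof (rule sum_mono)
    fix A assume "A \<in> orbits_on \<tau> X"
    then obtain x where "x \<in> X" "A = orbit \<tau> x" by (auto simp: orbits_on_def)
    then show "(if null_sum m n lab A then 1 else 0) \<le> (\<Sum>y\<in>A. turn_weight wA wB y (\<tau> y))"
      using orbit_turn_weight[OF assms(1) _ assms(2,3)] by simp
  qed
  also have "\<dots> = (\<Sum>x\<in>X. turn_weight wA wB x (\<tau> x))"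
    by (rule orbits_on_sum[OF \<tau> finite_X, symmetric])
  finally show ?thesis .
qed

lemma num_orbits_fixpoint_free:
  assumes "f permutes X" "\<And>x. x \<in> X \<Longrightarrow> f x \<noteq> x"
  shows "2 * num_orbits f X \<le> card X"
proof -
  have "2 \<le> card A" if A: "A \<in> orbits_on f X" for A
  proof -
    obtain x where x: "x \<in> X" "A = orbit f x" using A by (auto simp: orbits_on_def)
    have "finite A" using permutes_orbit_subset[OF assms(1) x(1)] finite_X x(2) finite_subset by blast
    moreover have "{x, f x} \<subseteq> A"
      using x permutes_self_in_orbit[OF assms(1) finite_X] by (auto intro: orbit.base)
    ultimately have "card {x, f x} \<le> card A" by (rule card_mono)
    then show ?thesis using assms(2)[OF x(1)] by auto
  qed
  then have "(\<Sum>A\<in>orbits_on f X. 2) \<le> (\<Sum>A\<in>orbits_on f X. card A)" by (rule sum_mono)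
  also have "\<dots> = (\<Sum>A\<in>orbits_on f X. \<Sum>x\<in>A. 1)" by simp
  also have "\<dots> = (\<Sum>x\<in>X. 1)" by (rule orbits_on_sum[OF assms(1) finite_X, symmetric])
  finally show ?thesis by (simp add: num_orbits_def)
qed

text \<open>This is weak duality. After the reduction to two-cycles, every \<open>a\<close>-letter
  is paired with a \<open>b\<close>-letter across an arc, and the two turns at this arc have total
  weight \<open>lam\<close>, which depends only on the \<open>a\<close>-letter.\<close>

theorem orbit_count_bound:
  assumes "type_preserving \<tau>" "disc_weight m wA" "disc_weight n wB"
    and lam: "\<And>i j. wA i (next_index j) + wB j i = lam i"
  shows "real (num_good_orbits (null_sum m n lab) \<tau> X) + real (num_orbits (corners \<tau>) X) \<le>
    real (card X) / 2 + (\<Sum>x | x \<in> X \<and> isl (lab x). lam (ix x))"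
proof -
  obtain \<tau>' where \<tau>': "type_preserving \<tau>'" "\<And>x. x \<in> X \<Longrightarrow> corners \<tau>' (corners \<tau>' x) = x"
    "num_good_orbits (null_sum m n lab) \<tau> X + num_orbits (corners \<tau>) X \<le>
     num_good_orbits (null_sum m n lab) \<tau>' X + num_orbits (corners \<tau>') X"
    using exists_involutive[OF assms(1)] by blast
  define F where "F = corners \<tau>'"
  have FX: "F x \<in> X" if "x \<in> X" for x unfolding F_def by (rule corners_in[OF \<tau>'(1) that])
  have Fty: "isl (lab (F x)) \<longleftrightarrow> \<not> isl (lab x)" if "x \<in> X" for x
    unfolding F_def by (rule corners_type[OF \<tau>'(1) that])
  have FF: "F (F x) = x" if "x \<in> X" for x unfolding F_def by (rule \<tau>'(2)[OF that])
  have \<tau>F: "\<tau>' (F x) = \<sigma> x" for x unfolding F_def by (rule \<tau>_corners[OF \<tau>'(1)])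
  let ?A = "{x \<in> X. isl (lab x)}" and ?B = "{x \<in> X. \<not> isl (lab x)}"
  let ?W = "\<lambda>x. turn_weight wA wB x (\<tau>' x)"
  have bij: "bij_betw F ?A ?B"
    by (rule bij_betw_byWitness[where f' = F]) (auto simp: FF FX Fty)
  have "(\<Sum>x\<in>X. ?W x) = (\<Sum>x\<in>?A. ?W x) + (\<Sum>x\<in>?B. ?W x)"
    using finite_X by (subst sum.union_disjoint[symmetric]) (auto intro!: sum.cong)
  also have "(\<Sum>x\<in>?B. ?W x) = (\<Sum>x\<in>?A. ?W (F x))"
    by (rule sum.reindex_bij_betw[OF bij, symmetric])
  also have "(\<Sum>x\<in>?A. ?W x) + (\<Sum>x\<in>?A. ?W (F x)) = (\<Sum>x\<in>?A. lam (ix x))"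
    unfolding sum.distrib[symmetric]
  proof (rule sum.cong)
    fix x assume "x \<in> ?A"
    then have x: "x \<in> X" "isl (lab x)" by auto
    \<comment> \<open>If \<open>x\<close> has index i and its partner \<open>F x\<close> has index
      j, the turn at \<open>x\<close> goes from i to the successor of j, and the turn at
      \<open>F x\<close> goes from j to i.\<close>
    have "\<tau>' x = \<sigma> (F x)" using \<tau>F[of "F x"] FF[OF x(1)] by simp
    then have "ix (\<tau>' x) = next_index (ix (F x))" "ix (\<tau>' (F x)) = ix x"
      using ix_\<sigma>[OF FX[OF x(1)]] ix_\<sigma>[OF x(1)] Fty[OF x(1)] x \<tau>F by simp_all
    then show "?W x + ?W (F x) = lam (ix x)"
      using x Fty[OF x(1)] lam by (simp add: turn_weight_def)
  qed simp
  finally have "real (num_good_orbits (null_sum m n lab) \<tau>' X) \<le> (\<Sum>x\<in>?A. lam (ix x))"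
    using num_good_orbits_le_weight[OF \<tau>'(1) assms(2,3)] by simp
  moreover have "2 * num_orbits F X \<le> card X"
  proof (rule num_orbits_fixpoint_free)
    show "F permutes X" unfolding F_def by (rule corners_permutes[OF \<tau>'(1)])
    show "F x \<noteq> x" if "x \<in> X" for x using Fty[OF that] by auto
  qed
  ultimately show ?thesis using \<tau>'(3) unfolding F_def by linarith
qed

end

section \<open>The optimal weights\<close>

fun expo_size :: "letter_index \<Rightarrow> int" where
  "expo_size I0 = 1" | "expo_size I1 = 2" | "expo_size I2 = 2" | "expo_size I3 = 1"

definition total_size :: "letter_index list \<Rightarrow> int" where
  "total_size ys = (\<Sum>y\<leftarrow>ys. expo_size y)"

abbreviation pos_letters :: "letter_index set" where "pos_letters \<equiv> {I0, I2}"
abbreviation neg_letters :: "letter_index set" where "neg_letters \<equiv> {I1, I3}"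

definition sign_change :: "letter_index \<Rightarrow> letter_index \<Rightarrow> real" where
  "sign_change i j = (if i \<in> pos_letters \<longleftrightarrow> j \<in> pos_letters then 0 else 1)"

lemma total_size_simps [simp]:
  "total_size [] = 0" "total_size (y # ys) = expo_size y + total_size ys"
  "total_size (us @ vs) = total_size us + total_size vs"
  by (simp_all add: total_size_def)

lemma total_expo_simps [simp]:
  "total_expo [] = 0" "total_expo (y # ys) = expo y + total_expo ys"
  "total_expo (us @ vs) = total_expo us + total_expo vs"
  by (simp_all add: total_expo_def)

lemma total_expo_pos: "set ys \<subseteq> pos_letters \<Longrightarrow> total_expo ys = total_size ys"
  by (induction ys) auto

lemma total_expo_neg: "set ys \<subseteq> neg_letters \<Longrightarrow> total_expo ys = - total_size ys"
  by (induction ys) auto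

lemma total_size_ge: "\<bar>total_expo ys\<bar> \<le> total_size ys"
proof (induction ys)
  case (Cons y ys)
  then show ?case by (cases y) auto
qed simp

lemma path_weight_nonneg:
  assumes "\<And>i j. w i j \<ge> 0"
  shows "path_weight w x ys \<ge> 0"
  using assms by (induction ys arbitrary: x) auto

text \<open>The potential \<open>p\<close> telescopes along the path, and so disappears on closed
  walks.\<close>

lemma path_weight_potential:
  assumes "\<And>i j. i \<in> D \<Longrightarrow> j \<in> D \<Longrightarrow> w i j \<ge> v j + p j - p i + r * c i j" "set (x # ys) \<subseteq> D"
  shows "path_weight w x ys \<ge> (\<Sum>y\<leftarrow>ys. v y) + p (last (x # ys)) - p x + r * path_weight c x ys"
  using assms(2)
proof (induction ys arbitrary: x)
  case (Cons y ys)
  have "w x y \<ge> v y + p y - p x + r * c x y" using Cons.prems by (intro assms(1)) auto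
  moreover have "path_weight w y ys \<ge> (\<Sum>y\<leftarrow>ys. v y) + p (last (y # ys)) - p y + r * path_weight c y ys"
    using Cons by auto
  ultimately show ?case by (simp add: algebra_simps)
qed simp

lemma walk_weight_potential:
  assumes "\<And>i j. i \<in> D \<Longrightarrow> j \<in> D \<Longrightarrow> w i j \<ge> v j + p j - p i + r * c i j" "set ys \<subseteq> D" "ys \<noteq> []"
  shows "walk_weight w ys \<ge> (\<Sum>y\<leftarrow>ys. v y) + r * walk_weight c ys"
proof -
  have "path_weight w (last ys) ys \<ge> (\<Sum>y\<leftarrow>ys. v y) + p (last (last ys # ys)) - p (last ys) +
      r * path_weight c (last ys) ys"
    by (rule path_weight_potential[where D = D, OF assms(1)]) (use assms(2,3) in auto)
  then show ?thesis using assms(3) by (simp add: walk_weight_def)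
qed

section \<open>Closed walks cut into runs of equal sign\<close>

lemma rotate_to_boundary:
  assumes "y \<in> set ys" "Q y" "z \<in> set ys" "\<not> Q z"
  obtains us vs where "ys = us @ vs" "vs @ us \<noteq> []" "Q (hd (vs @ us))" "\<not> Q (last (vs @ us))"
proof (cases "Q (last ys)")
  case False
  obtain us x vs where *: "ys = us @ x # vs" "Q x" "\<forall>u\<in>set us. \<not> Q u"
    using split_list_first_prop[of ys Q] assms by blast
  have "\<not> Q (last ((x # vs) @ us))" using * False by (cases "us = []") auto
  then show ?thesis using * by (intro that[of us "x # vs"]) auto
next
  case True
  obtain us x vs where *: "ys = us @ x # vs" "\<not> Q x" "\<forall>u\<in>set vs. Q u"
    using split_list_last_prop[of ys "\<lambda>x. \<not> Q x"] assms by blast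
  then have "vs \<noteq> []" using True by auto
  then show ?thesis
    using * by (intro that[of "us @ [x]" vs]) auto
qed

lemma sign_change_ge_0: "sign_change i j \<ge> 0"
  by (simp add: sign_change_def)

lemma pos_neg: "i \<notin> pos_letters \<longleftrightarrow> i \<in> neg_letters"
  by (cases i) auto

text \<open>After a rotation the walk starts positive and ends negative. If something remains behind
  its first positive and first negative run, the sign changes at both ends of these two runs, hence
  at three places at least.\<close>

lemma walk_cases:
  assumes "ys \<noteq> []"
  obtains (pos) "set ys \<subseteq> pos_letters"
    | (neg) "set ys \<subseteq> neg_letters"
    | (two) us vs p ps n ns where "ys = us @ vs" "vs @ us = (p # ps) @ (n # ns)"
        "set (p # ps) \<subseteq> pos_letters" "set (n # ns) \<subseteq> neg_letters"
    | (many) "walk_weight sign_change ys \<ge> 3"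
proof (cases "set ys \<subseteq> pos_letters \<or> set ys \<subseteq> neg_letters")
  case False
  then obtain y z where yz: "y \<in> set ys" "y \<in> pos_letters" "z \<in> set ys" "z \<notin> pos_letters"
    using pos_neg by blast
  obtain us vs where uv: "ys = us @ vs" "vs @ us \<noteq> []" "hd (vs @ us) \<in> pos_letters"
    "last (vs @ us) \<notin> pos_letters"
    using rotate_to_boundary[of y ys "\<lambda>i. i \<in> pos_letters" z] yz by metis
  define zs where "zs = vs @ us"
  define P where "P = takeWhile (\<lambda>i. i \<in> pos_letters) zs"
  define R where "R = dropWhile (\<lambda>i. i \<in> pos_letters) zs"
  define M where "M = takeWhile (\<lambda>i. i \<notin> pos_letters) R"
  define R' where "R' = dropWhile (\<lambda>i. i \<notin> pos_letters) R"
  have zs: "zs = P @ R" "R = M @ R'" by (simp_all add: P_def R_def M_def R'_def)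
  have zs_hd: "zs \<noteq> []" "hd zs \<in> pos_letters" using uv by (auto simp: zs_def)
  have "set P \<subseteq> pos_letters" unfolding P_def using set_takeWhileD by fastforce
  moreover have "P \<noteq> []" using zs_hd unfolding P_def by (cases zs) simp_all
  ultimately have P: "set P \<subseteq> pos_letters" "P \<noteq> []" by simp_all
  have "R \<noteq> []"
  proof
    assume "R = []"
    then have "zs = P" using zs by simp
    then show False using P uv(4) last_in_set unfolding zs_def by blast
  qed
  then have hdR: "hd R \<notin> pos_letters" unfolding R_def by (rule hd_dropWhile)
  have "set M \<subseteq> neg_letters" unfolding M_def using set_takeWhileD pos_neg by fastforce
  moreover have "M \<noteq> []" using hdR \<open>R \<noteq> []\<close> unfolding M_def by (cases R) simp_all
  ultimately have M: "set M \<subseteq> neg_letters" "M \<noteq> []" by simp_all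
  show ?thesis
  proof (cases "R' = []")
    case True
    then have "vs @ us = P @ M" using zs by (simp add: zs_def)
    moreover obtain p ps where "P = p # ps" using P by (cases P) auto
    moreover obtain n ns where "M = n # ns" using M by (cases M) auto
    ultimately show ?thesis using two uv P M by metis
  next
    case R': False
    have step: "path_weight sign_change x ws \<ge> 1" if "ws \<noteq> []" "x \<in> pos_letters \<longleftrightarrow> hd ws \<notin> pos_letters" for x ws
      using that path_weight_nonneg[of sign_change "hd ws" "tl ws", OF sign_change_ge_0]
      by (cases ws) (auto simp: sign_change_def)
    have last: "last zs = last R'" using zs R' by simp
    have lastP: "last P \<in> pos_letters" using P last_in_set by blast
    have lastM: "last M \<notin> pos_letters" using M(1) last_in_set[OF M(2)] pos_neg by blast
    have hdR': "hd R' \<in> pos_letters" using R' hd_dropWhile unfolding R'_def by blast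
    have "walk_weight sign_change zs = path_weight sign_change (last R') P +
        (path_weight sign_change (last P) M + path_weight sign_change (last M) R')"
      unfolding walk_weight_def last using P M R' zs by (simp add: path_weight_append)
    moreover have "path_weight sign_change (last R') P \<ge> 1"
      using uv(3,4) last zs(1) P by (intro step) (auto simp: zs_def[symmetric])
    moreover have "path_weight sign_change (last P) M \<ge> 1"
      using lastP M hdR zs(2) by (intro step) auto
    moreover have "path_weight sign_change (last M) R' \<ge> 1"
      using lastM hdR' R' by (intro step) auto
    ultimately have "walk_weight sign_change zs \<ge> 3" by simp
    then show ?thesis using many walk_weight_rotate[of sign_change us vs] uv(1) by (simp add: zs_def)
  qed
qed (use pos neg in blast)

text \<open>The letters of one sign have sizes 1 and 2, so a run with different end letters has size
  at least 3.\<close>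

definition block_reachable :: "letter_index \<Rightarrow> letter_index \<Rightarrow> int \<Rightarrow> bool" where
  "block_reachable p t S \<longleftrightarrow> (if p = t then expo_size p \<le> S else 3 \<le> S)"

text \<open>Dynamic programming along a run: \<open>G\<close> bounds the weight in terms of the
  first letter, the last letter and the size, so only the transitions have to be checked.\<close>

lemma path_weight_block:
  assumes base: "\<And>p. p \<in> D \<Longrightarrow> G p p (expo_size p) \<le> 0"
    and step: "\<And>p t t' S. p \<in> D \<Longrightarrow> t \<in> D \<Longrightarrow> t' \<in> D \<Longrightarrow> block_reachable p t S \<Longrightarrow>
      G p t' (S + expo_size t') \<le> G p t S + w t t'"
    and "set (p # ps) \<subseteq> D" and D: "D = pos_letters \<or> D = neg_letters"
  shows "G p (last (p # ps)) (total_size (p # ps)) \<le> path_weight w p ps \<and>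
    block_reachable p (last (p # ps)) (total_size (p # ps))"
  using assms(3)
proof (induction ps rule: rev_induct)
  case Nil
  then show ?case using base[of p] by (simp add: block_reachable_def)
next
  case (snoc t' ps)
  let ?t = "last (p # ps)" and ?S = "total_size (p # ps)"
  have mem: "p \<in> D" "?t \<in> D" "t' \<in> D" using snoc.prems by (auto intro: subsetD)
  have IH: "G p ?t ?S \<le> path_weight w p ps" "block_reachable p ?t ?S" using snoc by auto
  have "G p t' (?S + expo_size t') \<le> path_weight w p (ps @ [t'])"
    using step[OF mem IH(2)] IH(1) by (simp add: path_weight_append)
  moreover have "block_reachable p t' (?S + expo_size t')"
    using mem IH(2) D unfolding block_reachable_def
    by (cases p; cases "last (p # ps)"; cases t') (auto split: if_splits)
  ultimately show ?case by (simp add: algebra_simps)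
qed

text \<open>Exponent sum zero forces both runs to have the same size, so the closing condition
  concerns only their four end letters and this one size.\<close>

lemma two_block_weight:
  assumes "ys = us @ vs" "vs @ us = (p # ps) @ (n # ns)"
    "set (p # ps) \<subseteq> pos_letters" "set (n # ns) \<subseteq> neg_letters"
    and "\<And>p. G p p (expo_size p) \<le> 0"
    and "\<And>p t t' S. p \<in> pos_letters \<longleftrightarrow> t \<in> pos_letters \<Longrightarrow> t \<in> pos_letters \<longleftrightarrow> t' \<in> pos_letters \<Longrightarrow>
      block_reachable p t S \<Longrightarrow> G p t' (S + expo_size t') \<le> G p t S + w t t'"
    and "\<And>p t u v S. p \<in> pos_letters \<Longrightarrow> t \<in> pos_letters \<Longrightarrow> u \<in> neg_letters \<Longrightarrow> v \<in> neg_letters \<Longrightarrow>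
      block_reachable p t S \<Longrightarrow> block_reachable u v S \<Longrightarrow> G p t S + w t u + G u v S + w v p \<ge> 0"
    and "total_expo ys = 0"
  shows "walk_weight w ys \<ge> 0"
proof -
  have "walk_weight w ys = walk_weight w ((p # ps) @ (n # ns))"
    using walk_weight_rotate[of w us vs] assms(1,2) by simp
  also have "\<dots> = path_weight w p ps + w (last (p # ps)) n + path_weight w n ns + w (last (n # ns)) p"
    by (simp add: walk_weight_def path_weight_append)
  finally have eq: "walk_weight w ys =
    path_weight w p ps + w (last (p # ps)) n + path_weight w n ns + w (last (n # ns)) p" .
  have "total_expo ys = total_expo (vs @ us)" using assms(1) by simp
  also have "\<dots> = total_expo (p # ps) + total_expo (n # ns)" using assms(2) by simp
  also have "\<dots> = total_size (p # ps) - total_size (n # ns)"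
    using total_expo_pos[OF assms(3)] total_expo_neg[OF assms(4)] by simp
  finally have S: "total_size (n # ns) = total_size (p # ps)" using assms(8) by simp
  have step: "G p t' (S + expo_size t') \<le> G p t S + w t t'"
    if "p \<in> D" "t \<in> D" "t' \<in> D" "block_reachable p t S" "D = pos_letters \<or> D = neg_letters" for p t t' S D
    using that by (intro assms(6)) auto
  have P: "G p (last (p # ps)) (total_size (p # ps)) \<le> path_weight w p ps \<and>
      block_reachable p (last (p # ps)) (total_size (p # ps))"
    by (rule path_weight_block[where D = pos_letters, OF assms(5) step[where D = pos_letters] assms(3)]) simp_all
  have M: "G n (last (n # ns)) (total_size (n # ns)) \<le> path_weight w n ns \<and>
      block_reachable n (last (n # ns)) (total_size (n # ns))"
    by (rule path_weight_block[where D = neg_letters, OF assms(5) step[where D = neg_letters] assms(4)]) simp_all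
  have "last (p # ps) \<in> pos_letters" using assms(3) last_in_set[of "p # ps"] by auto
  moreover have "last (n # ns) \<in> neg_letters" using assms(4) last_in_set[of "n # ns"] by auto
  ultimately have "G p (last (p # ps)) (total_size (p # ps)) + w (last (p # ps)) n +
      G n (last (n # ns)) (total_size (p # ps)) + w (last (n # ns)) p \<ge> 0"
    using P M assms(3,4) unfolding S by (intro assms(7)) auto
  then show ?thesis using P M unfolding eq S by linarith
qed

text \<open>The weights are an optimal dual solution of the linear programme that maximises the number of
  discs, scaled by the order \<open>d\<close> of the first factor; \<open>\<eta>\<close> stands for \<open>12 / (d + 1)\<close>, and each sign change
  contributes a further \<open>d / 2\<close>.\<close>

fun small_A :: "real \<Rightarrow> letter_index \<Rightarrow> letter_index \<Rightarrow> real" where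
  "small_A \<eta> I0 I0 = 1" | "small_A \<eta> I0 I1 = -4" | "small_A \<eta> I0 I2 = 3/2" | "small_A \<eta> I0 I3 = 0"
| "small_A \<eta> I1 I0 = 3" | "small_A \<eta> I1 I1 = 2" | "small_A \<eta> I1 I2 = \<eta> / 2" | "small_A \<eta> I1 I3 = 2"
| "small_A \<eta> I2 I0 = 15/2 - 2 * \<eta>" | "small_A \<eta> I2 I1 = - \<eta> / 2" | "small_A \<eta> I2 I2 = 2 - \<eta>" | "small_A \<eta> I2 I3 = 3 - \<eta>"
| "small_A \<eta> I3 I0 = 0" | "small_A \<eta> I3 I1 = 1" | "small_A \<eta> I3 I2 = -15/4" | "small_A \<eta> I3 I3 = 1"

fun small_B :: "real \<Rightarrow> letter_index \<Rightarrow> letter_index \<Rightarrow> real" where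
  "small_B \<eta> I0 I0 = 7/2" | "small_B \<eta> I0 I1 = -3/2 + \<eta>" | "small_B \<eta> I0 I2 = 7/2 - 3/2 * \<eta>" | "small_B \<eta> I0 I3 = 3/2"
| "small_B \<eta> I1 I0 = -2" | "small_B \<eta> I1 I1 = 1/2 + \<eta> / 2" | "small_B \<eta> I1 I2 = 3/2 - \<eta>" | "small_B \<eta> I1 I3 = 25/4"
| "small_B \<eta> I2 I0 = -1/2" | "small_B \<eta> I2 I1 = -3/2 + \<eta>" | "small_B \<eta> I2 I2 = 1/2 - \<eta>" | "small_B \<eta> I2 I3 = 3/2"
| "small_B \<eta> I3 I0 = -3/2" | "small_B \<eta> I3 I1 = -5/2 + \<eta>" | "small_B \<eta> I3 I2 = -4" | "small_B \<eta> I3 I3 = 5/2"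

text \<open>A run of letters of one sign from \<open>p\<close> to \<open>t\<close> with exponent sum \<open>S\<close> or \<open>- S\<close> has weight at least
  \<open>block_A \<eta> p t S\<close> in the first factor and \<open>block_B \<eta> p t S\<close> in the second.\<close>

fun block_A :: "real \<Rightarrow> letter_index \<Rightarrow> letter_index \<Rightarrow> int \<Rightarrow> real" where
  "block_A \<eta> I0 I0 S = (if S \<le> 1 then 0 else if S \<le> 2 then 1 else 2)"
| "block_A \<eta> I0 I2 S = 3/2"
| "block_A \<eta> I2 I0 S = 15/2 - 2 * \<eta>"
| "block_A \<eta> I2 I2 S = (if S \<le> 2 then 0 else 2 - \<eta>)"
| "block_A \<eta> I1 I1 S = (if S \<le> 2 then 0 else 2)"
| "block_A \<eta> I1 I3 S = 2"
| "block_A \<eta> I3 I1 S = 1"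
| "block_A \<eta> I3 I3 S = (if S \<le> 1 then 0 else if S \<le> 2 then 1 else 2)"
| "block_A \<eta> _ _ S = 0"

fun block_B :: "real \<Rightarrow> letter_index \<Rightarrow> letter_index \<Rightarrow> int \<Rightarrow> real" where
  "block_B \<eta> I0 I0 S = (if S \<le> 1 then 0 else if S \<le> 3 then 7/2 else 3 - 3/2 * \<eta>)"
| "block_B \<eta> I0 I2 S = 7/2 - 3/2 * \<eta>"
| "block_B \<eta> I2 I0 S = (if S \<le> 3 then -1/2 else - \<eta>)"
| "block_B \<eta> I2 I2 S = (if S \<le> 2 then 0 else 1/2 - \<eta>)"
| "block_B \<eta> I1 I1 S = (if S \<le> 2 then 0 else 1/2 + \<eta> / 2)"
| "block_B \<eta> I1 I3 S = 25/4"
| "block_B \<eta> I3 I1 S = (if S \<le> 3 then -5/2 + \<eta> else -2 + 3/2 * \<eta>)"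
| "block_B \<eta> I3 I3 S = (if S \<le> 1 then 0 else if S \<le> 2 then 5/2 else 15/4 + \<eta>)"
| "block_B \<eta> _ _ S = 0"

lemma block_A_base: "block_A \<eta> p p (expo_size p) \<le> 0"
  by (cases p) auto

lemma block_B_base: "block_B \<eta> p p (expo_size p) \<le> 0"
  by (cases p) auto

text \<open>A finite check, since the table is piecewise constant in \<open>S\<close> with small
  thresholds. The bound 1/20 on \<eta> leaves enough room in the inequalities.\<close>

lemma block_A_step:
  assumes "0 < \<eta>" "\<eta> \<le> 1/20" "p \<in> pos_letters \<longleftrightarrow> t \<in> pos_letters" "t \<in> pos_letters \<longleftrightarrow> t' \<in> pos_letters"
    "block_reachable p t S"
  shows "block_A \<eta> p t' (S + expo_size t') \<le> block_A \<eta> p t S + small_A \<eta> t t'"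
  using assms by (cases p; cases t; cases t') (auto simp: block_reachable_def)

lemma block_B_step:
  assumes "0 < \<eta>" "\<eta> \<le> 1/20" "p \<in> pos_letters \<longleftrightarrow> t \<in> pos_letters" "t \<in> pos_letters \<longleftrightarrow> t' \<in> pos_letters"
    "block_reachable p t S"
  shows "block_B \<eta> p t' (S + expo_size t') \<le> block_B \<eta> p t S + small_B \<eta> t t'"
  using assms by (cases p; cases t; cases t') (auto simp: block_reachable_def)

lemma block_A_close:
  assumes "0 < \<eta>" "\<eta> \<le> 1/20" "p \<in> pos_letters" "t \<in> pos_letters" "u \<in> neg_letters" "v \<in> neg_letters"
    "block_reachable p t S" "block_reachable u v S"
  shows "block_A \<eta> p t S + small_A \<eta> t u + block_A \<eta> u v S + small_A \<eta> v p \<ge> 0"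
  using assms by (cases p; cases t; cases u; cases v) (auto simp: block_reachable_def)

lemma block_B_close:
  assumes "0 < \<eta>" "\<eta> \<le> 1/20" "p \<in> pos_letters" "t \<in> pos_letters" "u \<in> neg_letters" "v \<in> neg_letters"
    "block_reachable p t S" "block_reachable u v S"
  shows "block_B \<eta> p t S + small_B \<eta> t u + block_B \<eta> u v S + small_B \<eta> v p \<ge> 0"
  using assms by (cases p; cases t; cases u; cases v) (auto simp: block_reachable_def)

definition weight_A :: "real \<Rightarrow> real \<Rightarrow> letter_index \<Rightarrow> letter_index \<Rightarrow> real" where
  "weight_A d \<eta> i j = (small_A \<eta> i j + d / 2 * sign_change i j) / d"

definition weight_B :: "real \<Rightarrow> real \<Rightarrow> letter_index \<Rightarrow> letter_index \<Rightarrow> real" where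
  "weight_B d \<eta> i j = (small_B \<eta> i j + d / 2 * sign_change i j) / d"

text \<open>The four values add up to 6 - \<eta>. Hence one copy of the word accounts for at most 2
  + (6 - \<eta>)/d discs in the factors, and this number determines the lower bound.\<close>

fun turn_total :: "real \<Rightarrow> letter_index \<Rightarrow> real" where
  "turn_total \<eta> I0 = -1/2" | "turn_total \<eta> I1 = 1/2 + \<eta>" | "turn_total \<eta> I2 = 7/2 - 2 * \<eta>" | "turn_total \<eta> I3 = 5/2"

text \<open>The turns \<open>a\<^sub>i \<rightarrow> a\<^sub>j\<^sub>+\<^sub>1\<close> and \<open>b\<^sub>j \<rightarrow> b\<^sub>i\<close> are the two sides of one glued arc.\<close>

lemma weight_A_B:
  assumes "d \<noteq> 0"
  shows "weight_A d \<eta> i (next_index j) + weight_B d \<eta> j i = 1/2 + turn_total \<eta> i / d"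
  using assms by (cases i; cases j) (auto simp: weight_A_def weight_B_def sign_change_def field_simps)

lemma walk_weight_scaled:
  assumes "d > 0"
  shows "walk_weight (\<lambda>i j. (w i j + r * c i j) / d) ys = (walk_weight w ys + r * walk_weight c ys) / d"
proof -
  have "path_weight (\<lambda>i j. (w i j + r * c i j) / d) x ys = (path_weight w x ys + r * path_weight c x ys) / d" for x
    by (induction ys arbitrary: x) (auto simp: field_simps add_divide_distrib)
  then show ?thesis by (simp add: walk_weight_def)
qed

section \<open>Verification of the weights\<close>

lemma sign_change_two_blocks:
  assumes "ys = us @ vs" "vs @ us = (p # ps) @ (n # ns)"
    "set (p # ps) \<subseteq> pos_letters" "set (n # ns) \<subseteq> neg_letters"
  shows "walk_weight sign_change ys = 2"
proof -
  have const: "path_weight sign_change x zs = 0"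
    if "set (x # zs) \<subseteq> D" "D = pos_letters \<or> D = neg_letters" for x zs D
    using that by (induction zs arbitrary: x) (auto simp: sign_change_def)
  have "last (p # ps) \<in> pos_letters" using assms(3) last_in_set[of "p # ps"] by auto
  moreover have "last (n # ns) \<in> neg_letters" using assms(4) last_in_set[of "n # ns"] by auto
  moreover have "walk_weight sign_change ys = walk_weight sign_change ((p # ps) @ (n # ns))"
    using walk_weight_rotate[of sign_change us vs] assms(1,2) by simp
  moreover have "\<dots> = path_weight sign_change p ps + sign_change (last (p # ps)) n +
      path_weight sign_change n ns + sign_change (last (n # ns)) p"
    by (simp add: walk_weight_def path_weight_append)
  ultimately show ?thesis
    using const[of p ps pos_letters] const[of n ns neg_letters] assms(3,4)
    by (auto simp: sign_change_def)
qed

text \<open>Two sign changes already contribute \<open>d\<close>, so for exponent sum zero the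
  remaining weight need only be nonnegative, which \<open>G\<close> certifies. All other walks with
  sign changes are covered by the drift, which grows by 1/5 per unit of size and loses at most 6 per
  sign change.\<close>

lemma disc_weightI:
  fixes d :: real
  assumes d: "d \<ge> 36" "d \<le> real m" and m: "m \<ge> 60"
    and drift: "\<And>i j. w i j \<ge> 1/5 * real_of_int (expo_size j) + p j - p i + (-6) * sign_change i j"
    and base: "\<And>p. G p p (expo_size p) \<le> 0"
    and step: "\<And>p t t' S. p \<in> pos_letters \<longleftrightarrow> t \<in> pos_letters \<Longrightarrow> t \<in> pos_letters \<longleftrightarrow> t' \<in> pos_letters \<Longrightarrow>
      block_reachable p t S \<Longrightarrow> G p t' (S + expo_size t') \<le> G p t S + w t t'"
    and close: "\<And>p t u v S. p \<in> pos_letters \<Longrightarrow> t \<in> pos_letters \<Longrightarrow> u \<in> neg_letters \<Longrightarrow> v \<in> neg_letters \<Longrightarrow>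
      block_reachable p t S \<Longrightarrow> block_reachable u v S \<Longrightarrow> G p t S + w t u + G u v S + w v p \<ge> 0"
    and pos: "\<And>ys. ys \<noteq> [] \<Longrightarrow> set ys \<subseteq> pos_letters \<Longrightarrow> int m dvd total_size ys \<Longrightarrow> walk_weight w ys \<ge> d"
    and neg: "\<And>ys. ys \<noteq> [] \<Longrightarrow> set ys \<subseteq> neg_letters \<Longrightarrow> int m dvd total_size ys \<Longrightarrow> walk_weight w ys \<ge> d"
  shows "disc_weight m (\<lambda>i j. (w i j + d / 2 * sign_change i j) / d)"
  unfolding disc_weight_def
proof (intro allI impI)
  fix ys assume ys: "ys \<noteq> []" "int m dvd total_expo ys"
  have d0: "d > 0" using d by simp
  have changes: "walk_weight sign_change ys \<ge> 0"
    unfolding walk_weight_def by (rule path_weight_nonneg[OF sign_change_ge_0])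
  have size: "(\<Sum>y\<leftarrow>ys. 1/5 * real_of_int (expo_size y)) = 1/5 * real_of_int (total_size ys)"
    by (induction ys) (auto simp: algebra_simps)
  have low: "walk_weight w ys \<ge> 1/5 * real_of_int (total_size ys) - 6 * walk_weight sign_change ys"
    using walk_weight_potential[where D = UNIV and w = w and p = p and r = "-6" and c = sign_change
        and v = "\<lambda>j. 1/5 * real_of_int (expo_size j)", OF drift _ ys(1)] unfolding size by simp
  have size0: "total_size ys \<ge> 0" using total_size_ge[of ys] by simp
  have "walk_weight w ys + d / 2 * walk_weight sign_change ys \<ge> d"
    using ys(1)
  proof (cases rule: walk_cases)
    case pos
    have "walk_weight w ys \<ge> d"
      using assms(8)[OF ys(1) pos] ys(2) total_expo_pos[OF pos] by simp
    then show ?thesis using changes d0 by (simp add: add_increasing2)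
  next
    case neg
    have "walk_weight w ys \<ge> d"
      using assms(9)[OF ys(1) neg] ys(2) total_expo_neg[OF neg] by simp
    then show ?thesis using changes d0 by (simp add: add_increasing2)
  next
    case (two us vs p ps n ns)
    have two_changes: "walk_weight sign_change ys = 2" by (rule sign_change_two_blocks[OF two])
    show ?thesis
    proof (cases "total_expo ys = 0")
      case True
      have "walk_weight w ys \<ge> 0"
        by (rule two_block_weight[where w = w and G = G, OF two base step close True])
      then show ?thesis using two_changes by simp
    next
      case False
      then have "int m \<le> \<bar>total_expo ys\<bar>" using dvd_imp_le_int[of "total_expo ys" "int m"] ys(2) by simp
      \<comment> \<open>A size of 60 gives a drift of 12, which makes up for the loss of 6 at each
        of the two sign changes.\<close>
      then have "60 \<le> total_size ys" using total_size_ge[of ys] m by linarith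
      then show ?thesis using low two_changes by simp
    qed
  next
    case many
    \<comment> \<open>Three changes suffice because 3 (d/2 - 6) is at least \<open>d\<close> as soon
      as \<open>d\<close> is at least 36.\<close>
    have "(d / 2 - 6) * walk_weight sign_change ys \<ge> (d / 2 - 6) * 3"
      using many d by (intro mult_left_mono) auto
    moreover have "1/5 * real_of_int (total_size ys) \<ge> 0" using size0 by simp
    ultimately show ?thesis using low d by (simp add: algebra_simps)
  qed
  then show "walk_weight (\<lambda>i j. (w i j + d / 2 * sign_change i j) / d) ys \<ge> 1"
    unfolding walk_weight_scaled[OF d0] using d0 by simp
qed

fun potential_A :: "letter_index \<Rightarrow> real" where
  "potential_A i = - real_of_int (expo_size i)"

fun potential_B :: "letter_index \<Rightarrow> real" where
  "potential_B I0 = 0" | "potential_B I1 = 0" | "potential_B I2 = 2" | "potential_B I3 = 4"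

lemma total_size_pos_imp_ge:
  assumes "ys \<noteq> []" "int m dvd total_size ys"
  shows "int m \<le> total_size ys"
proof -
  have "expo_size y > 0" for y by (cases y) auto
  moreover have "total_size zs \<ge> 0" for zs using total_size_ge[of zs] by simp
  ultimately have "total_size ys > 0" using assms(1) by (cases ys) (auto intro: add_pos_nonneg)
  then show ?thesis using assms(2) by (simp add: zdvd_imp_le)
qed

text \<open>A walk of one sign has size at least \<open>n\<close>, so its drift is at least n/5;
  this is where the factor 5 comes from.\<close>

lemma disc_weight_B:
  assumes "0 < \<eta>" "\<eta> \<le> 1/20" "d \<ge> 36" "5 * d \<le> real n"
  shows "disc_weight n (weight_B d \<eta>)"
proof -
  have drift: "small_B \<eta> i j \<ge> 1/5 * real_of_int (expo_size j) + potential_B j - potential_B i + (-6) * sign_change i j" for i j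
    using assms(1,2) by (cases i; cases j) (auto simp: sign_change_def)
  have same: "walk_weight (small_B \<eta>) ys \<ge> d"
    if "ys \<noteq> []" "set ys \<subseteq> D" "D = pos_letters \<or> D = neg_letters" "int n dvd total_size ys" for ys D
  proof -
    have "walk_weight (small_B \<eta>) ys \<ge> (\<Sum>y\<leftarrow>ys. 1/5 * real_of_int (expo_size y)) + 0 * walk_weight sign_change ys"
    proof (rule walk_weight_potential[where D = D and p = potential_B])
      fix i j assume "i \<in> D" "j \<in> D"
      then have "sign_change i j = 0" using that(3) by (auto simp: sign_change_def)
      then show "small_B \<eta> i j \<ge> 1/5 * real_of_int (expo_size j) + potential_B j - potential_B i + 0 * sign_change i j"
        using drift[of j i] by simp
    qed (use that in auto)
    moreover have "(\<Sum>y\<leftarrow>ys. 1/5 * real_of_int (expo_size y)) = 1/5 * real_of_int (total_size ys)"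
      by (induction ys) (auto simp: algebra_simps)
    ultimately show ?thesis
      using total_size_pos_imp_ge[OF that(1,4)] assms(4) by simp
  qed
  have "real n \<ge> 180" using assms by simp
  then have n: "n \<ge> 60" "d \<le> real n" using assms by simp_all
  show ?thesis
    unfolding weight_B_def
    by (rule disc_weightI[where p = potential_B and G = "block_B \<eta>", OF assms(3) n(2,1) drift
          block_B_base block_B_step[OF assms(1,2)] block_B_close[OF assms(1,2)] same same])
      (auto simp del: expo_size.simps)
qed

text \<open>Unlike in the second factor, discs of one sign must be priced exactly here. Negative
  ones weigh their size. Positive ones obtain a discount \<eta> per \<open>a^2\<close> and a
  surcharge 6 - \<eta> per passage from \<open>a^2\<close> to \<open>a\<close>; parity of
  \<open>m\<close> guarantees such a passage whenever there is a discount and the size is exactly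
  \<open>m\<close>.\<close>

lemma disc_weight_A:
  assumes \<eta>: "0 < \<eta>" "\<eta> \<le> 1/20" "\<eta> * (real m + 1) = 12" and m: "m \<ge> 60" "odd m"
  shows "disc_weight m (weight_A (real m) \<eta>)"
proof -
  have drift: "small_A \<eta> i j \<ge> 1/5 * real_of_int (expo_size j) + potential_A j - potential_A i + (-6) * sign_change i j" for i j
    using \<eta>(1,2) by (cases i; cases j) (auto simp: sign_change_def)
  have pos: "walk_weight (small_A \<eta>) ys \<ge> real m"
    if ys: "ys \<noteq> []" "set ys \<subseteq> pos_letters" "int m dvd total_size ys" for ys
  proof -
    let ?l = "real (count_list ys I2)"
    let ?c = "\<lambda>i j. if i = I2 \<and> j = I0 then 1 else 0 :: real"
    define v where "v j = real_of_int (expo_size j) - (if j = I2 then \<eta> else 0)" for j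
    have "walk_weight (small_A \<eta>) ys \<ge> (\<Sum>y\<leftarrow>ys. v y) + (6 - \<eta>) * walk_weight ?c ys"
    \<comment> \<open>With this potential the inequality is an equality on all four turns between
      positive letters.\<close>
    proof (rule walk_weight_potential[where D = pos_letters and p = "\<lambda>i. if i = I2 then \<eta> - 1/2 else 0"])
      fix i j assume "i \<in> pos_letters" "j \<in> pos_letters"
      then show "small_A \<eta> i j \<ge> v j + (if j = I2 then \<eta> - 1/2 else 0) - (if i = I2 then \<eta> - 1/2 else 0) +
          (6 - \<eta>) * (if i = I2 \<and> j = I0 then 1 else 0)"
        by (auto simp: v_def)
    qed (use ys in auto)
    moreover have "(\<Sum>y\<leftarrow>ys. v y) = real_of_int (total_size ys) - \<eta> * ?l"
      by (induction ys) (auto simp: v_def algebra_simps)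
    ultimately have low: "walk_weight (small_A \<eta>) ys \<ge>
        real_of_int (total_size ys) - \<eta> * ?l + (6 - \<eta>) * walk_weight ?c ys" by simp
    have c0: "walk_weight ?c ys \<ge> 0"
      unfolding walk_weight_def by (rule path_weight_nonneg) auto
    have l: "2 * int (count_list ys I2) \<le> total_size ys"
    proof (induction ys)
      case (Cons y ys)
      then show ?case by (cases y) auto
    qed simp
    obtain k where k: "total_size ys = int m * k" using ys(3) by blast
    have "int m \<le> int m * k" using total_size_pos_imp_ge[OF ys(1,3)] k by simp
    then have "k \<ge> 1" using m by simp
    show ?thesis
    proof (cases "k = 1")
      case False
      \<comment> \<open>A walk of size at least 2 m has weight to spare: the discount is at most
        1/40 of its size.\<close>
      then have "k \<ge> 2" using \<open>k \<ge> 1\<close> by simp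
      then have "int m * 2 \<le> total_size ys" using k by (simp add: mult_left_mono)
      then have "real_of_int (total_size ys) \<ge> 2 * real m" by linarith
      moreover have "\<eta> * ?l \<le> 1/20 * (real_of_int (total_size ys) / 2)"
        using \<eta> l by (intro mult_mono) linarith+
      moreover have "(6 - \<eta>) * walk_weight ?c ys \<ge> 0" using \<eta> c0 by simp
      ultimately show ?thesis using low by linarith
    next
      case True
      then have size: "total_size ys = int m" using k by simp
      have "I0 \<in> set ys"
      proof (rule ccontr)
        assume "I0 \<notin> set ys"
        then have "set ys \<subseteq> {I2}" using ys(2) by auto
        then have "even (total_size ys)" by (induction ys) auto
        then show False using size m by simp
      qed
      show ?thesis
      proof (cases "I2 \<in> set ys")
        case False
        then have "count_list ys I2 = 0" by (simp add: count_list_0_iff)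
        moreover have "(6 - \<eta>) * walk_weight ?c ys \<ge> 0" using \<eta> c0 by simp
        ultimately show ?thesis using low size by simp
      next
        case True
        obtain us vs where uv: "ys = us @ vs" "vs @ us \<noteq> []" "hd (vs @ us) = I0" "last (vs @ us) \<noteq> I0"
          by (rule rotate_to_boundary[of I0 ys "\<lambda>i. i = I0" I2]) (use True \<open>I0 \<in> set ys\<close> in auto)
        have "last (vs @ us) \<in> set ys" using last_in_set[OF uv(2)] uv(1) by auto
        then have last: "last (vs @ us) = I2" using uv(4) ys(2) by auto
        have "path_weight ?c I2 (vs @ us) \<ge> 1"
        proof (cases "vs @ us")
          case (Cons z zs)
          have "path_weight ?c I0 zs \<ge> 0" by (rule path_weight_nonneg) auto
          then show ?thesis using uv(3) Cons by simp
        qed (use uv in simp)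
        then have "walk_weight ?c ys \<ge> 1"
          using walk_weight_rotate[of ?c us vs] uv(1) last by (simp add: walk_weight_def)
        then have "(6 - \<eta>) * walk_weight ?c ys \<ge> (6 - \<eta>) * 1"
          using \<eta> by (intro mult_left_mono) auto
        \<comment> \<open>As \<open>m\<close> is odd, there are at most (m - 1)/2 letters
          \<open>a^2\<close>. Equality for that number is the equation that defines \<eta>.\<close>
        moreover have "\<eta> * ?l \<le> 6 - \<eta>"
        proof -
          have "2 * int (count_list ys I2) \<noteq> int m" using m(2) by presburger
          then have "2 * ?l + 1 \<le> real m" using l size by linarith
          then have "\<eta> * (2 * ?l + 2) \<le> \<eta> * (real m + 1)" using \<eta> by (intro mult_left_mono) auto
          then show ?thesis using \<eta>(3) by (simp add: algebra_simps)
        qed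
        ultimately show ?thesis using low size by simp
      qed
    qed
  qed
  have neg: "walk_weight (small_A \<eta>) ys \<ge> real m"
    if ys: "ys \<noteq> []" "set ys \<subseteq> neg_letters" "int m dvd total_size ys" for ys
  proof -
    \<comment> \<open>Between negative letters the weight of a turn is the size of its first letter;
      the potential moves this to its second letter.\<close>
    have "walk_weight (small_A \<eta>) ys \<ge> (\<Sum>y\<leftarrow>ys. real_of_int (expo_size y)) + 0 * walk_weight sign_change ys"
      by (rule walk_weight_potential[where D = neg_letters and p = potential_A]) (use ys in auto)
    moreover have "(\<Sum>y\<leftarrow>ys. real_of_int (expo_size y)) = real_of_int (total_size ys)"
      by (induction ys) auto
    ultimately show ?thesis using total_size_pos_imp_ge[OF ys(1,3)] by simp
  qed
  have "real m \<ge> 36" using m by simp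
  then show ?thesis
    unfolding weight_A_def
    by (intro disc_weightI[where p = potential_A and G = "block_A \<eta>", OF _ order_refl m(1) drift
          block_A_base block_A_step[OF \<eta>(1,2)] block_A_close[OF \<eta>(1,2)] pos neg])
qed

section \<open>Powers of the word\<close>

lemma cycle_of_list_nth:
  assumes "distinct xs" "i < length xs"
  shows "cycle_of_list xs (xs ! i) = xs ! (Suc i mod length xs)"
proof -
  have "map (cycle_of_list xs ^^ 1) xs ! i = rotate 1 xs ! i" using cyclic_rotation[OF assms(1), of 1] by simp
  then show ?thesis using assms(2) nth_rotate[OF assms(2), of 1] by (simp add: add.commute)
qed

lemma nth_concat_replicate:
  "i < n * length ws \<Longrightarrow> concat (replicate n ws) ! i = ws ! (i mod length ws)"
proof (induction n arbitrary: i)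
  case (Suc n)
  show ?case
  proof (cases "i < length ws")
    case False
    then have "concat (replicate (Suc n) ws) ! i = concat (replicate n ws) ! (i - length ws)"
      by (simp add: nth_append)
    also have "\<dots> = ws ! ((i - length ws) mod length ws)" using Suc False by auto
    also have "(i - length ws) mod length ws = i mod length ws" using False by (simp add: le_mod_geq)
    finally show ?thesis .
  qed (simp add: nth_append)
qed simp

lemma length_concat_replicate: "length (concat (replicate n ws)) = n * length ws"
  by (induction n) auto

lemma sum_periodic:
  fixes f :: "nat \<Rightarrow> real"
  assumes "k > 0"
  shows "(\<Sum>i<n * k. f (i mod k)) = real n * (\<Sum>i<k. f i)"
proof (induction n)
  case (Suc n)
  have "(\<Sum>i<Suc n * k. f (i mod k)) = (\<Sum>i<n * k. f (i mod k)) + (\<Sum>i=n * k..<n * k + k. f (i mod k))"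
    by (simp add: lessThan_atLeast0 sum.atLeastLessThan_concat add.commute)
  also have "(\<Sum>i=n * k..<n * k + k. f (i mod k)) = (\<Sum>i<k. f i)"
  proof -
    have "(\<Sum>i=0 + n * k..<k + n * k. f (i mod k)) = (\<Sum>i=0..<k. f ((i + n * k) mod k))"
      by (rule sum.shift_bounds_nat_ivl)
    then show ?thesis by (simp add: lessThan_atLeast0 add.commute)
  qed
  finally show ?case using Suc by (simp add: algebra_simps)
qed simp

definition slot_index :: "nat \<Rightarrow> letter_index" where
  "slot_index k = (if k div 2 = 0 then I0 else if k div 2 = 1 then I1 else if k div 2 = 2 then I2 else I3)"

definition slot_letter :: "nat \<Rightarrow> nat \<Rightarrow> int \<Rightarrow> int \<Rightarrow> nat \<Rightarrow> int + int" where
  "slot_letter m n g h k = (if even k then Inl ((g * expo (slot_index k)) mod int m)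
    else Inr ((h * expo (slot_index k)) mod int n))"

definition word_letters :: "nat \<Rightarrow> nat \<Rightarrow> int \<Rightarrow> int \<Rightarrow> (int + int) list" where
  "word_letters m n g h = map (slot_letter m n g h) [0..<8]"

text \<open>One copy of the word has eight letters and accounts for at most four base-point discs;
  this is the term -4.\<close>

lemma surface_bound:
  assumes span: "spans_surface m n (concat (replicate N (word_letters m n g h))) e"
    and mn: "m > 0" "n > 0" and coprime: "coprime g (int m)" "coprime h (int n)"
    and w: "disc_weight m wA" "disc_weight n wB"
    and lam: "\<And>i j. wA i (next_index j) + wB j i = lam i"
  shows "real_of_int e \<le> real N * (lam I0 + lam I1 + lam I2 + lam I3 - 4)"
proof -
  let ?w = "word_letters m n g h"
  obtain xs lab \<tau> where xs: "distinct xs" "map lab xs = concat (replicate N ?w)" "\<tau> permutes set xs"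
    "\<forall>x\<in>set xs. isl (lab (\<tau> x)) = isl (lab x)" "e \<le> euler_bound m n lab \<tau> xs"
    using span by (auto simp: spans_surface_def)
  have len: "length xs = N * 8"
    using arg_cong[OF xs(2), of length] by (simp add: length_concat_replicate word_letters_def)
  have lab_nth: "lab (xs ! i) = slot_letter m n g h (i mod 8)" if "i < length xs" for i
  proof -
    have "lab (xs ! i) = concat (replicate N ?w) ! i" using that xs(2) by (metis nth_map)
    also have "\<dots> = ?w ! (i mod 8)"
      using nth_concat_replicate[of i N ?w] that len by (simp add: word_letters_def)
    finally show ?thesis by (simp add: word_letters_def)
  qed
  define pos where "pos x = (THE i. i < length xs \<and> xs ! i = x)" for x
  have pos: "pos (xs ! i) = i" if "i < length xs" for i
    unfolding pos_def by (rule the_equality) (use that nth_eq_iff_index_eq[OF xs(1)] in auto)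
  define ix where "ix x = slot_index (pos x mod 8)" for x
  have ix_nth: "ix (xs ! i) = slot_index (i mod 8)" if "i < length xs" for i
    using pos[OF that] by (simp add: ix_def)
  have isl_nth: "isl (lab (xs ! i)) \<longleftrightarrow> even i" if "i < length xs" for i
    using lab_nth[OF that] by (simp add: slot_letter_def dvd_mod_iff)
  have succ: "Suc i mod length xs < length xs" "Suc i mod length xs mod 8 = Suc i mod 8" if "i < length xs" for i
    using that len by (auto simp: mod_mod_cancel)
  interpret alternating_word "set xs" "cycle_of_list xs" lab ix m n g h
  proof
    show "cycle_of_list xs permutes set xs" by (rule cycle_permutes)
    fix x assume "x \<in> set xs"
    then obtain i where i: "i < length xs" "x = xs ! i" by (metis in_set_conv_nth)
    have \<sigma>x: "cycle_of_list xs x = xs ! (Suc i mod length xs)"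
      using cycle_of_list_nth[OF xs(1) i(1)] i(2) by simp
    have "even (Suc i mod length xs) \<longleftrightarrow> even (Suc i)" using len by (simp add: dvd_mod_iff)
    then show "isl (lab (cycle_of_list xs x)) \<longleftrightarrow> \<not> isl (lab x)"
      unfolding \<sigma>x using i isl_nth[OF i(1)] isl_nth[OF succ(1)[OF i(1)]] by simp
    have slots: "slot_index (Suc k mod 8) = (if even k then slot_index k else next_index (slot_index k))" if "k < 8" for k
    proof -
      have "k \<in> {0, 1, 2, 3, 4, 5, 6, 7}" using that by auto
      then show ?thesis by (auto simp: slot_index_def)
    qed
    have parity: "even (i mod 8) \<longleftrightarrow> even i" by (simp add: dvd_mod_iff)
    have mod_diff: "k dvd z mod k - z" for k z :: int by (simp add: mod_eq_dvd_iff[symmetric])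
    show "ix (cycle_of_list xs x) = (if isl (lab x) then ix x else next_index (ix x))"
      unfolding \<sigma>x using i isl_nth[OF i(1)] ix_nth[OF i(1)] ix_nth[OF succ(1)[OF i(1)]]
        succ(2)[OF i(1)] slots[of "i mod 8"] parity by (simp add: mod_Suc_eq)
    show "isl (lab x) \<Longrightarrow> int m dvd lval_A (lab x) - g * expo (ix x)"
      using i isl_nth[OF i(1)] lab_nth[OF i(1)] ix_nth[OF i(1)] parity mod_diff
      by (simp add: slot_letter_def lval_A_def)
    show "\<not> isl (lab x) \<Longrightarrow> int n dvd lval_B (lab x) - h * expo (ix x)"
      using i isl_nth[OF i(1)] lab_nth[OF i(1)] ix_nth[OF i(1)] parity mod_diff
      by (simp add: slot_letter_def lval_B_def)
  qed (use mn coprime in auto)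
  have "type_preserving \<tau>" using xs(3,4) by (simp add: type_preserving_def)
  note bound = orbit_count_bound[OF this w lam]
  have "(\<Sum>x | x \<in> set xs \<and> isl (lab x). lam (ix x)) = (\<Sum>x\<in>set xs. if isl (lab x) then lam (ix x) else 0)"
    by (simp add: sum.inter_filter)
  also have "\<dots> = (\<Sum>i<length xs. if isl (lab (xs ! i)) then lam (ix (xs ! i)) else 0)"
    by (rule sum.reindex_bij_betw[symmetric]) (rule bij_betw_nth[OF xs(1)]; simp)
  also have "\<dots> = (\<Sum>i<N * 8. if even (i mod 8) then lam (slot_index (i mod 8)) else 0)"
    unfolding len
  proof (rule sum.cong)
    fix i assume "i \<in> {..<N * 8}"
    then have i: "i < length xs" using len by simp
    show "(if isl (lab (xs ! i)) then lam (ix (xs ! i)) else 0) =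
        (if even (i mod 8) then lam (slot_index (i mod 8)) else 0)"
      unfolding isl_nth[OF i] ix_nth[OF i] by (simp add: dvd_mod_iff)
  qed simp
  also have "\<dots> = real N * (\<Sum>i<8. if even i then lam (slot_index i) else 0)"
    by (rule sum_periodic) simp
  also have "(\<Sum>i<8. if even i then lam (slot_index i) else 0) = lam I0 + lam I1 + lam I2 + lam I3"
    proof -
    have "{..<8::nat} = {0, 1, 2, 3, 4, 5, 6, 7}" by auto
    then show ?thesis by (simp add: slot_index_def)
  qed
  finally have sum: "(\<Sum>x | x \<in> set xs \<and> isl (lab x). lam (ix x)) = real N * (lam I0 + lam I1 + lam I2 + lam I3)" .
  have "card (set xs) = N * 8" using xs(1) len by (simp add: distinct_card)
  with bound sum have "real_of_int (euler_bound m n lab \<tau> xs) \<le> real N * (lam I0 + lam I1 + lam I2 + lam I3 - 4)"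
    by (simp add: euler_bound_def len algebra_simps)
  moreover have "real_of_int e \<le> real_of_int (euler_bound m n lab \<tau> xs)" using xs(5) by linarith
  ultimately show ?thesis by linarith
qed

section \<open>The image of the word in the free product of cyclic groups\<close>

lemma generator_coprime:
  assumes "m > 0" "x \<in> carrier (integer_mod_group m)"
    "generate (integer_mod_group m) {x} = carrier (integer_mod_group m)"
  shows "coprime x (int m)"
proof -
  interpret group "integer_mod_group m" by simp
  have "1 mod int m \<in> carrier (integer_mod_group m)"
    using assms(1) by (simp add: carrier_integer_mod_group)
  then have "1 mod int m \<in> generate (integer_mod_group m) {x}" using assms(3) by simp
  then obtain k :: int where "1 mod int m = x [^]\<^bsub>integer_mod_group m\<^esub> k"
    using generate_pow[OF assms(2)] by auto
  then have "1 mod int m = (k * x) mod int m" by (simp add: int_pow_integer_mod_group)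
  then have "int m dvd 1 - k * x" by (simp add: mod_eq_dvd_iff)
  then obtain l where l: "1 = k * x + int m * l" by (auto simp: dvd_def algebra_simps)
  show ?thesis
  proof (rule coprimeI)
    fix d assume "d dvd x" "d dvd int m"
    then have "d dvd k * x + int m * l" by (intro dvd_add dvd_mult2 dvd_mult) auto
    then show "is_unit d" using l by simp
  qed
qed

lemma word_letters_lists:
  assumes "m > 0" "n > 0"
  shows "word_letters m n g h \<in> lists (prod_letters m n)"
  using assms by (auto simp: word_letters_def slot_letter_def carrier_integer_mod_group in_lists_conv_set)

lemma prod_class_foldr:
  assumes "ls \<in> lists (prod_letters m n)"
  shows "prod_class m n ls =
    foldr (\<otimes>\<^bsub>cyclic_prod m n\<^esub>) (map (\<lambda>l. prod_class m n [l]) ls) \<one>\<^bsub>cyclic_prod m n\<^esub>"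
  using assms
proof (induction ls)
  case (Cons l ls)
  then show ?case using prod_class_append[of "[l]" m n ls] by simp
qed (simp add: prod_class_Nil)

lemma natural_hom_word_letters:
  assumes "natural_hom m n \<phi>" "m > 0" "n > 0"
  obtains g h where "coprime g (int m)" "coprime h (int n)"
    "prod_class m n (word_letters m n g h) = \<phi> word_c"
proof -
  let ?G = "integer_mod_group m" and ?H = "integer_mod_group n" and ?P = "cyclic_prod m n"
  obtain x y where xy: "x \<in> carrier ?G" "y \<in> carrier ?H" "generate ?G {x} = carrier ?G"
    "generate ?H {y} = carrier ?H" "\<phi> gen_a = free_prod_inl ?G ?H x" "\<phi> gen_b = free_prod_inr ?G ?H y"
    using assms(1) by (auto simp: natural_hom_def)
  interpret F: group F2 by (rule group_free_group)
  interpret P: group ?P by (simp add: group_free_prod)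
  interpret group_hom F2 ?P \<phi> using assms(1) by unfold_locales (simp add: natural_hom_def)
  interpret L: group_hom ?G ?P "free_prod_inl ?G ?H"
    using free_prod_inl_hom[OF group_integer_mod_group]
    by (intro group_hom.intro group_integer_mod_group P.is_group) (simp add: group_hom_axioms_def)
  interpret R: group_hom ?H ?P "free_prod_inr ?G ?H"
    using free_prod_inr_hom[OF group_integer_mod_group]
    by (intro group_hom.intro group_integer_mod_group P.is_group) (simp add: group_hom_axioms_def)
  have c: "gen_a \<in> carrier F2" "gen_b \<in> carrier F2" by (simp_all add: free_gen_carrier)
  define l where "l k = prod_class m n [Inl ((x * k) mod int m)]" for k
  define r where "r k = prod_class m n [Inr ((y * k) mod int n)]" for k
  have lr: "l k \<in> carrier ?P" "r k \<in> carrier ?P" for k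
  proof -
    have "[Inl ((x * k) mod int m)] \<in> lists (prod_letters m n)" "[Inr ((y * k) mod int n)] \<in> lists (prod_letters m n)"
      using assms by (auto simp: carrier_integer_mod_group)
    then show "l k \<in> carrier ?P" "r k \<in> carrier ?P"
      unfolding l_def r_def using prod_class_carrier by blast+
  qed
  have l_pow: "\<phi> gen_a [^]\<^bsub>?P\<^esub> (k::int) = l k" for k
    unfolding xy(5) L.hom_int_pow[OF xy(1), symmetric]
    by (simp add: l_def free_prod_inl_def int_pow_integer_mod_group mult.commute)
  have r_pow: "\<phi> gen_b [^]\<^bsub>?P\<^esub> (k::int) = r k" for k
    unfolding xy(6) R.hom_int_pow[OF xy(2), symmetric]
    by (simp add: r_def free_prod_inr_def int_pow_integer_mod_group mult.commute)
  have "\<phi> word_c = \<phi> gen_a [^]\<^bsub>?P\<^esub> (1::int) \<otimes>\<^bsub>?P\<^esub> \<phi> gen_b [^]\<^bsub>?P\<^esub> (1::int) \<otimes>\<^bsub>?P\<^esub> \<phi> gen_a [^]\<^bsub>?P\<^esub> (-2::int)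
      \<otimes>\<^bsub>?P\<^esub> \<phi> gen_b [^]\<^bsub>?P\<^esub> (-2::int) \<otimes>\<^bsub>?P\<^esub> \<phi> gen_a [^]\<^bsub>?P\<^esub> (2::int) \<otimes>\<^bsub>?P\<^esub> \<phi> gen_b [^]\<^bsub>?P\<^esub> (2::int)
      \<otimes>\<^bsub>?P\<^esub> \<phi> gen_a [^]\<^bsub>?P\<^esub> (-1::int) \<otimes>\<^bsub>?P\<^esub> \<phi> gen_b [^]\<^bsub>?P\<^esub> (-1::int)"
    unfolding word_c_def using c
    by (simp only: hom_mult hom_int_pow F.m_closed F.int_pow_closed P.int_pow_1 hom_closed)
  also have "\<dots> = foldr (\<otimes>\<^bsub>?P\<^esub>) [l 1, r 1, l (-2), r (-2), l 2, r 2, l (-1), r (-1)] \<one>\<^bsub>?P\<^esub>"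
    unfolding l_pow r_pow using lr by (simp add: P.m_assoc)
  also have "[l 1, r 1, l (-2), r (-2), l 2, r 2, l (-1), r (-1)] =
      map (\<lambda>l. prod_class m n [l]) (word_letters m n x y)"
    by (simp add: word_letters_def slot_letter_def slot_index_def upt_rec l_def r_def)
  also have "foldr (\<otimes>\<^bsub>?P\<^esub>) \<dots> \<one>\<^bsub>?P\<^esub> = prod_class m n (word_letters m n x y)"
    by (rule prod_class_foldr[OF word_letters_lists[OF assms(2,3)], symmetric])
  finally show ?thesis
    using that generator_coprime[OF assms(2) xy(1,3)] generator_coprime[OF assms(3) xy(2,4)] by metis
qed

section \<open>Asymptotic cost of cancelling a factor\<close>

context group
begin

text \<open>The budget is real, so that asymptotic rates times lengths can be used without
  rounding.\<close>

definition comm_prod :: "real \<Rightarrow> 'a \<Rightarrow> bool" where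
  "comm_prod r g \<longleftrightarrow> (\<exists>xs. real (length xs) \<le> r \<and> set xs \<subseteq> derived_set G (carrier G) \<and> foldr (\<otimes>) xs \<one> = g)"

definition comm_near :: "real \<Rightarrow> 'a \<Rightarrow> 'a \<Rightarrow> bool" where
  "comm_near r g h \<longleftrightarrow> h \<in> carrier G \<and> (\<exists>u. comm_prod r u \<and> g = u \<otimes> h)"

lemma inv_cancel_left: "x \<in> carrier G \<Longrightarrow> y \<in> carrier G \<Longrightarrow> inv x \<otimes> (x \<otimes> y) = y"
  "x \<in> carrier G \<Longrightarrow> y \<in> carrier G \<Longrightarrow> x \<otimes> (inv x \<otimes> y) = y"
  by (simp_all add: m_assoc[symmetric])

lemmas word_simps = m_assoc inv_mult_group inv_cancel_left

lemma derived_set_carrier: "derived_set G (carrier G) \<subseteq> carrier G"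
  by auto

lemma derived_setI: "x \<in> carrier G \<Longrightarrow> y \<in> carrier G \<Longrightarrow> x \<otimes> y \<otimes> inv x \<otimes> inv y \<in> derived_set G (carrier G)"
  by blast

lemma foldr_mult_closed: "set xs \<subseteq> carrier G \<Longrightarrow> foldr (\<otimes>) xs \<one> \<in> carrier G"
  by (induction xs) auto

lemma foldr_mult_append:
  "set xs \<subseteq> carrier G \<Longrightarrow> set ys \<subseteq> carrier G \<Longrightarrow>
    foldr (\<otimes>) (xs @ ys) \<one> = foldr (\<otimes>) xs \<one> \<otimes> foldr (\<otimes>) ys \<one>"
  by (induction xs) (auto simp: m_assoc foldr_mult_closed)

lemma comm_prod_closed: "comm_prod r g \<Longrightarrow> g \<in> carrier G"
  unfolding comm_prod_def using foldr_mult_closed derived_set_carrier by blast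

lemma comm_prod_one: "0 \<le> r \<Longrightarrow> comm_prod r \<one>"
  unfolding comm_prod_def by (intro exI[of _ "[]"]) auto

lemma comm_prod_commutator:
  "x \<in> carrier G \<Longrightarrow> y \<in> carrier G \<Longrightarrow> comm_prod 1 (x \<otimes> y \<otimes> inv x \<otimes> inv y)"
  unfolding comm_prod_def
  by (intro exI[of _ "[x \<otimes> y \<otimes> inv x \<otimes> inv y]"] conjI) (auto intro!: derived_setI simp del: UN_iff)

lemma comm_prod_mult:
  assumes "comm_prod r g" "comm_prod s h"
  shows "comm_prod (r + s) (g \<otimes> h)"
proof -
  obtain xs where xs: "real (length xs) \<le> r" "set xs \<subseteq> derived_set G (carrier G)" "foldr (\<otimes>) xs \<one> = g"
    using assms(1) unfolding comm_prod_def by blast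
  obtain ys where ys: "real (length ys) \<le> s" "set ys \<subseteq> derived_set G (carrier G)" "foldr (\<otimes>) ys \<one> = h"
    using assms(2) unfolding comm_prod_def by blast
  have "foldr (\<otimes>) (xs @ ys) \<one> = g \<otimes> h"
    using foldr_mult_append[of xs ys] xs ys derived_set_carrier by blast
  then show ?thesis
    unfolding comm_prod_def using xs ys by (intro exI[of _ "xs @ ys"]) auto
qed

lemma comm_prod_mono: "comm_prod r g \<Longrightarrow> r \<le> s \<Longrightarrow> comm_prod s g"
  unfolding comm_prod_def by (elim exE conjE) (rule exI, intro conjI; assumption?; simp)

lemma comm_prod_conj:
  assumes "comm_prod r g" "t \<in> carrier G"
  shows "comm_prod r (t \<otimes> g \<otimes> inv t)"
proof -
  obtain xs where xs: "real (length xs) \<le> r" "set xs \<subseteq> derived_set G (carrier G)" "foldr (\<otimes>) xs \<one> = g"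
    using assms(1) unfolding comm_prod_def by blast
  let ?c = "\<lambda>x. t \<otimes> x \<otimes> inv t"
  have c: "?c z \<in> derived_set G (carrier G)" if z: "z \<in> derived_set G (carrier G)" for z
  proof -
    obtain x y where xy: "x \<in> carrier G" "y \<in> carrier G" "z = x \<otimes> y \<otimes> inv x \<otimes> inv y" using z by auto
    have "?c z = ?c x \<otimes> ?c y \<otimes> inv (?c x) \<otimes> inv (?c y)" using xy assms(2) by (simp add: word_simps)
    then show ?thesis using xy assms(2) derived_setI[of "?c x" "?c y"] by simp
  qed
  have "foldr (\<otimes>) (map ?c xs) \<one> = ?c (foldr (\<otimes>) xs \<one>)" if "set xs \<subseteq> carrier G" for xs
    using that assms(2) by (induction xs) (auto simp: word_simps foldr_mult_closed)
  then have "foldr (\<otimes>) (map ?c xs) \<one> = ?c g" using xs derived_set_carrier by blast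
  moreover have "set (map ?c xs) \<subseteq> derived_set G (carrier G)"
    unfolding set_map by (rule image_subsetI, rule c, rule subsetD[OF xs(2)])
  ultimately show ?thesis
    unfolding comm_prod_def using xs(1) by (intro exI[of _ "map ?c xs"]) simp
qed

lemma comm_near_refl: "g \<in> carrier G \<Longrightarrow> 0 \<le> r \<Longrightarrow> comm_near r g g"
  unfolding comm_near_def using comm_prod_one[of r] by force

lemma comm_near_trans:
  assumes "comm_near r g h" "comm_near s h k"
  shows "comm_near (r + s) g k"
proof -
  obtain u where u: "comm_prod r u" "g = u \<otimes> h" using assms(1) unfolding comm_near_def by blast
  obtain v where v: "comm_prod s v" "h = v \<otimes> k" "k \<in> carrier G" using assms(2) unfolding comm_near_def by blast
  have "g = u \<otimes> v \<otimes> k" using u v comm_prod_closed by (simp add: m_assoc)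
  then show ?thesis unfolding comm_near_def using comm_prod_mult[OF u(1) v(1)] v(3) by blast
qed

lemma comm_near_mono: "comm_near r g h \<Longrightarrow> r \<le> s \<Longrightarrow> comm_near s g h"
  unfolding comm_near_def using comm_prod_mono by blast

text \<open>The second correction is conjugated across \<open>g'\<close>; a conjugate of a product
  of commutators is a product of equally many.\<close>

lemma comm_near_mult:
  assumes "comm_near r g g'" "comm_near s h h'"
  shows "comm_near (r + s) (g \<otimes> h) (g' \<otimes> h')"
proof -
  obtain u where u: "comm_prod r u" "g = u \<otimes> g'" "g' \<in> carrier G" using assms(1) unfolding comm_near_def by blast
  obtain v where v: "comm_prod s v" "h = v \<otimes> h'" "h' \<in> carrier G" using assms(2) unfolding comm_near_def by blast
  have "g \<otimes> h = (u \<otimes> (g' \<otimes> v \<otimes> inv g')) \<otimes> (g' \<otimes> h')"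
    using u v comm_prod_closed by (simp add: word_simps)
  then show ?thesis
    unfolding comm_near_def using comm_prod_mult[OF u(1) comm_prod_conj[OF v(1) u(3)]] u(3) v(3) by blast
qed

lemma comm_near_conj:
  assumes "g \<in> carrier G" "t \<in> carrier G"
  shows "comm_near 1 (t \<otimes> g \<otimes> inv t) g"
proof -
  have "t \<otimes> g \<otimes> inv t = (t \<otimes> g \<otimes> inv t \<otimes> inv g) \<otimes> g" using assms by (simp add: word_simps)
  then show ?thesis unfolding comm_near_def using comm_prod_commutator[OF assms(2,1)] assms(1) by blast
qed

lemma comm_near_conj_both:
  assumes "comm_near r g h" "t \<in> carrier G"
  shows "comm_near r (t \<otimes> g \<otimes> inv t) (t \<otimes> h \<otimes> inv t)"
proof -
  obtain u where u: "comm_prod r u" "g = u \<otimes> h" "h \<in> carrier G" using assms(1) unfolding comm_near_def by blast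
  have "t \<otimes> g \<otimes> inv t = (t \<otimes> u \<otimes> inv t) \<otimes> (t \<otimes> h \<otimes> inv t)"
    using u assms(2) comm_prod_closed by (simp add: word_simps)
  then show ?thesis unfolding comm_near_def using comm_prod_conj[OF u(1) assms(2)] u(3) assms(2) by blast
qed

lemma conj_pow:
  assumes "g \<in> carrier G" "t \<in> carrier G"
  shows "(t \<otimes> g \<otimes> inv t) [^] (n::nat) = t \<otimes> g [^] n \<otimes> inv t"
  using assms by (induction n) (simp_all add: word_simps)

text \<open>Two further factors \<open>x y\<close> cost one commutator, because
  \<open>y x y x\<^sup>n = x\<^sup>n\<^sup>+\<^sup>1 y\<^sup>2 [y\<^sup>-\<^sup>2 x\<^sup>-\<^sup>1, x\<^sup>-\<^sup>n y]\<close>.\<close>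

lemma comm_near_mult_pow:
  assumes x: "x \<in> carrier G" and y: "y \<in> carrier G"
  shows "comm_near (real (n div 2)) ((x \<otimes> y) [^] n) (x [^] n \<otimes> y [^] n)"
proof (induction n rule: induct_nat_012)
  case 0
  then show ?case using comm_near_refl[of \<one> 0] by simp
next
  case 1
  then show ?case using comm_near_refl[of "x \<otimes> y" 0] x y by simp
next
  case (ge2 n)
  define B where "B = x [^] n"
  have B: "B \<in> carrier G" "x \<otimes> B = B \<otimes> x" using x unfolding B_def by (simp, metis nat_pow_Suc nat_pow_Suc2)
  define u where "u = inv y \<otimes> inv y \<otimes> inv x"
  define v where "v = inv B \<otimes> y"
  have uv: "u \<in> carrier G" "v \<in> carrier G" using x y B(1) by (simp_all add: u_def v_def)
  define k where "k = x \<otimes> B \<otimes> x \<otimes> y \<otimes> y"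
  have k: "k \<in> carrier G" using x y B(1) by (simp add: k_def)
  have pow2: "z [^] Suc (Suc n) = z \<otimes> (z \<otimes> z [^] n)" if "z \<in> carrier G" for z
    using that nat_pow_Suc2 by metis
  have "(x \<otimes> y) [^] Suc (Suc n) = (x \<otimes> y \<otimes> x \<otimes> y) \<otimes> (x \<otimes> y) [^] n"
    unfolding pow2[OF m_closed[OF x y]] using x y by (simp add: m_assoc)
  moreover have "x \<otimes> y \<otimes> x \<otimes> y \<in> carrier G" using x y by simp
  ultimately have 1: "comm_near (0 + real (n div 2)) ((x \<otimes> y) [^] Suc (Suc n)) ((x \<otimes> y \<otimes> x \<otimes> y) \<otimes> (B \<otimes> y [^] n))"
    using comm_near_mult[OF comm_near_refl[OF _ order_refl] ge2(1)] by (simp only: B_def)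
  have "y \<otimes> x \<otimes> y \<otimes> B = B \<otimes> x \<otimes> y \<otimes> y \<otimes> (u \<otimes> v \<otimes> inv u \<otimes> inv v)"
    using x y B(1) by (simp add: u_def v_def word_simps)
  then have "(x \<otimes> y \<otimes> x \<otimes> y) \<otimes> (B \<otimes> y [^] n) = (k \<otimes> (u \<otimes> v \<otimes> inv u \<otimes> inv v) \<otimes> inv k) \<otimes> (k \<otimes> y [^] n)"
  proof -
    assume eq: "y \<otimes> x \<otimes> y \<otimes> B = B \<otimes> x \<otimes> y \<otimes> y \<otimes> (u \<otimes> v \<otimes> inv u \<otimes> inv v)"
    have "(x \<otimes> y \<otimes> x \<otimes> y) \<otimes> (B \<otimes> y [^] n) = x \<otimes> (y \<otimes> x \<otimes> y \<otimes> B) \<otimes> y [^] n"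
      using x y B(1) by (simp add: m_assoc)
    also have "\<dots> = k \<otimes> (u \<otimes> v \<otimes> inv u \<otimes> inv v) \<otimes> y [^] n"
      unfolding eq using x y B(1) uv by (simp add: k_def m_assoc)
    also have "\<dots> = (k \<otimes> (u \<otimes> v \<otimes> inv u \<otimes> inv v) \<otimes> inv k) \<otimes> (k \<otimes> y [^] n)"
      using k uv y by (simp add: word_simps)
    finally show ?thesis .
  qed
  moreover have "k \<otimes> y [^] n = x [^] Suc (Suc n) \<otimes> y [^] Suc (Suc n)"
  proof -
    have "k \<otimes> y [^] n = (x \<otimes> B \<otimes> x) \<otimes> (y \<otimes> (y \<otimes> y [^] n))"
      using x y B(1) by (simp add: k_def m_assoc)
    also have "x \<otimes> B \<otimes> x = x [^] Suc (Suc n)" unfolding B(2) using x by (simp add: B_def)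
    finally show ?thesis unfolding pow2[OF y] .
  qed
  ultimately have "comm_near 1 ((x \<otimes> y \<otimes> x \<otimes> y) \<otimes> (B \<otimes> y [^] n)) (x [^] Suc (Suc n) \<otimes> y [^] Suc (Suc n))"
    unfolding comm_near_def using comm_prod_conj[OF comm_prod_commutator[OF uv] k] x y by force
  from comm_near_trans[OF 1 this] show ?case by (rule comm_near_mono) simp
qed

text \<open>If \<open>t\<^sup>p = 1\<close>, then \<open>(t y)\<^sup>p\<close> is a product of \<open>p\<close> conjugates of \<open>y\<close>.\<close>

lemma comm_near_torsion_mult_pow:
  assumes t: "t \<in> carrier G" "t [^] p = \<one>" and y: "y \<in> carrier G" and p: "p > 0"
  shows "comm_near ((real p - 1) * real m / 2 + real p) ((t \<otimes> y) [^] (p * m)) (y [^] (p * m))"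
proof -
  \<comment> \<open>\<open>Q k\<close> is the product of the conjugates of \<open>y\<close> by t,
    t^2, ..., t^k, and \<open>Q p\<close> is (t y)^p because t^p = 1.\<close>
  define Q where "Q k = (t \<otimes> y) [^] k \<otimes> inv (t [^] k)" for k :: nat
  have Q: "Q k \<in> carrier G" for k using t y by (simp add: Q_def)
  have QS: "Q (Suc k) = Q k \<otimes> (t [^] Suc k \<otimes> y \<otimes> inv (t [^] Suc k))" for k
    using t y by (simp add: Q_def word_simps)
  have "comm_near (real k * real m / 2 + real (Suc k)) (Q (Suc k) [^] m) (y [^] (Suc k * m))" for k
  proof (induction k)
    case 0
    have "Q (Suc 0) = t \<otimes> y \<otimes> inv t" using t y by (simp add: Q_def)
    then show ?case using comm_near_conj[of "y [^] m" t] t y by (simp add: conj_pow)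
  next
    case (Suc k)
    let ?y = "t [^] Suc (Suc k) \<otimes> y \<otimes> inv (t [^] Suc (Suc k))"
    \<comment> \<open>Splitting off one conjugate costs m/2 commutators and undoing its conjugation
      one more. For \<open>p\<close> conjugates there are only \<open>p - 1\<close> splittings,
      whence the rate.\<close>
    have "comm_near (real (m div 2)) (Q (Suc (Suc k)) [^] m) (Q (Suc k) [^] m \<otimes> ?y [^] m)"
      unfolding QS[of "Suc k"] using t y Q by (intro comm_near_mult_pow) auto
    moreover have "comm_near 1 (?y [^] m) (y [^] m)"
      using comm_near_conj[of "y [^] m" "t [^] Suc (Suc k)"] t y by (simp add: conj_pow del: nat_pow_Suc)
    then have "comm_near (real k * real m / 2 + real (Suc k) + 1) (Q (Suc k) [^] m \<otimes> ?y [^] m)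
        (y [^] (Suc k * m) \<otimes> y [^] m)"
      by (rule comm_near_mult[OF Suc])
    ultimately have "comm_near (real (m div 2) + (real k * real m / 2 + real (Suc k) + 1))
        (Q (Suc (Suc k)) [^] m) (y [^] (Suc k * m) \<otimes> y [^] m)"
      by (rule comm_near_trans)
    moreover have "y [^] (Suc k * m) \<otimes> y [^] m = y [^] (Suc (Suc k) * m)"
      using y by (simp add: nat_pow_mult algebra_simps)
    ultimately have "comm_near (real (m div 2) + (real k * real m / 2 + real (Suc k) + 1))
        (Q (Suc (Suc k)) [^] m) (y [^] (Suc (Suc k) * m))" by simp
    moreover have "real (m div 2) + (real k * real m / 2 + real (Suc k) + 1) \<le>
        real (Suc k) * real m / 2 + real (Suc (Suc k))"
      by (simp add: algebra_simps add_divide_distrib)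
    ultimately show ?case by (rule comm_near_mono)
  qed
  from this[of "p - 1"] have "comm_near ((real p - 1) * real m / 2 + real p) (Q p [^] m) (y [^] (p * m))"
    using p by (simp add: of_nat_diff)
  moreover have "Q p [^] m = (t \<otimes> y) [^] (p * m)" using t y by (simp add: Q_def nat_pow_pow)
  ultimately show ?thesis by simp
qed

text \<open>\<open>stable_cost d g r\<close> says that, asymptotically along multiples of \<open>d\<close>, cancelling a factor \<open>g\<close>
  changes the commutator length of the \<open>n\<close>-th power by at most \<open>r n / 2\<close>.\<close>

definition stable_cost :: "nat \<Rightarrow> 'a \<Rightarrow> real \<Rightarrow> bool" where
  "stable_cost d g r \<longleftrightarrow> g \<in> carrier G \<and> (\<forall>y\<in>carrier G. \<exists>C. \<forall>n.
    comm_near (r * real (d * n) / 2 + C) ((g \<otimes> y) [^] (d * n)) (y [^] (d * n)))"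

lemma stable_cost_closed: "stable_cost d g r \<Longrightarrow> g \<in> carrier G"
  by (simp add: stable_cost_def)

lemma stable_cost_mult:
  assumes "stable_cost d g r" "stable_cost d h s"
  shows "stable_cost d (g \<otimes> h) (r + s)"
  unfolding stable_cost_def
proof (intro conjI ballI)
  show "g \<otimes> h \<in> carrier G" using assms stable_cost_closed by simp
  fix y assume y: "y \<in> carrier G"
  have hy: "h \<otimes> y \<in> carrier G" using assms y stable_cost_closed by simp
  obtain C where C: "\<And>n. comm_near (r * real (d * n) / 2 + C) ((g \<otimes> (h \<otimes> y)) [^] (d * n)) ((h \<otimes> y) [^] (d * n))"
    using assms(1) hy unfolding stable_cost_def by blast
  obtain D where D: "\<And>n. comm_near (s * real (d * n) / 2 + D) ((h \<otimes> y) [^] (d * n)) (y [^] (d * n))"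
    using assms(2) y unfolding stable_cost_def by blast
  have "comm_near ((r + s) * real (d * n) / 2 + (C + D)) ((g \<otimes> h \<otimes> y) [^] (d * n)) (y [^] (d * n))" for n
  proof -
    have "g \<otimes> h \<otimes> y = g \<otimes> (h \<otimes> y)" using assms y stable_cost_closed by (simp add: m_assoc)
    then show ?thesis
      using comm_near_trans[OF C[of n] D[of n]] by (simp add: algebra_simps add_divide_distrib)
  qed
  then show "\<exists>C. \<forall>n. comm_near ((r + s) * real (d * n) / 2 + C) ((g \<otimes> h \<otimes> y) [^] (d * n)) (y [^] (d * n))"
    by blast
qed

lemma stable_cost_conj:
  assumes "stable_cost d g r" "t \<in> carrier G"
  shows "stable_cost d (t \<otimes> g \<otimes> inv t) r"
  unfolding stable_cost_def
proof (intro conjI ballI)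
  have g: "g \<in> carrier G" by (rule stable_cost_closed[OF assms(1)])
  then show "t \<otimes> g \<otimes> inv t \<in> carrier G" using assms(2) by simp
  fix y assume y: "y \<in> carrier G"
  let ?y = "inv t \<otimes> y \<otimes> t"
  have y': "?y \<in> carrier G" using y assms(2) by simp
  obtain C where C: "\<And>n. comm_near (r * real (d * n) / 2 + C) ((g \<otimes> ?y) [^] (d * n)) (?y [^] (d * n))"
    using assms(1) y' unfolding stable_cost_def by blast
  have "comm_near (r * real (d * n) / 2 + C) ((t \<otimes> g \<otimes> inv t \<otimes> y) [^] (d * n)) (y [^] (d * n))" for n
  proof -
    have "t \<otimes> g \<otimes> inv t \<otimes> y = t \<otimes> (g \<otimes> ?y) \<otimes> inv t" "y = t \<otimes> ?y \<otimes> inv t"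
      using g y assms(2) by (simp_all add: word_simps)
    then have "(t \<otimes> g \<otimes> inv t \<otimes> y) [^] (d * n) = t \<otimes> (g \<otimes> ?y) [^] (d * n) \<otimes> inv t"
      "y [^] (d * n) = t \<otimes> ?y [^] (d * n) \<otimes> inv t"
      using g y' assms(2) by (metis conj_pow m_closed)+
    then show ?thesis using comm_near_conj_both[OF C[of n] assms(2)] by simp
  qed
  then show "\<exists>C. \<forall>n. comm_near (r * real (d * n) / 2 + C) ((t \<otimes> g \<otimes> inv t \<otimes> y) [^] (d * n)) (y [^] (d * n))"
    by blast
qed

lemma stable_cost_torsion:
  assumes t: "t \<in> carrier G" "t [^] p = \<one>" and p: "p > 0" "p dvd d"
  shows "stable_cost d t (1 - 1 / real p)"
  unfolding stable_cost_def
proof (intro conjI ballI t(1))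
  fix y assume y: "y \<in> carrier G"
  obtain e where e: "d = p * e" using p(2) by blast
  have "comm_near ((1 - 1 / real p) * real (d * n) / 2 + real p) ((t \<otimes> y) [^] (d * n)) (y [^] (d * n))" for n
  proof -
    have "comm_near ((real p - 1) * real (e * n) / 2 + real p) ((t \<otimes> y) [^] (p * (e * n))) (y [^] (p * (e * n)))"
      by (rule comm_near_torsion_mult_pow[OF t y p(1)])
    moreover have "(real p - 1) * real (e * n) / 2 = (1 - 1 / real p) * real (d * n) / 2"
      using p(1) by (simp add: e field_simps)
    moreover have "p * (e * n) = d * n" by (simp add: e)
    ultimately show ?thesis by (simp only:)
  qed
  then show "\<exists>C. \<forall>n. comm_near ((1 - 1 / real p) * real (d * n) / 2 + C) ((t \<otimes> y) [^] (d * n)) (y [^] (d * n))"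
    by blast
qed

text \<open>Each of the factors is removed by one commutator; the rate is 2 because
  \<open>stable_cost\<close> is normalised by r n / 2.\<close>

lemma stable_cost_commutator:
  assumes "x \<in> carrier G" "z \<in> carrier G"
  shows "stable_cost d (x \<otimes> z \<otimes> inv x \<otimes> inv z) 2"
  unfolding stable_cost_def
proof (intro conjI ballI)
  let ?u = "x \<otimes> z \<otimes> inv x \<otimes> inv z"
  show u: "?u \<in> carrier G" using assms by simp
  fix y assume y: "y \<in> carrier G"
  have 1: "comm_near 1 (?u \<otimes> y) y"
    unfolding comm_near_def using comm_prod_commutator[OF assms] y by blast
  have "comm_near (real n) ((?u \<otimes> y) [^] n) (y [^] n)" for n
  proof (induction n)
    case 0
    then show ?case using comm_near_refl[of \<one> 0] by simp
  next
    case (Suc n)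
    then show ?case using comm_near_mult[OF Suc 1] by (simp add: add.commute)
  qed
  from this[of "d * n" for n] have "\<forall>n. comm_near (2 * real (d * n) / 2 + 0) ((?u \<otimes> y) [^] (d * n)) (y [^] (d * n))" by simp
  then show "\<exists>C. \<forall>n. comm_near (2 * real (d * n) / 2 + C) ((?u \<otimes> y) [^] (d * n)) (y [^] (d * n))" by blast
qed

lemma stable_cost_one: "stable_cost d \<one> 0"
  unfolding stable_cost_def by (auto intro!: exI[of _ 0] comm_near_refl)

end

section \<open>Powers of the word as products of commutators\<close>

context group
begin

text \<open>Every \<open>g\<close> is moved to the left end past the powers of \<open>x\<close>; it
  becomes a conjugate, which has the same cost.\<close>

lemma collect_powers_right:
  assumes "x \<in> carrier G" "stable_cost d g r"
  shows "\<exists>U. stable_cost d U (real k * r) \<and> x [^] (j::nat) \<otimes> (g \<otimes> x [^] (e::nat)) [^] k = U \<otimes> x [^] (j + e * k)"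
proof (induction k)
  case 0
  then show ?case using stable_cost_one assms(1) by (intro exI[of _ \<one>]) simp
next
  case (Suc k)
  then obtain U where U: "stable_cost d U (real k * r)"
    "x [^] j \<otimes> (g \<otimes> x [^] e) [^] k = U \<otimes> x [^] (j + e * k)" by blast
  have g: "g \<in> carrier G" "U \<in> carrier G" using assms(2) U(1) stable_cost_closed by blast+
  let ?t = "x [^] (j + e * k)"
  let ?V = "U \<otimes> (?t \<otimes> g \<otimes> inv ?t)"
  have "x [^] j \<otimes> (g \<otimes> x [^] e) [^] Suc k = (x [^] j \<otimes> (g \<otimes> x [^] e) [^] k) \<otimes> (g \<otimes> x [^] e)"
    using assms(1) g by (simp add: m_assoc)
  also have "\<dots> = ?V \<otimes> (?t \<otimes> x [^] e)"
    unfolding U(2) using assms(1) g by (simp add: word_simps del: nat_pow_mult)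
  also have "?t \<otimes> x [^] e = x [^] (j + e * Suc k)"
    using assms(1) by (simp add: nat_pow_mult algebra_simps)
  finally have "x [^] j \<otimes> (g \<otimes> x [^] e) [^] Suc k = ?V \<otimes> x [^] (j + e * Suc k)" .
  moreover have "stable_cost d ?V (real k * r + r)"
    using assms g by (intro stable_cost_mult U(1) stable_cost_conj) auto
  then have "stable_cost d ?V (real (Suc k) * r)" by (simp add: algebra_simps)
  ultimately show ?case by blast
qed

lemma collect_powers_left:
  assumes "s \<in> carrier G" "stable_cost d y r"
  shows "\<exists>T. stable_cost d T (real k * r) \<and> (s \<otimes> y) [^] (k::nat) = s [^] k \<otimes> T"
proof (induction k)
  case 0
  then show ?case using stable_cost_one by (intro exI[of _ \<one>]) simp
next
  case (Suc k)
  then obtain T where T: "stable_cost d T (real k * r)" "(s \<otimes> y) [^] k = s [^] k \<otimes> T" by blast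
  have y: "y \<in> carrier G" "T \<in> carrier G" using assms(2) T(1) stable_cost_closed by blast+
  let ?V = "(inv s \<otimes> T \<otimes> inv (inv s)) \<otimes> y"
  have "(s \<otimes> y) [^] Suc k = s [^] Suc k \<otimes> ?V"
    using assms(1) y T(2) by (simp add: word_simps)
  moreover have "stable_cost d ?V (real k * r + r)"
    using assms y by (intro stable_cost_mult T(1) stable_cost_conj) auto
  then have "stable_cost d ?V (real (Suc k) * r)" by (simp add: algebra_simps)
  ultimately show ?case by blast
qed

end

locale torsion_pair = group G for G (structure) +
  fixes a b :: 'a and K :: nat
  assumes a: "a \<in> carrier G" and b: "b \<in> carrier G" and K: "K \<ge> 1" and a_torsion: "a [^] (6 * K + 3) = \<one>"
begin

text \<open>Chosen so that \<open>ord_a\<close> is 2 * \<open>N\<close> + 3. Being a multiple of 3,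
  \<open>N\<close> also makes \<open>ord_a\<close> divisible by 3, so that the cube of
  \<open>inv a\<close> is killed by the power \<open>ord_a\<close>/3.\<close>

abbreviation N :: nat where "N \<equiv> 3 * K"
abbreviation ord_a :: nat where "ord_a \<equiv> 6 * K + 3"

definition c :: 'a where
  "c = a \<otimes> b \<otimes> inv a \<otimes> inv a \<otimes> inv b \<otimes> inv b \<otimes> a \<otimes> a \<otimes> b \<otimes> b \<otimes> inv a \<otimes> inv b"
text \<open>\<open>c1\<close> and \<open>c2\<close> are cyclic rotations of \<open>c\<close>. One
  begins with \<open>a^-2\<close>, the other ends with \<open>a^2\<close>, so these letters stand
  where consecutive powers can collect them.\<close>

definition c1 :: 'a where
  "c1 = inv a \<otimes> inv a \<otimes> inv b \<otimes> inv b \<otimes> a \<otimes> a \<otimes> b \<otimes> b \<otimes> inv a \<otimes> inv b \<otimes> a \<otimes> b"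
definition c2 :: 'a where
  "c2 = b \<otimes> b \<otimes> inv a \<otimes> inv b \<otimes> a \<otimes> b \<otimes> inv a \<otimes> inv a \<otimes> inv b \<otimes> inv b \<otimes> a \<otimes> a"
definition p :: 'a where "p = b \<otimes> b \<otimes> inv a \<otimes> inv b \<otimes> a \<otimes> b"
definition W :: 'a where
  "W = (b \<otimes> b) \<otimes> ((inv a \<otimes> (inv b \<otimes> a \<otimes> inv (inv b)) \<otimes> inv (inv a)) \<otimes> inv a [^] (3::nat)) \<otimes> inv (b \<otimes> b)"
definition u :: 'a where "u = a \<otimes> a \<otimes> b"
definition v :: 'a where "v = b \<otimes> inv a \<otimes> inv b \<otimes> a \<otimes> b \<otimes> inv a \<otimes> inv a"
definition q :: 'a where "q = b \<otimes> a \<otimes> inv b"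
definition Z :: 'a where
  "Z = ((b \<otimes> b) \<otimes> inv a \<otimes> inv (b \<otimes> b)) \<otimes> (q \<otimes> (u \<otimes> v \<otimes> inv u \<otimes> inv v) \<otimes> inv q)"

lemmas ab = a b

lemma closed: "c \<in> carrier G" "c1 \<in> carrier G" "c2 \<in> carrier G" "p \<in> carrier G" "W \<in> carrier G"
  "u \<in> carrier G" "v \<in> carrier G" "q \<in> carrier G" "Z \<in> carrier G"
  using ab by (simp_all add: c_def c1_def c2_def p_def W_def u_def v_def q_def Z_def)

lemma inv_a_torsion: "inv a [^] ord_a = \<one>"
  using a a_torsion by (simp add: nat_pow_inv)

lemma c2_eq_W: "c2 = W \<otimes> a [^] (2::nat)"
  using ab by (simp add: c2_def W_def word_simps numeral_2_eq_2 numeral_3_eq_3)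

lemma c2_eq_conj: "c2 = p \<otimes> c1 \<otimes> inv p"
  using ab by (simp add: c2_def c1_def p_def word_simps)

lemma c_eq_conj: "c = (a \<otimes> b) \<otimes> c1 \<otimes> inv (a \<otimes> b)"
  using ab by (simp add: c_def c1_def word_simps)

text \<open>Pulling the letters \<open>a\<^sup>-\<^sup>2\<close> and \<open>a\<^sup>-\<^sup>1\<close> of one copy out of \<open>c2\<^sup>2\<close> leaves a commutator times \<open>a\<^sup>3\<close>.\<close>

lemma c2_square: "c2 [^] (2::nat) = (p \<otimes> inv a [^] (2::nat) \<otimes> inv p) \<otimes> Z \<otimes> a [^] (3::nat)"
  using ab by (simp add: c2_def p_def Z_def q_def u_def v_def word_simps numeral_2_eq_2 numeral_3_eq_3)

definition cost_a :: real where "cost_a = 1 - 1 / real ord_a"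
definition cost_W :: real where "cost_W = 2 - 4 / real ord_a"

lemma stable_cost_a: "stable_cost ord_a a cost_a" "stable_cost ord_a (inv a) cost_a"
  unfolding cost_a_def using a a_torsion inv_a_torsion by (intro stable_cost_torsion; simp)+

text \<open>Up to conjugation, \<open>W\<close> is a conjugate of \<open>a\<close> times
  \<open>a^-3\<close>. The second has order dividing \<open>ord_a\<close>/3, so the costs are 1 -
  1/\<open>ord_a\<close> and 1 - 3/\<open>ord_a\<close>.\<close>

lemma stable_cost_W: "stable_cost ord_a W cost_W"
proof -
  have "ord_a = 3 * (2 * K + 1)" by simp
  then have "(inv a [^] (3::nat)) [^] (2 * K + 1) = \<one>"
    using inv_a_torsion by (simp only: nat_pow_pow[OF inv_closed[OF a]])
  moreover have "2 * K + 1 dvd ord_a" by (metis dvd_triv_right \<open>ord_a = 3 * (2 * K + 1)\<close>)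
  ultimately have "stable_cost ord_a (inv a [^] (3::nat)) (1 - 1 / real (2 * K + 1))"
    using a by (intro stable_cost_torsion) auto
  moreover have "cost_W = cost_a + (1 - 1 / real (2 * K + 1))"
  proof -
    have "1 / real (2 * K + 1) = 3 / real ord_a" by (simp add: divide_simps)
    then show ?thesis unfolding cost_W_def cost_a_def by simp
  qed
  ultimately show ?thesis
    unfolding W_def using ab by (simp only:) (intro stable_cost_conj stable_cost_mult stable_cost_a; simp)
qed

lemma stable_cost_Z: "stable_cost ord_a Z (cost_a + 2)"
  unfolding Z_def using ab closed
  by (intro stable_cost_mult stable_cost_conj stable_cost_a stable_cost_commutator) auto

lemma c1_pow: "c1 [^] (n::nat) = inv p \<otimes> c2 [^] n \<otimes> p"
proof -
  have "c2 [^] n = p \<otimes> c1 [^] n \<otimes> inv p" unfolding c2_eq_conj using closed by (intro conj_pow) auto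
  then show ?thesis using closed by (simp add: word_simps)
qed

text \<open>The first two copies supply \<open>a^3\<close>, the next \<open>k\<close> copies and the
  block with remainder \<open>R\<close> supply \<open>a^2\<close> each. Together this is a power 2 k
  + 5 = \<open>ord_a\<close> of \<open>a\<close> and vanishes; what remains is \<open>a^-2\<close>
  from the first two copies and the collected remainders.\<close>

lemma c1_pow_absorb:
  assumes "c2 [^] m = R \<otimes> a [^] (2::nat)" "stable_cost ord_a R r" "2 * k + 5 = ord_a"
  shows "\<exists>Y. stable_cost ord_a Y (cost_a + 2 + real k * cost_W + r) \<and>
    c1 [^] (2 + k + m) = inv a [^] (2::nat) \<otimes> Y"
proof -
  obtain U where U: "stable_cost ord_a U (real k * cost_W)"
    "a [^] (3::nat) \<otimes> (W \<otimes> a [^] (2::nat)) [^] k = U \<otimes> a [^] (3 + 2 * k)"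
    using collect_powers_right[OF a stable_cost_W] by blast
  have R: "R \<in> carrier G" "U \<in> carrier G" using assms(2) U(1) stable_cost_closed by blast+
  let ?t = "a [^] (3 + 2 * k)"
  let ?Y = "inv p \<otimes> (Z \<otimes> U \<otimes> (?t \<otimes> R \<otimes> inv ?t)) \<otimes> inv (inv p)"
  have "c2 [^] (2 + k + m) = c2 [^] (2::nat) \<otimes> c2 [^] k \<otimes> c2 [^] m"
    by (simp only: nat_pow_mult[OF closed(3)])
  also have "\<dots> = (p \<otimes> inv a [^] (2::nat) \<otimes> inv p) \<otimes> Z \<otimes> (a [^] (3::nat) \<otimes> (W \<otimes> a [^] (2::nat)) [^] k) \<otimes> (R \<otimes> a [^] (2::nat))"
    unfolding c2_square assms(1) unfolding c2_eq_W using closed a R by (simp add: m_assoc)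
  also have "\<dots> = (p \<otimes> inv a [^] (2::nat) \<otimes> inv p) \<otimes> (Z \<otimes> U \<otimes> (?t \<otimes> R \<otimes> inv ?t)) \<otimes> (?t \<otimes> a [^] (2::nat))"
    unfolding U(2) using closed a R by (simp add: word_simps del: nat_pow_mult)
  also have "?t \<otimes> a [^] (2::nat) = \<one>"
  proof -
    have "3 + 2 * k + 2 = ord_a" using assms(3) by simp
    then show ?thesis using a_torsion by (simp only: nat_pow_mult[OF a])
  qed
  finally have "c1 [^] (2 + k + m) = inv a [^] (2::nat) \<otimes> ?Y"
    unfolding c1_pow using closed a R by (simp add: word_simps)
  moreover have "stable_cost ord_a ?Y (cost_a + 2 + real k * cost_W + r)"
    using closed a R by (intro stable_cost_conj stable_cost_mult stable_cost_Z U(1) assms(2)) auto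
  ultimately show ?thesis by blast
qed

text \<open>The summands belong to the conjugate of \<open>a\<close> left over at the end, to the
  block that contains \<open>R\<close> (without the cost of \<open>R\<close>), and to the other
  \<open>N - 1\<close> blocks.\<close>

definition step_cost :: real where
  "step_cost = cost_a + (cost_a + 2 + real (N - 1) * cost_W) +
    real (N - 1) * (cost_a + 2 + real N * cost_W)"

text \<open>\<open>N\<close> blocks, each equal to \<open>a^-2\<close> up to cost, contribute a^(-2
  N). The conjugation by \<open>p\<close> and one further copy of \<open>c1\<close> contribute
  \<open>a^-1\<close> and \<open>a^-2\<close>, and the exponents add up to -\<open>ord_a\<close>.
  The final \<open>a^2\<close> of that copy survives, so the result has the form of the hypothesis
  again.\<close>

lemma c2_pow_step:
  assumes "c2 [^] m = R \<otimes> a [^] (2::nat)" "stable_cost ord_a R r"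
  shows "\<exists>R'. c2 [^] (m + N * (N + 2)) = R' \<otimes> a [^] (2::nat) \<and> stable_cost ord_a R' (r + step_cost)"
proof -
  let ?s = "inv a [^] (2::nat)"
  have s: "?s \<in> carrier G" using a by simp
  obtain Y0 where Y0: "stable_cost ord_a Y0 (cost_a + 2 + real (N - 1) * cost_W + r)"
    "c1 [^] (2 + (N - 1) + m) = ?s \<otimes> Y0"
  proof -
    have "2 * (N - 1) + 5 = ord_a" using K by simp
    then show ?thesis using c1_pow_absorb[OF assms] that by blast
  qed
  \<comment> \<open>The case \<open>R = W\<close>, \<open>m = 1\<close> supplies the blocks that do not contain \<open>R\<close>.\<close>
  obtain Y where Y: "stable_cost ord_a Y (cost_a + 2 + real N * cost_W)" "c1 [^] (N + 2) = ?s \<otimes> Y"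
  proof -
    have "c2 [^] (1::nat) = W \<otimes> a [^] (2::nat)" using c2_eq_W closed by simp
    moreover have "2 * (N - 1) + 5 = ord_a" using K by simp
    ultimately obtain Y where "stable_cost ord_a Y (cost_a + 2 + real (N - 1) * cost_W + cost_W)"
      "c1 [^] (2 + (N - 1) + 1) = ?s \<otimes> Y"
      using c1_pow_absorb[OF _ stable_cost_W] by blast
    moreover have "real (N - 1) * cost_W + cost_W = real N * cost_W" using K by (simp add: algebra_simps of_nat_diff)
    moreover have "2 + (N - 1) + 1 = N + 2" using K by simp
    ultimately show ?thesis using that by (simp add: add.assoc)
  qed
  obtain T where T: "stable_cost ord_a T (real (N - 1) * (cost_a + 2 + real N * cost_W))"
    "(?s \<otimes> Y) [^] (N - 1) = ?s [^] (N - 1) \<otimes> T"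
    using collect_powers_left[OF s Y(1)] by blast
  have cl: "Y0 \<in> carrier G" "Y \<in> carrier G" "T \<in> carrier G"
    using Y0(1) Y(1) T(1) stable_cost_closed by blast+
  define T' where "T' = (inv ?s \<otimes> T \<otimes> inv (inv ?s)) \<otimes> Y0"
  have T': "stable_cost ord_a T' (real (N - 1) * (cost_a + 2 + real N * cost_W) + (cost_a + 2 + real (N - 1) * cost_W + r))"
    unfolding T'_def using s by (intro stable_cost_mult stable_cost_conj T(1) Y0(1)) auto
  have T'_cl: "T' \<in> carrier G" using stable_cost_closed[OF T'] .
  \<comment> \<open>\<open>N - 1\<close> blocks of \<open>N + 2\<close> copies and one block of
    \<open>N + 1 + m\<close> copies; with the further copy of \<open>c1\<close> this makes
    \<open>m + N * (N + 2)\<close>.\<close>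
  define n where "n = (N + 2) * (N - 1) + (2 + (N - 1) + m)"
  have "c1 [^] n = (c1 [^] (N + 2)) [^] (N - 1) \<otimes> c1 [^] (2 + (N - 1) + m)"
    by (simp only: n_def nat_pow_pow[OF closed(2)] nat_pow_mult[OF closed(2)])
  also have "\<dots> = (?s [^] (N - 1) \<otimes> T) \<otimes> (?s \<otimes> Y0)" unfolding Y0(2) Y(2) T(2) ..
  also have "\<dots> = (?s [^] (N - 1) \<otimes> ?s) \<otimes> T'"
    using s cl by (simp add: T'_def word_simps del: nat_pow_mult)
  also have "?s [^] (N - 1) \<otimes> ?s = inv a [^] (2 * N)"
  proof -
    have "?s [^] (N - 1) \<otimes> ?s = ?s [^] Suc (N - 1)" by simp
    also have "Suc (N - 1) = N" using K by simp
    finally show ?thesis using a by (simp add: nat_pow_pow)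
  qed
  finally have c1n: "c1 [^] n = inv a [^] (2 * N) \<otimes> T'" .
  define V where "V = inv a [^] (2 * N)"
  have V: "V \<in> carrier G" using a by (simp add: V_def)
  have VV: "inv a \<otimes> V \<otimes> inv a [^] (2::nat) = \<one>"
  proof -
    have "inv a [^] (1::nat) \<otimes> V \<otimes> inv a [^] (2::nat) = inv a [^] (1 + 2 * N + 2)"
      by (simp only: V_def nat_pow_mult[OF inv_closed[OF a]])
    also have "1 + 2 * N + 2 = ord_a" by simp
    finally show ?thesis using inv_a_torsion a by simp
  qed
  let ?y = "inv b \<otimes> a \<otimes> inv (inv b)"
  let ?X = "(inv a \<otimes> ?y \<otimes> inv (inv a)) \<otimes> ((inv a \<otimes> V) \<otimes> T' \<otimes> inv (inv a \<otimes> V))"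
  let ?R = "(b \<otimes> b) \<otimes> ?X \<otimes> inv (b \<otimes> b)"
  have "c2 [^] (m + N * (N + 2)) = p \<otimes> (c1 [^] n \<otimes> c1) \<otimes> inv p"
  proof -
    have "m + N * (N + 2) = Suc n" using K unfolding n_def by (cases N) (auto simp: algebra_simps)
    moreover have "c2 [^] Suc n = p \<otimes> c1 [^] Suc n \<otimes> inv p"
      unfolding c2_eq_conj using closed by (intro conj_pow) auto
    ultimately show ?thesis by simp
  qed
  also have "\<dots> = (b \<otimes> b) \<otimes> (inv a \<otimes> ?y \<otimes> V \<otimes> T' \<otimes> inv a [^] (2::nat)) \<otimes> inv (b \<otimes> b) \<otimes> a [^] (2::nat)"
    unfolding c1n V_def[symmetric] using ab V T'_cl by (simp add: p_def c1_def word_simps numeral_2_eq_2)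
  also have "inv a \<otimes> ?y \<otimes> V \<otimes> T' \<otimes> inv a [^] (2::nat) = ?X \<otimes> (inv a \<otimes> V \<otimes> inv a [^] (2::nat))"
    using ab V T'_cl by (simp add: word_simps del: nat_pow_mult)
  also have "\<dots> = ?X" unfolding VV using ab V T'_cl by simp
  finally have "c2 [^] (m + N * (N + 2)) = ?R \<otimes> a [^] (2::nat)" .
  moreover have "stable_cost ord_a ?R (cost_a + (real (N - 1) * (cost_a + 2 + real N * cost_W) + (cost_a + 2 + real (N - 1) * cost_W + r)))"
    using ab V by (intro stable_cost_conj stable_cost_mult stable_cost_a T') auto
  then have "stable_cost ord_a ?R (r + step_cost)" by (simp add: step_cost_def algebra_simps)
  ultimately show ?thesis by blast
qed

lemma c2_pow_remainder:
  "\<exists>R. c2 [^] (1 + M * (N * (N + 2))) = R \<otimes> a [^] (2::nat) \<and> stable_cost ord_a R (cost_W + real M * step_cost)"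
proof (induction M)
  case 0
  then show ?case using c2_eq_W stable_cost_W closed by (intro exI[of _ W]) simp
next
  case (Suc M)
  then obtain R where "c2 [^] (1 + M * (N * (N + 2))) = R \<otimes> a [^] (2::nat)"
    "stable_cost ord_a R (cost_W + real M * step_cost)" by blast
  from c2_pow_step[OF this] show ?case by (simp add: algebra_simps)
qed

text \<open>Cancelling the remainder leaves a power of \<open>a^2\<close> with exponent divisible by
  \<open>ord_a\<close>, which is trivial.\<close>

lemma comm_prod_c_pow:
  "\<exists>C. \<forall>n. comm_prod ((cost_W + real M * step_cost) * real (ord_a * n) / 2 + C)
    (c [^] ((1 + M * (N * (N + 2))) * ord_a * n))"
proof -
  let ?m = "1 + M * (N * (N + 2))"
  obtain R where R: "c2 [^] ?m = R \<otimes> a [^] (2::nat)" "stable_cost ord_a R (cost_W + real M * step_cost)"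
    using c2_pow_remainder by blast
  obtain C where C: "\<And>n. comm_near ((cost_W + real M * step_cost) * real (ord_a * n) / 2 + C)
      ((R \<otimes> a [^] (2::nat)) [^] (ord_a * n)) ((a [^] (2::nat)) [^] (ord_a * n))"
    using R(2) a unfolding stable_cost_def by (meson nat_pow_closed)
  have "comm_prod ((cost_W + real M * step_cost) * real (ord_a * n) / 2 + C) (c [^] (?m * ord_a * n))" for n
  proof -
    have "(a [^] (2::nat)) [^] (ord_a * n) = (a [^] ord_a) [^] (2 * n)"
      using a by (simp add: nat_pow_pow algebra_simps)
    then have one: "(a [^] (2::nat)) [^] (ord_a * n) = \<one>" using a_torsion by simp
    have "comm_near ((cost_W + real M * step_cost) * real (ord_a * n) / 2 + C) ((c2 [^] ?m) [^] (ord_a * n)) \<one>"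
      using C[of n] unfolding R(1) one .
    then have "comm_prod ((cost_W + real M * step_cost) * real (ord_a * n) / 2 + C) ((c2 [^] ?m) [^] (ord_a * n))"
      unfolding comm_near_def using comm_prod_closed by auto
    then have "comm_prod ((cost_W + real M * step_cost) * real (ord_a * n) / 2 + C) (c2 [^] (?m * ord_a * n))"
      using closed by (simp only: nat_pow_pow mult.assoc)
    from comm_prod_conj[OF this, of "a \<otimes> b \<otimes> inv p"]
    have "comm_prod ((cost_W + real M * step_cost) * real (ord_a * n) / 2 + C)
        ((a \<otimes> b \<otimes> inv p) \<otimes> c2 [^] (?m * ord_a * n) \<otimes> inv (a \<otimes> b \<otimes> inv p))"
      using closed ab by simp
    moreover have "c = (a \<otimes> b \<otimes> inv p) \<otimes> c2 \<otimes> inv (a \<otimes> b \<otimes> inv p)"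
      unfolding c_eq_conj c2_eq_conj using closed ab by (simp add: word_simps)
    then have "c [^] (?m * ord_a * n) = (a \<otimes> b \<otimes> inv p) \<otimes> c2 [^] (?m * ord_a * n) \<otimes> inv (a \<otimes> b \<otimes> inv p)"
      using closed ab conj_pow by simp
    ultimately show ?thesis by simp
  qed
  then show ?thesis by blast
qed

lemma step_cost_eq: "step_cost = real N * (real ord_a - 2 + 3 / real ord_a)"
proof -
  have N: "real (N - 1) = 3 * real K - 1" "real N = 3 * real K" using K by (simp_all add: of_nat_diff)
  define x where "x = real K"
  define e where "e = 1 / real ord_a"
  have "e * (6 * x + 3) = 1" by (simp add: e_def x_def field_simps)
  then have "1 - e + (1 - e + 2 + (3 * x - 1) * (2 - 4 * e)) + (3 * x - 1) * (1 - e + 2 + 3 * x * (2 - 4 * e)) =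
      3 * x * (6 * x + 3 - 2 + 3 * e)"
    by algebra
  moreover have "real ord_a = 6 * x + 3" by (simp add: x_def)
  ultimately show ?thesis
    unfolding step_cost_def cost_a_def cost_W_def N x_def[symmetric]
    by (simp add: e_def)
qed

end

section \<open>The stable commutator length\<close>

context group
begin

lemma derived_foldr:
  assumes "g \<in> derived G (carrier G)"
  shows "\<exists>xs. set xs \<subseteq> derived_set G (carrier G) \<and> foldr (\<otimes>) xs \<one> = g"
  using assms unfolding derived_def
proof (induction rule: generate.induct)
  case one
  then show ?case by (intro exI[of _ "[]"]) simp
next
  case (incl h)
  then have "h \<in> carrier G" by (rule subsetD[OF derived_set_carrier])
  then have "foldr (\<otimes>) [h] \<one> = h" by simp
  moreover have "set [h] \<subseteq> derived_set G (carrier G)" using incl by (simp del: UN_iff)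
  ultimately show ?case by (intro exI conjI)
next
  case (inv h)
  obtain x y where xy: "x \<in> carrier G" "y \<in> carrier G" "h = x \<otimes> y \<otimes> inv x \<otimes> inv y"
    using inv by (elim UN_E) (rule that, assumption+, erule singletonD)
  \<comment> \<open>The inverse of a commutator is a commutator, so inverses do not lengthen the
    product.\<close>
  then have inv_h: "inv h = y \<otimes> x \<otimes> inv y \<otimes> inv x" by (simp add: word_simps)
  have "set [inv h] \<subseteq> derived_set G (carrier G)"
    unfolding inv_h using derived_setI[OF xy(2,1)] by (simp del: UN_iff)
  moreover have "foldr (\<otimes>) [inv h] \<one> = inv h" using xy by simp
  ultimately show ?case by (intro exI conjI)
next
  case (eng h k)
  obtain xs ys where xs: "set xs \<subseteq> derived_set G (carrier G)" "foldr (\<otimes>) xs \<one> = h"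
    and ys: "set ys \<subseteq> derived_set G (carrier G)" "foldr (\<otimes>) ys \<one> = k"
    using eng.IH by (elim exE conjE) (rule that)
  have "set (xs @ ys) \<subseteq> derived_set G (carrier G)" using xs(1) ys(1) by (simp del: UN_iff)
  moreover have "foldr (\<otimes>) (xs @ ys) \<one> = h \<otimes> k"
    using foldr_mult_append[OF subset_trans[OF xs(1) derived_set_carrier] subset_trans[OF ys(1) derived_set_carrier]]
      xs(2) ys(2) by simp
  ultimately show ?case by (intro exI conjI)
qed

lemma comm_length_attained:
  assumes "g \<in> derived G (carrier G)"
  shows "\<exists>xs. length xs = comm_length G g \<and> set xs \<subseteq> derived_set G (carrier G) \<and> foldr (\<otimes>) xs \<one> = g"
proof -
  obtain xs where xs: "set xs \<subseteq> derived_set G (carrier G)" "foldr (\<otimes>) xs \<one> = g"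
    using derived_foldr[OF assms] by (elim exE conjE) (rule that)
  have "\<exists>ys. length ys = length xs \<and> set ys \<subseteq> derived_set G (carrier G) \<and> foldr (\<otimes>) ys \<one> = g"
    by (intro exI[of _ xs] conjI refl xs)
  then show ?thesis unfolding comm_length_def by (rule LeastI)
qed

lemma comm_prod_comm_length:
  assumes "g \<in> derived G (carrier G)"
  shows "comm_prod (real (comm_length G g)) g"
proof -
  obtain xs where xs: "length xs = comm_length G g" "set xs \<subseteq> derived_set G (carrier G)" "foldr (\<otimes>) xs \<one> = g"
    using comm_length_attained[OF assms] by (elim exE conjE) (rule that)
  have "real (length xs) \<le> real (comm_length G g)" using xs(1) by simp
  then show ?thesis unfolding comm_prod_def by (intro exI[of _ xs] conjI xs(2,3))
qed

lemma comm_length_le: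
  assumes "comm_prod r g"
  shows "real (comm_length G g) \<le> r"
proof -
  obtain xs where xs: "real (length xs) \<le> r" "set xs \<subseteq> derived_set G (carrier G)" "foldr (\<otimes>) xs \<one> = g"
    using assms unfolding comm_prod_def by (elim exE conjE) (rule that)
  have "comm_length G g \<le> length xs"
    unfolding comm_length_def by (intro Least_le exI[of _ xs] conjI refl xs)
  then show ?thesis using xs(1) by simp
qed

lemma derived_pow_closed:
  assumes "g \<in> derived G (carrier G)"
  shows "g [^] (n::nat) \<in> derived G (carrier G)"
proof -
  interpret D: subgroup "derived G (carrier G)" G by (rule derived_is_subgroup) simp
  show ?thesis using assms by (induction n) auto
qed

text \<open>Upper estimates along multiples of some \<open>d\<close> suffice: the other exponents
  differ by a remainder below \<open>d\<close>, whose commutator length is bounded by a constant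
  independent of the exponent.\<close>

lemma scl_eqI:
  assumes g: "g \<in> derived G (carrier G)" and V: "V \<ge> 0"
    and lower: "\<And>n. n > 0 \<Longrightarrow> V * real n \<le> real (comm_length G (g [^] n))"
    and upper: "\<And>e. e > 0 \<Longrightarrow> \<exists>d>0. \<exists>C. \<forall>n. comm_prod ((V + e) * real (d * n) + C) (g [^] (d * n))"
  shows "scl G g = V"
proof -
  have gG: "g \<in> carrier G" using g derived_in_carrier by blast
  let ?x = "\<lambda>n. real (comm_length G (g [^] n)) / real n"
  have "?x \<longlonglongrightarrow> V"
  proof (rule LIMSEQ_I)
    fix r :: real assume r: "r > 0"
    obtain d C where d: "d > 0" and C: "\<And>n. comm_prod ((V + r / 2) * real (d * n) + C) (g [^] (d * n))"
      using upper[of "r / 2"] r by auto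
    define D where "D = (\<Sum>j<d. real (comm_length G (g [^] j)))"
    have bound: "real (comm_length G (g [^] n)) \<le> (V + r / 2) * real n + (C + D)" for n
    proof -
      have "comm_prod (real (comm_length G (g [^] (n mod d)))) (g [^] (n mod d))"
        by (intro comm_prod_comm_length derived_pow_closed g)
      moreover have "real (comm_length G (g [^] (n mod d))) \<le> D"
        unfolding D_def using d by (intro member_le_sum) auto
      ultimately have "comm_prod D (g [^] (n mod d))" by (rule comm_prod_mono)
      then have "comm_prod ((V + r / 2) * real (d * (n div d)) + C + D) (g [^] (d * (n div d)) \<otimes> g [^] (n mod d))"
        by (rule comm_prod_mult[OF C])
      moreover have "g [^] (d * (n div d)) \<otimes> g [^] (n mod d) = g [^] n"
        using gG by (simp add: nat_pow_mult)
      moreover have "(V + r / 2) * real (d * (n div d)) \<le> (V + r / 2) * real n"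
        using V r by (intro mult_left_mono of_nat_mono) (auto simp: times_div_less_eq_dividend)
      ultimately show ?thesis using comm_length_le by fastforce
    qed
    obtain n0 :: nat where n0: "real n0 > 2 * (\<bar>C + D\<bar> + 1) / r" using reals_Archimedean2 by blast
    show "\<exists>no. \<forall>n\<ge>no. norm (?x n - V) < r"
    proof (intro exI allI impI)
      fix n assume n: "n \<ge> Suc n0"
      then have n_pos: "real n > 0" by simp
      have "2 * (\<bar>C + D\<bar> + 1) / r < real n" using n n0 by linarith
      then have "2 * (\<bar>C + D\<bar> + 1) < r * real n" using r by (simp add: field_simps)
      then have "real (comm_length G (g [^] n)) < (V + r) * real n"
        using bound[of n] abs_ge_self[of "C + D"] by (simp add: algebra_simps)
      then have "?x n < V + r" using n_pos by (simp add: divide_less_eq)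
      moreover have "V \<le> ?x n" using lower[of n] n n_pos by (simp add: le_divide_eq)
      ultimately show "norm (?x n - V) < r" using r by simp
    qed
  qed
  then show ?thesis unfolding scl_def by (rule limI)
qed

end

lemma prod_class_concat_replicate:
  assumes "w \<in> lists (prod_letters m n)"
  shows "prod_class m n (concat (replicate k w)) = prod_class m n w [^]\<^bsub>cyclic_prod m n\<^esub> k"
proof -
  interpret P: group "cyclic_prod m n" by (simp add: group_free_prod)
  have "concat (replicate k w) \<in> lists (prod_letters m n)" for k
    using assms by (induction k) auto
  note lists = this
  show ?thesis
  proof (induction k)
    case (Suc k)
    have "prod_class m n (concat (replicate (Suc k) w)) =
        prod_class m n w \<otimes>\<^bsub>cyclic_prod m n\<^esub> prod_class m n (concat (replicate k w))"
      using prod_class_append[OF assms lists] by simp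
    then show ?case unfolding Suc P.nat_pow_Suc2[OF prod_class_carrier[OF assms]] .
  qed (simp add: prod_class_Nil)
qed

text \<open>Equality in the group transfers the surface of an optimal product of commutators to the
  power of the reduced word. There \<open>surface_bound\<close> compares 1 - 2 times the commutator
  length with the disc count.\<close>

lemma comm_length_lower_bound:
  assumes \<phi>: "natural_hom m n \<phi>" and mn: "m > 0" "n > 0"
    and w: "disc_weight m wA" "disc_weight n wB"
    and lam: "\<And>i j. wA i (next_index j) + wB j i = lam i" and k: "k > 0"
  shows "real k * (4 - (lam I0 + lam I1 + lam I2 + lam I3)) / 2 \<le>
    real (comm_length (cyclic_prod m n) (\<phi> word_c [^]\<^bsub>cyclic_prod m n\<^esub> k))"
proof -
  let ?P = "cyclic_prod m n"
  interpret P: group ?P by (simp add: group_free_prod)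
  obtain g h where gh: "coprime g (int m)" "coprime h (int n)"
    "prod_class m n (word_letters m n g h) = \<phi> word_c"
    using natural_hom_word_letters[OF \<phi> mn] by blast
  let ?w = "word_letters m n g h"
  have w_lists: "?w \<in> lists (prod_letters m n)" by (rule word_letters_lists[OF mn])
  obtain gs where gs: "length gs = comm_length ?P (\<phi> word_c [^]\<^bsub>?P\<^esub> k)"
    "set gs \<subseteq> derived_set ?P (carrier ?P)" "foldr (\<otimes>\<^bsub>?P\<^esub>) gs \<one>\<^bsub>?P\<^esub> = \<phi> word_c [^]\<^bsub>?P\<^esub> k"
    using P.comm_length_attained[OF P.derived_pow_closed[OF natural_hom_word_c_derived[OF \<phi>], of k]]
    by (elim exE conjE) (rule that)
  obtain v where v: "v \<in> lists (prod_letters m n)" "prod_class m n v = \<phi> word_c [^]\<^bsub>?P\<^esub> k"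
    "spans_surface m n (Inl 0 # v) (1 - 2 * int (length gs))"
    using spans_surface_of_commutators[OF mn gs(2)] unfolding gs(3) by (elim bexE conjE) (rule that)
  let ?W = "concat (replicate k ?w)"
  have W_lists: "?W \<in> lists (prod_letters m n)" using w_lists by (induction k) auto
  have "prod_class m n v = prod_class m n ?W"
    using v(2) gh(3) prod_class_concat_replicate[OF w_lists] by simp
  then have "spans_surface m n (Inl 0 # ?W) (1 - 2 * int (length gs))"
    using spans_surface_prod_class[OF _ v(1) W_lists mn v(3)] by blast
  moreover obtain l r where W: "?W = l # r" "isl l"
  proof -
    obtain k' where k': "k = Suc k'" using k by (cases k) auto
    have "?w = slot_letter m n g h 0 # map (slot_letter m n g h) [1..<8]"
      by (simp add: word_letters_def upt_conv_Cons)
    then have "?W = slot_letter m n g h 0 # map (slot_letter m n g h) [1..<8] @ concat (replicate k' ?w)"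
      unfolding k' by simp
    moreover have "isl (slot_letter m n g h 0)" by (simp add: slot_letter_def)
    ultimately show ?thesis by (rule that)
  qed
  ultimately have "spans_surface m n (r @ [Inl 0, l]) (1 - 2 * int (length gs))"
    using spans_surface_rotate[of m n "[Inl 0, l]" r] by simp
  \<comment> \<open>The auxiliary letter in front is absorbed by the first letter of the word, which
    lies in the same factor.\<close>
  moreover have "merged_letter m n (Inl 0) l l"
    using W(2) by (simp add: merged_letter_def lval_A_def lval_B_def)
  ultimately have "spans_surface m n (r @ [l]) (1 - 2 * int (length gs))"
    by (rule spans_surface_merge_letters)
  then have "spans_surface m n ?W (1 - 2 * int (length gs))"
    using spans_surface_rotate[of m n r "[l]"] W(1) by simp
  from surface_bound[OF this mn gh(1,2) w lam] gs(1) show ?thesis by (simp add: algebra_simps)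
qed

lemma natural_hom_torsion_pair:
  assumes \<phi>: "natural_hom (6 * K + 3) n \<phi>" and K: "K \<ge> 1"
  shows "torsion_pair (cyclic_prod (6 * K + 3) n) (\<phi> gen_a) (\<phi> gen_b) K"
proof -
  let ?m = "6 * K + 3"
  let ?G = "integer_mod_group ?m" and ?H = "integer_mod_group n" and ?P = "cyclic_prod ?m n"
  interpret P: group ?P by (simp add: group_free_prod)
  obtain x where x: "x \<in> carrier ?G" "\<phi> gen_a = free_prod_inl ?G ?H x"
    using \<phi> by (auto simp: natural_hom_def)
  interpret L: group_hom ?G ?P "free_prod_inl ?G ?H"
    using free_prod_inl_hom[OF group_integer_mod_group]
    by (intro group_hom.intro group_integer_mod_group P.is_group) (simp add: group_hom_axioms_def)
  have "\<phi> \<in> hom F2 ?P" using \<phi> by (simp add: natural_hom_def)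
  then have cl: "\<phi> gen_a \<in> carrier ?P" "\<phi> gen_b \<in> carrier ?P"
    by (simp_all add: hom_in_carrier free_gen_carrier)
  have "x [^]\<^bsub>?G\<^esub> ?m = \<one>\<^bsub>?G\<^esub>" by (simp only: pow_integer_mod_group one_integer_mod_group) simp
  then have "\<phi> gen_a [^]\<^bsub>?P\<^esub> ?m = \<one>\<^bsub>?P\<^esub>"
    unfolding x(2) L.hom_nat_pow[OF x(1), symmetric] by (simp only: L.hom_one)
  then show ?thesis using cl K by unfold_locales
qed

lemma (in group) int_pow_small:
  assumes "x \<in> carrier G"
  shows "x [^] (2::int) = x \<otimes> x" "x [^] (-2::int) = inv x \<otimes> inv x" "x [^] (-1::int) = inv x"
proof -
  show 2: "x [^] (2::int) = x \<otimes> x" using assms int_pow_mult[OF assms, of 1 1] by simp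
  show "x [^] (-2::int) = inv x \<otimes> inv x"
    unfolding int_pow_neg[OF assms, of 2] 2 using assms by (simp add: inv_mult_group)
  show "x [^] (-1::int) = inv x"
    unfolding int_pow_neg[OF assms, of 1] using assms by simp
qed

lemma natural_hom_word_c_eq:
  assumes \<phi>: "natural_hom (6 * K + 3) n \<phi>" and K: "K \<ge> 1"
  shows "\<phi> word_c = torsion_pair.c (cyclic_prod (6 * K + 3) n) (\<phi> gen_a) (\<phi> gen_b)"
proof -
  let ?P = "cyclic_prod (6 * K + 3) n"
  interpret F: group F2 by (rule group_free_group)
  interpret T: torsion_pair ?P "\<phi> gen_a" "\<phi> gen_b" K by (rule natural_hom_torsion_pair[OF assms])
  interpret group_hom F2 ?P \<phi> using \<phi> by unfold_locales (simp add: natural_hom_def)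
  have c: "gen_a \<in> carrier F2" "gen_b \<in> carrier F2" by (simp_all add: free_gen_carrier)
  show ?thesis
    unfolding word_c_def T.c_def F.int_pow_small[OF c(1)] F.int_pow_small[OF c(2)]
    using c T.a T.b by (simp add: T.m_assoc)
qed

lemma scl_natural_hom_word_c:
  assumes \<phi>: "natural_hom (6 * K + 3) n \<phi>" and K: "K \<ge> 100" and n: "5 * (6 * K + 3) \<le> n"
  shows "scl (cyclic_prod (6 * K + 3) n) (\<phi> word_c) =
    1 - 3 * (real (6 * K + 3) - 1) / (real (6 * K + 3) * (real (6 * K + 3) + 1))"
proof -
  let ?m = "6 * K + 3"
  let ?P = "cyclic_prod ?m n"
  define V where "V = 1 - 3 * (real ?m - 1) / (real ?m * (real ?m + 1))"
  have m: "real ?m \<ge> 603" using K by simp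
  have K1: "K \<ge> 1" using K by simp
  interpret T: torsion_pair ?P "\<phi> gen_a" "\<phi> gen_b" K by (rule natural_hom_torsion_pair[OF \<phi> K1])
  have V_mult: "V * (real ?m + 1) = real ?m - 2 + 3 / real ?m"
  proof -
    have *: "(1 - 3 * (d - 1) / (d * (d + 1))) * (d + 1) = d - 2 + 3 / d" if "d > 0" for d :: real
    proof -
      have "3 * (d - 1) / (d * (d + 1)) * (d + 1) = 3 * (d - 1) / d" using that by simp
      then have "(1 - 3 * (d - 1) / (d * (d + 1))) * (d + 1) = d + 1 - 3 * (d - 1) / d"
        by (simp only: left_diff_distrib mult_1_left)
      then show ?thesis using that by (simp add: field_simps)
    qed
    have "real ?m > 0" using m by simp
    then show ?thesis unfolding V_def by (rule *)
  qed
  have V0: "V \<ge> 0"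
  proof -
    have "V * (real ?m + 1) \<ge> 0" unfolding V_mult using m by simp
    then show ?thesis using m by (simp add: zero_le_mult_iff)
  qed
  have "scl ?P (\<phi> word_c) = V"
  proof (rule T.scl_eqI)
    show "\<phi> word_c \<in> derived ?P (carrier ?P)" by (rule natural_hom_word_c_derived[OF \<phi>])
    show "0 \<le> V" by (rule V0)
    fix k :: nat assume k: "k > 0"
    define \<eta> where "\<eta> = 12 / (real ?m + 1)"
    \<comment> \<open>The bound 1/20 amounts to \<open>?m\<close> \<ge> 239; the hypothesis on
      \<open>K\<close> gives 603.\<close>
    have \<eta>: "0 < \<eta>" "\<eta> \<le> 1/20" "\<eta> * (real ?m + 1) = 12" using m by (simp_all add: \<eta>_def field_simps)
    have wA: "disc_weight ?m (weight_A (real ?m) \<eta>)"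
      by (rule disc_weight_A[OF \<eta>]) (use K in auto)
    have wB: "disc_weight n (weight_B (real ?m) \<eta>)"
    proof (rule disc_weight_B[OF \<eta>(1,2)])
      have "real (5 * ?m) \<le> real n" using n by (rule of_nat_mono)
      then show "5 * real ?m \<le> real n" by simp
    qed (use m in simp)
    have lam: "weight_A (real ?m) \<eta> i (next_index j) + weight_B (real ?m) \<eta> j i = 1/2 + turn_total \<eta> i / real ?m" for i j
      by (rule weight_A_B) (use m in simp)
    let ?lam = "\<lambda>i. 1/2 + turn_total \<eta> i / real ?m"
    define S where "S = ?lam I0 + ?lam I1 + ?lam I2 + ?lam I3"
    have V_eq: "V = (4 - S) / 2"
    proof -
      define d where "d = real ?m"
      have d: "d \<ge> 603" using m by (simp add: d_def)
      have "(4 - (?lam I0 + ?lam I1 + ?lam I2 + ?lam I3)) / 2 = 1 - (6 - \<eta>) / (2 * d)"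
        unfolding d_def[symmetric] using d by (simp add: field_simps)
      also have "\<dots> = V"
      proof -
        have "6 - \<eta> = 6 * (d - 1) / (d + 1)" unfolding \<eta>_def d_def[symmetric] using d by (simp add: field_simps)
        then have "(6 - \<eta>) / (2 * d) = 6 * (d - 1) / ((d + 1) * (2 * d))" by simp
        also have "\<dots> = 3 * (d - 1) / (d * (d + 1))"
        proof -
          have nz: "(d + 1) * (2 * d) \<noteq> 0" "d * (d + 1) \<noteq> 0" using d by auto
          show ?thesis unfolding frac_eq_eq[OF nz] by (simp add: algebra_simps)
        qed
        finally show ?thesis unfolding V_def d_def[symmetric] by simp
      qed
      finally show ?thesis unfolding S_def ..
    qed
    have "?m > 0" "n > 0" using n by simp_all
    from comm_length_lower_bound[OF \<phi> this wA wB lam k]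
    show "V * real k \<le> real (comm_length ?P (\<phi> word_c [^]\<^bsub>?P\<^esub> k))"
      unfolding S_def[symmetric] V_eq by (simp only: times_divide_eq_left mult.commute)
  next
    fix e :: real assume e: "e > 0"
    \<comment> \<open>The initial copy costs at most one commutator per copy of the whole block;
      spread over more than 1/e copies of the word, this is absorbed by the rate
      \<open>e\<close>.\<close>
    obtain M :: nat where M: "real M > 1 / e" using reals_Archimedean2 by blast
    define q where "q = 1 + M * (T.N * (T.N + 2))"
    obtain C where C: "\<And>j. T.comm_prod ((T.cost_W + real M * T.step_cost) * real (?m * j) / 2 + C)
        (\<phi> word_c [^]\<^bsub>?P\<^esub> (q * ?m * j))"
      using T.comm_prod_c_pow[of M] unfolding natural_hom_word_c_eq[OF \<phi> K1] q_def by blast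
    have "T.step_cost = 2 * V * (real T.N * (real T.N + 2))"
    proof -
      \<comment> \<open>This identity turns the cost of a round into 2 V per copy; halved by the
        normalisation of \<open>stable_cost\<close>, it is the rate V of the lower bound.\<close>
      have "real ?m + 1 = 2 * (real T.N + 2)" by simp
      then show ?thesis unfolding T.step_cost_eq V_mult[symmetric] by (simp add: algebra_simps)
    qed
    then have "(T.cost_W + real M * T.step_cost) / 2 = T.cost_W / 2 + V * (real q - 1)"
      by (simp add: q_def algebra_simps)
    also have "\<dots> \<le> 1 + V * real q" using V0 by (simp add: T.cost_W_def algebra_simps)
    also have "1 \<le> e * real q"
    proof -
      have "1 \<le> T.N * (T.N + 2)" using K1 by simp
      then have "M * 1 \<le> M * (T.N * (T.N + 2))" by (rule mult_le_mono2)
      then have "real M \<le> real q" unfolding q_def by (intro of_nat_mono) linarith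
      then have "1 / e \<le> real q" using M by linarith
      then show ?thesis using e by (simp add: field_simps)
    qed
    finally have rate: "(T.cost_W + real M * T.step_cost) / 2 \<le> (V + e) * real q"
      by (simp add: algebra_simps)
    have "T.comm_prod ((V + e) * real (q * ?m * j) + C) (\<phi> word_c [^]\<^bsub>?P\<^esub> (q * ?m * j))" for j
    proof (rule T.comm_prod_mono[OF C[of j]])
      have "(T.cost_W + real M * T.step_cost) / 2 * real (?m * j) \<le> (V + e) * real q * real (?m * j)"
        by (rule mult_right_mono[OF rate]) simp
      then show "(T.cost_W + real M * T.step_cost) * real (?m * j) / 2 + C \<le> (V + e) * real (q * ?m * j) + C"
        by (simp only: of_nat_mult)
    qed
    moreover have "q * ?m > 0" by (simp add: q_def)
    ultimately show "\<exists>d>0. \<exists>C. \<forall>j. T.comm_prod ((V + e) * real (d * j) + C) (\<phi> word_c [^]\<^bsub>?P\<^esub> (d * j))"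
      by blast
  qed
  then show ?thesis unfolding V_def .
qed

theorem proposition6p3:
  shows "\<exists>r s :: real. r \<ge> 1 \<and> s \<ge> 1 \<and>
    (\<forall>(o1::nat) (o2::nat) (K::int) (L::int) \<phi>.
      o1 \<ge> 2 \<longrightarrow> o2 \<ge> 2 \<longrightarrow>
      int o1 = 6 * K + 3 \<longrightarrow> int o2 = 6 * L + 3 \<longrightarrow>
      real_of_int L \<ge> r * real_of_int K \<longrightarrow> real_of_int K \<ge> s \<longrightarrow>
      natural_hom o1 o2 \<phi> \<longrightarrow>
      scl (cyclic_prod o1 o2) (\<phi> word_c) =
        1 - 3 * (real o1 - 1) / (real o1 * (real o1 + 1)))"
\<comment> \<open>Both constants are 100: for s this makes the first order large enough for the
  weights, and for r it gives \<open>o2\<close> \<ge> 5 \<open>o1\<close>.\<close>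
proof (intro exI[of _ 100] conjI allI impI)
  fix o1 o2 :: nat and K L :: int and \<phi>
  assume o: "int o1 = 6 * K + 3" "int o2 = 6 * L + 3"
    and KL: "100 * real_of_int K \<le> real_of_int L" "100 \<le> real_of_int K"
    and \<phi>: "natural_hom o1 o2 \<phi>"
  have "100 * K \<le> L" "100 \<le> K" using KL by linarith+
  then have "int (5 * (6 * nat K + 3)) \<le> int o2" "int o1 = int (6 * nat K + 3)" "nat K \<ge> 100" using o by simp_all
  then have "o1 = 6 * nat K + 3" "nat K \<ge> 100" "5 * (6 * nat K + 3) \<le> o2" by (simp_all only: of_nat_eq_iff of_nat_le_iff)
  then show "scl (cyclic_prod o1 o2) (\<phi> word_c) = 1 - 3 * (real o1 - 1) / (real o1 * (real o1 + 1))"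
    using scl_natural_hom_word_c[of "nat K" o2 \<phi>] \<phi> by simp
qed simp_all

end
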